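(* For every fixed $\delta>0$, $$\log W(x)\sim \log D_M(x)\sim \log S_{M,\delta}(x)\sim \log Z(x)\qquad\text{as } x\to\infty .$$
   Context: Let $\mu$ be the M\"obius function and $M(x)=\sum_{n\le x}\mu(n)$ for real $x\ge 0$ (so $M(x)=0$ for $x<1$). The letter $\varrho=\beta+i\gamma$ ($\beta,\gamma$ real) denotes non-trivial zeros of the Riemann zeta function $\zeta(s)$; sums over $\varrho$ count zeros with multiplicity. $\log$ is the natural logarithm. For $x>1$ define $$W(x)=\sum_{\varrho:\ |\gamma|\le x}\frac{x^{\beta}}{|\gamma|},\qquad Z(x)=\max_{\varrho:\ \gamma>0}\frac{x^{\beta}}{\gamma},\qquad D_M(x)=\frac1x\int_0^x|M(u)|\,du,$$ and, for fixed $\delta>0$, $$S_{M,\delta}(x)=\max_{x^{1-\delta}\le u\le x}|M(u)|.$$ $f(x)\sim g(x)$ as $x\to\infty$ means $f(x)/g(x)\to1$ as $x\to\infty$. *)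

theory Defs
  imports "HOL-Complex_Analysis.Complex_Analysis" "HOL-Computational_Algebra.Squarefree"
begin

section \<open>The Moebius function and its summatory function\<close>

definition moebius :: "nat \<Rightarrow> int" where
  "moebius n = (if squarefree n then (-1) ^ card (prime_factors n) else 0)"

definition mertens :: "real \<Rightarrow> real" where
  "mertens x = (\<Sum>n | 1 \<le> n \<and> real n \<le> x. real_of_int (moebius n))"


section \<open>The Riemann zeta function\<close>

text \<open>
  The unique analytic continuation of the Dirichlet series. The value at the pole \<open>1\<close> is
  left unspecified; existence of the continuation is shown in \<open>zeta_holomorphic\<close> and
  \<open>zeta_sums\<close>, and uniqueness away from \<open>1\<close> in \<open>zeta_unique\<close>.
\<close>

definition is_zeta :: "(complex \<Rightarrow> complex) \<Rightarrow> bool" where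
  "is_zeta f \<longleftrightarrow> f holomorphic_on - {1} \<and>
     (\<forall>s. Re s > 1 \<longrightarrow> (\<lambda>n. 1 / of_nat (Suc n) powr s) sums f s)"

definition zeta :: "complex \<Rightarrow> complex" where
  "zeta = (SOME f. is_zeta f)"

text \<open>
  The existence proof writes \<open>zeta s - 1 / (s - 1)\<close> in terms of the sums \<open>zkersum P s\<close>
  below and continues these by repeated integration by parts.
\<close>

definition zker :: "nat \<Rightarrow> real \<Rightarrow> complex \<Rightarrow> complex" where
  "zker n t s = exp (- s * of_real (ln (real (Suc n) + t)))"

definition zkerint :: "(real \<Rightarrow> real) \<Rightarrow> nat \<Rightarrow> complex \<Rightarrow> complex" where
  "zkerint P n s = integral (cbox 0 1) (\<lambda>t. of_real (P t) * zker n t s)"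

definition zkersum :: "(real \<Rightarrow> real) \<Rightarrow> complex \<Rightarrow> complex" where
  "zkersum P s = (\<Sum>n. zkerint P n s)"

lemma zker_1: "zker n 1 s = zker (Suc n) 0 s"
  by (simp add: zker_def add_ac)

lemma zker_0: "zker n 0 s = 1 / of_nat (Suc n) powr s"
proof -
  have "Ln (of_nat (Suc n)) = of_real (ln (real (Suc n)))"
    using Ln_of_real[of "real (Suc n)"] by (simp del: of_nat_Suc)
  thus ?thesis by (simp add: zker_def powr_def exp_minus inverse_eq_divide del: of_nat_Suc)
qed

lemma zker_plus1: "t \<ge> 0 \<Longrightarrow> zker n t (s + 1) = zker n t s / of_real (real (Suc n) + t)"
proof -
  assume "t \<ge> 0"
  hence *: "exp (of_real (ln (real (Suc n) + t))) = complex_of_real (real (Suc n) + t)"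
    by (subst exp_of_real) simp
  have "zker n t (s + 1) = exp (- s * of_real (ln (real (Suc n) + t)) - of_real (ln (real (Suc n) + t)))"
    unfolding zker_def by (rule arg_cong[of _ _ exp]) (simp add: algebra_simps)
  thus ?thesis unfolding exp_diff * by (simp only: zker_def)
qed

lemma continuous_on_zker [continuous_intros]: "continuous_on {0..1} (\<lambda>t. zker n t s)"
  unfolding zker_def by (intro continuous_intros) auto

lemma norm_zker_le:
  assumes "t \<ge> 0" "Re s \<ge> a" "a \<ge> 0"
  shows "norm (zker n t s) \<le> real (Suc n) powr (-a)"
proof -
  have "ln (real (Suc n)) \<le> ln (real (Suc n) + t)" "0 \<le> ln (real (Suc n))"
    using assms by auto
  hence "a * ln (real (Suc n)) \<le> Re s * ln (real (Suc n) + t)"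
    using assms by (intro mult_mono) auto
  thus ?thesis by (simp add: zker_def powr_def)
qed

lemma zkerint_holomorphic:
  assumes "continuous_on {0..1} P"
  shows "zkerint P n holomorphic_on UNIV"
  unfolding zkerint_def
proof (rule leibniz_rule_holomorphic)
  fix s :: complex and t :: real assume "t \<in> cbox 0 1"
  show "((\<lambda>s. of_real (P t) * zker n t s) has_field_derivative
          of_real (P t) * (- of_real (ln (real (Suc n) + t)) * zker n t s)) (at s within UNIV)"
    unfolding zker_def by (auto intro!: derivative_eq_intros)
next
  fix s :: complex
  show "(\<lambda>t. of_real (P t) * zker n t s) integrable_on cbox 0 1"
    using assms by (intro integrable_continuous) (auto intro!: continuous_intros)
next
  have *: "continuous_on (UNIV \<times> cbox 0 1) (\<lambda>x. P (snd x))" (is "continuous_on ?A _")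
    by (rule continuous_on_compose2[OF assms]) (auto intro!: continuous_intros)
  show "continuous_on ?A (\<lambda>(s, t). of_real (P t) * (- of_real (ln (real (Suc n) + t)) * zker n t s))"
    unfolding zker_def case_prod_unfold by (intro continuous_intros *) auto
qed auto

lemma zkerint_bound:
  assumes "continuous_on {0..1} P"
  obtains B where "\<And>n s a. Re s \<ge> a \<Longrightarrow> a \<ge> 0 \<Longrightarrow> norm (zkerint P n s) \<le> B * real (Suc n) powr (-a)"
proof -
  have "compact (P ` {0..1})"
    by (intro compact_continuous_image assms) auto
  hence "bounded (P ` {0..1})" by (rule compact_imp_bounded)
  then obtain B where B: "\<And>t. t \<in> {0..1} \<Longrightarrow> norm (P t) \<le> B"
    unfolding bounded_iff by blast
  have B0: "B \<ge> 0" using B[of 0] by auto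
  show ?thesis
  proof (rule that[of B])
    fix n s and a :: real assume a: "Re s \<ge> a" "a \<ge> 0"
    have "norm (zkerint P n s) \<le> B * real (Suc n) powr (-a) * measure lborel (cbox 0 (1::real))"
      unfolding zkerint_def
    proof (rule integrable_bound)
      show "(\<lambda>t. of_real (P t) * zker n t s) integrable_on cbox 0 1"
        using assms by (intro integrable_continuous) (auto intro!: continuous_intros)
      fix t :: real assume t: "t \<in> cbox 0 1"
      show "norm (of_real (P t) * zker n t s) \<le> B * real (Suc n) powr (-a)"
        unfolding norm_mult using B[of t] t B0 norm_zker_le[of t a s n] a
        by (intro mult_mono) auto
    qed (use B0 in auto)
    thus "norm (zkerint P n s) \<le> B * real (Suc n) powr (-a)" by simp
  qed
qed

lemma summable_Suc_powr: "a > 1 \<Longrightarrow> summable (\<lambda>n. B * real (Suc n) powr (-a))"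
  using summable_real_powr_iff[of "-a"]
    summable_Suc_iff[of "\<lambda>n. real n powr (-a)"]
  by (intro summable_mult) simp

lemma zkerint_summable:
  assumes "continuous_on {0..1} P" "Re s > 1"
  shows "summable (\<lambda>n. zkerint P n s)"
proof -
  obtain B where B: "\<And>n s a. Re s \<ge> a \<Longrightarrow> a \<ge> 0 \<Longrightarrow> norm (zkerint P n s) \<le> B * real (Suc n) powr (-a)"
    using zkerint_bound[OF assms(1)] by metis
  show ?thesis
    by (rule summable_comparison_test'[OF summable_Suc_powr[of "Re s" B], of 0])
       (use assms B[of "Re s" s] in auto)
qed

lemma zkersum_holomorphic:
  assumes "continuous_on {0..1} P"
  shows "zkersum P holomorphic_on {s. Re s > 1}"
proof (rule holomorphic_uniform_sequence[where f = "\<lambda>n s. \<Sum>i<n. zkerint P i s"])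
  obtain B where B: "\<And>n s a. Re s \<ge> a \<Longrightarrow> a \<ge> 0 \<Longrightarrow> norm (zkerint P n s) \<le> B * real (Suc n) powr (-a)"
    using zkerint_bound[OF assms(1)] by metis
  show "open {s. Re s > 1}" by (rule open_halfspace_Re_gt)
  show "(\<lambda>s. \<Sum>i<n. zkerint P i s) holomorphic_on {s. 1 < Re s}" for n
    by (intro holomorphic_intros holomorphic_on_subset[OF zkerint_holomorphic[OF assms]]) auto
  fix s assume s: "s \<in> {s. Re s > 1}"
  define d where "d = (Re s - 1) / 2"
  have d: "Re z \<ge> 1 + d" if "z \<in> cball s d" for z
    using that abs_Re_le_cmod[of "s - z"] by (auto simp: d_def dist_norm field_simps abs_if split: if_splits)
  have d0: "d > 0" using s by (auto simp: d_def)
  have "uniform_limit (cball s d) (\<lambda>n s. \<Sum>i<n. zkerint P i s) (\<lambda>s. \<Sum>i. zkerint P i s) sequentially"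
  proof (rule Weierstrass_m_test[OF _ summable_Suc_powr[of "1 + d" B]])
    show "norm (zkerint P n z) \<le> B * real (Suc n) powr (- (1 + d))" if "z \<in> cball s d" for n z
      using d0 by (intro B d that) auto
  qed (use d0 in auto)
  moreover have "cball s d \<subseteq> {s. Re s > 1}" using d d0 by force
  ultimately show "\<exists>d>0. cball s d \<subseteq> {s. 1 < Re s} \<and>
      uniform_limit (cball s d) (\<lambda>n s. \<Sum>i<n. zkerint P i s) (zkersum P) sequentially"
    using d0 unfolding zkersum_def by blast
qed

lemma zkerint_by_parts:
  assumes P: "continuous_on {0..1} P"
    and Q: "\<And>t. t \<in> {0..1} \<Longrightarrow> (Q has_vector_derivative P t) (at t within {0..1})"
  shows "zkerint P n s =
           of_real (Q 1) * zker (Suc n) 0 s - of_real (Q 0) * zker n 0 s + s * zkerint Q n (s + 1)"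
proof -
  have Qc: "continuous_on {0..1} Q"
    using Q by (meson continuous_on_eq_continuous_within has_vector_derivative_continuous)
  have "((\<lambda>t. of_real (P t) * zker n t s - s * (of_real (Q t) * zker n t (s + 1))) has_integral
          (of_real (Q 1) * zker n 1 s - of_real (Q 0) * zker n 0 s)) {0..1}"
  proof (rule fundamental_theorem_of_calculus)
    fix t :: real assume t: "t \<in> {0..1}"
    have 1: "((\<lambda>t. complex_of_real (Q t)) has_vector_derivative of_real (P t)) (at t within {0..1})"
      using Q[OF t] by (simp add: has_vector_derivative_of_real has_real_derivative_iff_has_vector_derivative)
    have "((\<lambda>t. ln (real (Suc n) + t)) has_real_derivative 1 / (real (Suc n) + t)) (at t within {0..1})"
      using t by (auto intro!: derivative_eq_intros)
    hence "((\<lambda>t. complex_of_real (ln (real (Suc n) + t))) has_vector_derivative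
              of_real (1 / (real (Suc n) + t))) (at t within {0..1})"
      by (intro has_vector_derivative_of_real) (simp add: has_real_derivative_iff_has_vector_derivative)
    hence "((\<lambda>t. - s * complex_of_real (ln (real (Suc n) + t))) has_vector_derivative
              - s * of_real (1 / (real (Suc n) + t))) (at t within {0..1})"
      by (rule has_vector_derivative_mult_right)
    moreover have "(exp has_field_derivative zker n t s)
        (at (- s * complex_of_real (ln (real (Suc n) + t))) within
            (\<lambda>t. - s * complex_of_real (ln (real (Suc n) + t))) ` {0..1})"
      unfolding zker_def by (rule DERIV_subset[OF DERIV_exp]) auto
    ultimately have "((exp \<circ> (\<lambda>t. - s * complex_of_real (ln (real (Suc n) + t)))) has_vector_derivative
              - s * of_real (1 / (real (Suc n) + t)) * zker n t s) (at t within {0..1})"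
      by (rule field_vector_diff_chain_within)
    hence 2: "((\<lambda>t. zker n t s) has_vector_derivative
              - s * of_real (1 / (real (Suc n) + t)) * zker n t s) (at t within {0..1})"
      by (simp add: zker_def o_def)
    have 3: "zker n t (s + 1) = zker n t s * of_real (1 / (real (Suc n) + t))"
      using t by (subst zker_plus1) auto
    show "((\<lambda>t. of_real (Q t) * zker n t s) has_vector_derivative
            of_real (P t) * zker n t s - s * (of_real (Q t) * zker n t (s + 1))) (at t within {0..1})"
      unfolding 3 using has_vector_derivative_mult[OF 1 2]
      by (simp add: algebra_simps)
  qed auto
  moreover have "((\<lambda>t. of_real (P t) * zker n t s - s * (of_real (Q t) * zker n t (s + 1))) has_integral
                   zkerint P n s - s * zkerint Q n (s + 1)) {0..1}"
    unfolding zkerint_def cbox_interval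
    by (intro has_integral_diff has_integral_mult_right integrable_integral
              integrable_continuous_real continuous_intros P Qc)
  ultimately have "zkerint P n s - s * zkerint Q n (s + 1) =
      of_real (Q 1) * zker n 1 s - of_real (Q 0) * zker n 0 s"
    using has_integral_unique by blast
  thus ?thesis by (simp add: zker_1 algebra_simps)
qed

lemma zker_tendsto_0:
  assumes "Re s > 0" shows "(\<lambda>n. zker n 0 s) \<longlonglongrightarrow> 0"
proof (rule Lim_null_comparison)
  show "\<forall>\<^sub>F n in sequentially. norm (zker n 0 s) \<le> real (Suc n) powr (- Re s)"
    using assms by (intro always_eventually allI norm_zker_le) auto
  show "(\<lambda>n. real (Suc n) powr (- Re s)) \<longlonglongrightarrow> 0"
    using assms by (intro tendsto_neg_powr filterlim_compose[OF filterlim_real_sequentially filterlim_Suc]) auto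
qed

lemma zkersum_step:
  assumes P: "continuous_on {0..1} P" "integral {0..1} P = 0"
  obtains Q c where "continuous_on {0..1} Q" "integral {0..1} Q = 0"
    "\<And>s. Re s > 1 \<Longrightarrow> zkersum P s = - of_real c + s * zkersum Q (s + 1)"
proof -
  define R where "R = (\<lambda>t. integral {0..t} P)"
  have R: "(R has_vector_derivative P t) (at t within {0..1})" if "t \<in> {0..1}" for t
    unfolding R_def using integral_has_vector_derivative[OF P(1) that] by simp
  define c where "c = - integral {0..1} R"
  define Q where "Q = (\<lambda>t. R t + c)"
  have Q: "(Q has_vector_derivative P t) (at t within {0..1})" if "t \<in> {0..1}" for t
    unfolding Q_def using R[OF that] by (auto intro!: derivative_eq_intros)
  have Rc: "continuous_on {0..1} R"
    using R by (meson continuous_on_eq_continuous_within has_vector_derivative_continuous)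
  have Qc: "continuous_on {0..1} Q" unfolding Q_def by (intro continuous_intros Rc)
  have "integral {0..1} Q = integral {0..1} R + c"
    unfolding Q_def by (subst integral_add) (auto intro!: integrable_continuous_real Rc)
  hence Q0: "integral {0..1} Q = 0" by (simp add: c_def)
  have ends: "Q 0 = c" "Q 1 = c" using P(2) by (auto simp: Q_def R_def)
  have "zkersum P s = - of_real c + s * zkersum Q (s + 1)" if s: "Re s > 1" for s
  proof -
    have "(\<lambda>n. zker (Suc n) 0 s - zker n 0 s) sums (0 - zker 0 0 s)"
      using s by (intro telescope_sums zker_tendsto_0) auto
    hence "(\<lambda>n. of_real c * (zker (Suc n) 0 s - zker n 0 s) + s * zkerint Q n (s + 1)) sums
             (of_real c * (0 - zker 0 0 s) + s * zkersum Q (s + 1))"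
      unfolding zkersum_def using s
      by (intro sums_add sums_mult summable_sums zkerint_summable Qc) auto
    also have "(\<lambda>n. of_real c * (zker (Suc n) 0 s - zker n 0 s) + s * zkerint Q n (s + 1)) =
               (\<lambda>n. zkerint P n s)"
      by (subst zkerint_by_parts[OF P(1) Q]) (auto simp: ends algebra_simps)
    finally show ?thesis
      unfolding zkersum_def[of P] by (simp add: sums_iff zker_def)
  qed
  with Qc Q0 show ?thesis by (rule that)
qed

lemma zkersum_continuation_halfplane:
  assumes "continuous_on {0..1} P" "integral {0..1} P = 0"
  shows "\<exists>f. f holomorphic_on {s. Re s > 1 - real m} \<and> (\<forall>s. Re s > 1 \<longrightarrow> f s = zkersum P s)"
  using assms
proof (induction m arbitrary: P)
  case 0
  thus ?case using zkersum_holomorphic[of P] by auto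
next
  case (Suc m)
  obtain Q c where Q: "continuous_on {0..1} Q" "integral {0..1} Q = 0"
    "\<And>s. Re s > 1 \<Longrightarrow> zkersum P s = - of_real c + s * zkersum Q (s + 1)"
    using zkersum_step[OF Suc.prems] by metis
  obtain f where f: "f holomorphic_on {s. Re s > 1 - real m}" "\<And>s. Re s > 1 \<Longrightarrow> f s = zkersum Q s"
    using Suc.IH[OF Q(1,2)] by blast
  have "f \<circ> (\<lambda>s. s + 1) holomorphic_on {s. Re s > 1 - real (Suc m)}"
    by (rule holomorphic_on_compose_gen[OF _ f(1)]) (auto intro!: holomorphic_intros)
  hence "(\<lambda>s. - of_real c + s * (f \<circ> (\<lambda>s. s + 1)) s) holomorphic_on {s. Re s > 1 - real (Suc m)}"
    by (intro holomorphic_intros)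
  moreover have "- of_real c + s * (f \<circ> (\<lambda>s. s + 1)) s = zkersum P s" if "Re s > 1" for s
    using Q(3)[OF that] f(2)[of "s + 1"] that by simp
  ultimately show ?case
    by (intro exI[of _ "\<lambda>s. - of_real c + s * (f \<circ> (\<lambda>s. s + 1)) s"]) simp
qed

lemma zkersum_continuation:
  assumes "continuous_on {0..1} P" "integral {0..1} P = 0"
  shows "\<exists>f. f holomorphic_on UNIV \<and> (\<forall>s. Re s > 1 \<longrightarrow> f s = zkersum P s)"
proof -
  define H where "H = (\<lambda>m::nat. {s. Re s > 1 - real m})"
  obtain F where F: "\<And>m. F m holomorphic_on H m" "\<And>m s. Re s > 1 \<Longrightarrow> F m s = zkersum P s"
    using zkersum_continuation_halfplane[OF assms] unfolding H_def by metis
  have agree: "F m s = F k s" if "m \<le> k" "s \<in> H m" for m k s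
  proof -
    have sub: "H m \<subseteq> H k" using that(1) by (auto simp: H_def)
    have "F m s - F k s = 0"
    proof (rule analytic_continuation[where f = "\<lambda>s. F m s - F k s" and S = "H m" and U = "{s. Re s > 1}" and \<xi> = 2])
      show "(\<lambda>s. F m s - F k s) holomorphic_on H m"
        by (intro holomorphic_intros F holomorphic_on_subset[OF F(1) sub])
      show "2 islimpt {s. Re s > 1}"
        by (rule open_imp_islimpt) (auto simp: open_halfspace_Re_gt)
    qed (use that F(2) in \<open>auto simp: H_def open_halfspace_Re_gt connected_halfspace_Re_gt\<close>)
    thus ?thesis by simp
  qed
  define f where "f = (\<lambda>s. F (nat \<lceil>2 - Re s\<rceil>) s)"
  have fF: "f s = F m s" if "s \<in> H m" for s m
  proof -
    have "s \<in> H (nat \<lceil>2 - Re s\<rceil>)" by (auto simp: H_def) linarith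
    thus ?thesis unfolding f_def using agree that by (metis nle_le)
  qed
  have "f holomorphic_on UNIV"
  proof (rule holomorphic_on_subset)
    show "f holomorphic_on (\<Union>m. H m)"
    proof (rule holomorphic_on_UN_open)
      fix m show "f holomorphic_on H m"
        using F(1)[of m] by (rule holomorphic_transform) (simp add: fF)
    qed (auto simp: H_def open_halfspace_Re_gt)
    show "UNIV \<subseteq> (\<Union>m. H m)"
    proof
      fix s :: complex
      have "s \<in> H (nat \<lceil>2 - Re s\<rceil>)" by (auto simp: H_def) linarith
      thus "s \<in> (\<Union>m. H m)" by blast
    qed
  qed
  moreover have "f s = zkersum P s" if "Re s > 1" for s
    unfolding f_def using F(2) that by blast
  ultimately show ?thesis by blast
qed

lemma zeta_series_eq_zkersum:
  assumes s: "Re s > 1"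
  shows "(\<lambda>n. 1 / of_nat (Suc n) powr s) sums
           (1 / (s - 1) + 1 / 2 - s * zkersum (\<lambda>t. t - 1 / 2) (s + 1))"
proof -
  have s1: "s \<noteq> 1" using s by auto
  define I where "I = (\<lambda>n. zkerint (\<lambda>_. 1) n s)"
  define J where "J = (\<lambda>n. zkerint (\<lambda>t. t - 1 / 2) n (s + 1))"
  have I1: "I n = (zker n 0 (s - 1) - zker (Suc n) 0 (s - 1)) / (s - 1)" for n
    using zkerint_by_parts[of "\<lambda>_. 0" "\<lambda>_. 1" n "s - 1"] s1
    by (simp add: I_def zkerint_def field_simps)
  have I2: "I n = (zker (Suc n) 0 s + zker n 0 s) / 2 + s * J n" for n
    unfolding I_def J_def by (subst zkerint_by_parts[where Q = "\<lambda>t. t - 1 / 2"])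
      (auto intro!: derivative_eq_intros simp: field_simps)
  have z0: "zker 0 0 z = 1" for z by (simp add: zker_def)
  have "(\<lambda>n. (zker n 0 (s - 1) - zker (Suc n) 0 (s - 1)) / (s - 1)) sums ((zker 0 0 (s - 1) - 0) / (s - 1))"
    using s by (intro sums_divide telescope_sums' zker_tendsto_0) auto
  hence I: "I sums (1 / (s - 1))" by (simp only: I1[abs_def] z0 diff_zero)
  have J: "J sums zkersum (\<lambda>t. t - 1 / 2) (s + 1)"
    unfolding J_def zkersum_def using s by (intro summable_sums zkerint_summable continuous_intros) auto
  have K: "(\<lambda>n. (zker n 0 s - zker (Suc n) 0 s) / 2) sums ((zker 0 0 s - 0) / 2)"
    using s by (intro sums_divide telescope_sums' zker_tendsto_0) auto
  have "(\<lambda>n. I n + (zker n 0 s - zker (Suc n) 0 s) / 2 - s * J n) sums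
          (1 / (s - 1) + (zker 0 0 s - 0) / 2 - s * zkersum (\<lambda>t. t - 1 / 2) (s + 1))"
    by (intro sums_add sums_diff sums_mult I J K)
  also have "(\<lambda>n. I n + (zker n 0 s - zker (Suc n) 0 s) / 2 - s * J n) = (\<lambda>n. zker n 0 s)"
    by (rule ext, subst I2) (simp add: add_divide_distrib diff_divide_distrib)
  finally have "(\<lambda>n. zker n 0 s) sums (1 / (s - 1) + (zker 0 0 s - 0) / 2 - s * zkersum (\<lambda>t. t - 1 / 2) (s + 1))" .
  moreover have "(\<lambda>n. zker n 0 s) = (\<lambda>n. 1 / of_nat (Suc n) powr s)" by (intro ext zker_0)
  ultimately show ?thesis by (simp only: z0 diff_zero)
qed

lemma ex_is_zeta: "\<exists>f. is_zeta f"
proof -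
  have "((\<lambda>t::real. t - 1 / 2) has_integral (1\<^sup>2 / 2 - 1 / 2 * 1) - (0\<^sup>2 / 2 - 1 / 2 * 0)) {0..1}"
    by (rule fundamental_theorem_of_calculus)
       (auto intro!: derivative_eq_intros simp flip: has_real_derivative_iff_has_vector_derivative)
  hence "integral {0..1} (\<lambda>t::real. t - 1 / 2) = 0"
    by (subst integral_unique) auto
  then obtain f where f: "f holomorphic_on UNIV"
      "\<And>s. Re s > 1 \<Longrightarrow> f s = zkersum (\<lambda>t. t - 1 / 2) s"
    using zkersum_continuation[of "\<lambda>t. t - 1 / 2"] continuous_on_diff[OF continuous_on_id continuous_on_const]
    by blast
  have "(\<lambda>s. f (s + 1)) holomorphic_on UNIV"
  proof -
    have "(\<lambda>s. s + 1) holomorphic_on (UNIV :: complex set)" by (intro holomorphic_intros)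
    from holomorphic_on_compose_gen[OF this f(1)] show ?thesis by (simp add: o_def)
  qed
  hence "(\<lambda>s. f (s + 1)) holomorphic_on - {1}" by (rule holomorphic_on_subset) simp
  hence "(\<lambda>s. 1 / (s - 1) + 1 / 2 - s * f (s + 1)) holomorphic_on - {1}"
    by (intro holomorphic_intros) auto
  moreover have "(\<lambda>n. 1 / of_nat (Suc n) powr s) sums (1 / (s - 1) + 1 / 2 - s * f (s + 1))"
    if "Re s > 1" for s
    using zeta_series_eq_zkersum[OF that] f(2)[of "s + 1"] that by simp
  ultimately show ?thesis unfolding is_zeta_def by blast
qed

lemma is_zeta_zeta: "is_zeta zeta"
  unfolding zeta_def using ex_is_zeta by (rule someI_ex)

lemma zeta_holomorphic: "zeta holomorphic_on - {1}"
  using is_zeta_zeta by (simp add: is_zeta_def)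

lemma zeta_sums: "Re s > 1 \<Longrightarrow> (\<lambda>n. 1 / of_nat (Suc n) powr s) sums zeta s"
  using is_zeta_zeta by (simp add: is_zeta_def)

lemma zeta_unique:
  assumes "is_zeta f" "s \<noteq> 1"
  shows "f s = zeta s"
proof -
  have "f s - zeta s = 0"
  proof (rule analytic_continuation[where f = "\<lambda>s. f s - zeta s" and S = "- {1}" and U = "{s. Re s > 1}" and \<xi> = 2])
    show "(\<lambda>s. f s - zeta s) holomorphic_on - {1}"
      using assms(1) by (intro holomorphic_intros zeta_holomorphic) (simp add: is_zeta_def)
    show "2 islimpt {s. Re s > 1}"
      by (rule open_imp_islimpt) (auto simp: open_halfspace_Re_gt)
    show "f z - zeta z = 0" if "z \<in> {s. Re s > 1}" for z
    proof -
      have "(\<lambda>n. 1 / of_nat (Suc n) powr z) sums f z"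
        using that assms(1) by (simp add: is_zeta_def)
      moreover have "(\<lambda>n. 1 / of_nat (Suc n) powr z) sums zeta z"
        using that by (intro zeta_sums) simp
      ultimately have "f z = zeta z" by (rule sums_unique2)
      thus ?thesis by simp
    qed
    show "connected (- {1::complex})"
      by (rule connected_punctured_universe) simp
    show "{s. Re s > 1} \<subseteq> - {1::complex}" by auto
  qed (use assms(2) in \<open>auto intro: open_Compl\<close>)
  thus ?thesis by simp
qed


section \<open>The quantities compared in the theorem\<close>

text \<open>All zeros of \<open>zeta\<close> outside the open critical strip are the trivial ones \<open>-2, -4, \<dots>\<close>\<close>

definition nontrivial_zeros :: "complex set" where
  "nontrivial_zeros = {s. 0 < Re s \<and> Re s < 1 \<and> zeta s = 0}"

text \<open>The factor \<open>zorder zeta r\<close> is the multiplicity of the zero \<open>r\<close>.\<close>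

definition W_fun :: "real \<Rightarrow> real" where
  "W_fun x = (\<Sum>r | r \<in> nontrivial_zeros \<and> \<bar>Im r\<bar> \<le> x.
            real_of_int (zorder zeta r) * (x powr Re r / \<bar>Im r\<bar>))"

text \<open>
  The index set is infinite, so the maximum is written as a supremum; it is attained because
  for fixed \<open>x\<close> only finitely many of the terms exceed a given positive bound.
\<close>

definition Z_fun :: "real \<Rightarrow> real" where
  "Z_fun x = (SUP r \<in> {r \<in> nontrivial_zeros. Im r > 0}. x powr Re r / Im r)"

definition D_M :: "real \<Rightarrow> real" where
  "D_M x = 1 / x * integral {0..x} (\<lambda>u. \<bar>mertens u\<bar>)"

text \<open>\<open>mertens\<close> is a step function, so the maximum is over a finite set of values.\<close>

definition S_M :: "real \<Rightarrow> real \<Rightarrow> real" where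
  "S_M \<delta> x = Max ((\<lambda>u. \<bar>mertens u\<bar>) ` {x powr (1 - \<delta>)..x})"

text \<open>
  The quotient form of asymptotic equivalence. Division by zero yields zero, so the limit \<open>1\<close>
  forces the denominator to be eventually nonzero.
\<close>

definition asymp_eq :: "(real \<Rightarrow> real) \<Rightarrow> (real \<Rightarrow> real) \<Rightarrow> bool" where
  "asymp_eq f g \<longleftrightarrow> ((\<lambda>x. f x / g x) \<longlongrightarrow> 1) at_top"

end

theory Submission
  imports Defs
begin

text \<open>
  Let \<open>\<Theta>\<close> be the supremum of the real parts of the nontrivial zeros. All four functions are
  \<open>x powr (\<Theta> + o(1))\<close>, and \<open>\<Theta> > 0\<close>, so all four logarithms are asymptotic to \<open>\<Theta> * ln x\<close>.

  For \<open>W\<close> and \<open>Z\<close> this follows from a single zero close to the supremum and from the bound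
  \<open>O(log T)\<close>, obtained by Jensen's inequality, for the number of zeros of ordinate between \<open>T\<close> and \<open>T + 1\<close>.

  For \<open>M\<close> the upper bound is Littlewood's: zeta has no zeros to the right of \<open>\<Theta>\<close>, hence
  \<open>1 / zeta\<close> is \<open>O(t powr \<epsilon>)\<close> there, and Perron's formula applies. The lower bound is a maximum principle
  argument: if \<open>M\<close> were small on average over \<open>[N powr (1 - \<delta>), N]\<close>, then a finite Dirichlet
  polynomial would approximate \<open>1 / zeta\<close> so well near a zero \<open>\<rho>\<close> with \<open>Re \<rho>\<close> close to \<open>\<Theta>\<close>
  that zeta could not vanish at \<open>\<rho>\<close>. One such average bound gives the lower bounds for \<open>D\<close> and \<open>S\<close>.

  That some nontrivial zero exists does not need the functional equation: without zeros the
  alternating zeta function would be \<open>O(t powr \<epsilon>)\<close> on the line \<open>Re s = 1 / 4\<close>, which contradicts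
  its correlation with \<open>\<Sum> (-1) ^ m * m powr s\<close> over \<open>X < m \<le> 2 * X\<close>.
\<close>

section \<open>The zeta function near the critical strip\<close>

text \<open>Landau's oscillation argument would give large values of \<open>M\<close> only along a
  sequence of \<open>x\<close>, whereas \<open>S_M\<close> and \<open>D_M\<close> must be bounded
  below for every large \<open>x\<close>. This is why the lower bound works at one fixed zero with a
  Dirichlet polynomial that depends on \<open>N\<close>. The existence of a zero enters twice:
  \<open>\<Theta> > 0\<close> excludes the form 0 / 0 when two logarithms are compared through
  \<open>ln x\<close>, and it leaves room for a disc of radius \<open>\<Theta> / 4\<close> around a
  zero inside \<open>Re s > 0\<close>. Zeros on the line \<open>Re s = 1\<close> have to be excluded
  separately, because \<open>nontrivial_zeros\<close> consists of points of the open strip. In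
  \<open>W\<close> the cut-off \<open>\<bar>\<gamma>\<bar> \<le> x\<close> allows the factor
  \<open>(x / \<bar>\<gamma>\<bar>) powr \<epsilon> \<ge> 1\<close> to be inserted; the remaining
  sum of \<open>\<bar>\<gamma>\<bar> powr (-1 - \<epsilon>)\<close> converges by the zero
  count.\<close>

definition zeta1 :: "complex \<Rightarrow> complex" where
  "zeta1 s = (if s = 1 then 1 else (s - 1) * zeta s)"

lemma zeta1_1 [simp]: "zeta1 1 = 1"
  by (simp add: zeta1_def)

lemma zeta_eq_zeta1: "s \<noteq> 1 \<Longrightarrow> zeta s = zeta1 s / (s - 1)"
  by (simp add: zeta1_def)

lemma holomorphic_on_shift:
  assumes "f holomorphic_on B" "\<And>s. s \<in> A \<Longrightarrow> s + c \<in> B"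
  shows "(\<lambda>s. f (s + c)) holomorphic_on A"
proof -
  have "(\<lambda>s. s + c) holomorphic_on A" by (intro holomorphic_intros)
  from holomorphic_on_compose_gen[OF this assms(1)] show ?thesis
    using assms(2) by (auto simp: o_def)
qed

lemma zkersum_bound:
  assumes "continuous_on {0..1} P" "a > 1"
  obtains B where "B \<ge> 0" "\<And>s. Re s \<ge> a \<Longrightarrow> norm (zkersum P s) \<le> B"
proof -
  obtain B where B: "\<And>n s a. Re s \<ge> a \<Longrightarrow> a \<ge> 0 \<Longrightarrow> norm (zkerint P n s) \<le> B * real (Suc n) powr (-a)"
    using zkerint_bound[OF assms(1)] by metis
  have bound: "norm (zkersum P s) \<le> (\<Sum>n. B * real (Suc n) powr (-a))" if "Re s \<ge> a" for s
    unfolding zkersum_def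
    using assms that by (intro norm_suminf_le summable_Suc_powr B) auto
  show ?thesis
  proof (rule that)
    show "max 0 (\<Sum>n. B * real (Suc n) powr (-a)) \<ge> 0" by simp
    show "Re s \<ge> a \<Longrightarrow> norm (zkersum P s) \<le> max 0 (\<Sum>n. B * real (Suc n) powr (-a))" for s
      using bound[of s] by linarith
  qed
qed

lemma half_mean: "continuous_on {0..1} (\<lambda>t::real. t - 1 / 2)"
  "integral {0..1} (\<lambda>t::real. t - 1 / 2) = 0"
proof -
  have "((\<lambda>t::real. t - 1 / 2) has_integral (1\<^sup>2 / 2 - 1 / 2 * 1) - (0\<^sup>2 / 2 - 1 / 2 * 0)) {0..1}"
    by (rule fundamental_theorem_of_calculus)
       (auto intro!: derivative_eq_intros simp flip: has_real_derivative_iff_has_vector_derivative)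
  thus "integral {0..1} (\<lambda>t::real. t - 1 / 2) = 0"
    by (subst integral_unique) auto
qed (intro continuous_intros)

text \<open>The Euler-Maclaurin formula for the Dirichlet series continues by itself once the
  sawtooth sums are replaced by their entire continuation \<open>f\<close>; by
  \<open>zeta_unique\<close> the result is the chosen \<open>zeta\<close>.\<close>

lemma zeta_entire_repr:
  obtains f where "f holomorphic_on UNIV"
    "\<And>s. Re s > 1 \<Longrightarrow> f s = zkersum (\<lambda>t. t - 1 / 2) s"
    "\<And>s. s \<noteq> 1 \<Longrightarrow> zeta s = 1 / (s - 1) + 1 / 2 - s * f (s + 1)"
proof -
  obtain f where f: "f holomorphic_on UNIV"
      "\<And>s. Re s > 1 \<Longrightarrow> f s = zkersum (\<lambda>t. t - 1 / 2) s"
    using zkersum_continuation[OF half_mean] by blast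
  have "(\<lambda>s. f (s + 1)) holomorphic_on - {1}"
    by (rule holomorphic_on_shift[OF f(1)]) auto
  hence "(\<lambda>s. 1 / (s - 1) + 1 / 2 - s * f (s + 1)) holomorphic_on - {1}"
    by (intro holomorphic_intros) auto
  moreover have "(\<lambda>n. 1 / of_nat (Suc n) powr s) sums (1 / (s - 1) + 1 / 2 - s * f (s + 1))"
    if "Re s > 1" for s
    using zeta_series_eq_zkersum[OF that] f(2)[of "s + 1"] that by simp
  ultimately have "is_zeta (\<lambda>s. 1 / (s - 1) + 1 / 2 - s * f (s + 1))"
    unfolding is_zeta_def by blast
  from zeta_unique[OF this] show ?thesis
    by (intro that[OF f]) auto
qed

lemma zeta1_repr:
  obtains f where "f holomorphic_on UNIV"
    "\<And>s. Re s > 1 \<Longrightarrow> f s = zkersum (\<lambda>t. t - 1 / 2) s"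
    "\<And>s. zeta1 s = 1 + (s - 1) / 2 - s * (s - 1) * f (s + 1)"
proof -
  obtain f where f: "f holomorphic_on UNIV"
    "\<And>s. Re s > 1 \<Longrightarrow> f s = zkersum (\<lambda>t. t - 1 / 2) s"
    "\<And>s. s \<noteq> 1 \<Longrightarrow> zeta s = 1 / (s - 1) + 1 / 2 - s * f (s + 1)"
    using zeta_entire_repr by metis
  show ?thesis
    by (rule that[OF f(1,2)]) (auto simp: zeta1_def f(3) field_simps)
qed

text \<open>The pole of zeta at 1 is simple with residue 1, the value prescribed for
  \<open>zeta1\<close> there. Zero-free half-planes can then be stated for \<open>zeta1\<close> with
  no exception at 1, where the value of \<open>zeta\<close> is unspecified.\<close>

lemma zeta1_entire: "zeta1 holomorphic_on UNIV"
proof -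
  obtain f where f: "f holomorphic_on UNIV"
    "\<And>s. zeta1 s = 1 + (s - 1) / 2 - s * (s - 1) * f (s + 1)"
    using zeta1_repr by metis
  have "(\<lambda>s. f (s + 1)) holomorphic_on UNIV"
    by (rule holomorphic_on_shift[OF f(1)]) auto
  hence "(\<lambda>s. 1 + (s - 1) / 2 - s * (s - 1) * f (s + 1)) holomorphic_on UNIV"
    by (intro holomorphic_intros) auto
  moreover have "zeta1 = (\<lambda>s. 1 + (s - 1) / 2 - s * (s - 1) * f (s + 1))"
    using f(2) by blast
  ultimately show ?thesis by simp
qed

lemma zeta1_holomorphic [holomorphic_intros]: "zeta1 holomorphic_on S"
  using zeta1_entire holomorphic_on_subset by blast

lemma zeta1_continuous: "continuous_on S zeta1"
  by (intro holomorphic_on_imp_continuous_on zeta1_holomorphic)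

text \<open>One integration by parts continues \<open>f\<close> explicitly to
  \<open>Re s > 0\<close>, so \<open>f (s + 1)\<close> is under control for
  \<open>Re s \<ge> - 1 / 2\<close>. The exponent 3 collects the factors \<open>s\<close> and
  \<open>s - 1\<close> and the factor \<open>s + 1\<close> produced by that integration.\<close>

lemma zeta1_growth:
  obtains C where "C > 0" "\<And>s. Re s \<ge> - 1 / 2 \<Longrightarrow> norm (zeta1 s) \<le> C * (1 + norm s) ^ 3"
proof -
  obtain f where f: "f holomorphic_on UNIV"
    "\<And>s. Re s > 1 \<Longrightarrow> f s = zkersum (\<lambda>t. t - 1 / 2) s"
    "\<And>s. zeta1 s = 1 + (s - 1) / 2 - s * (s - 1) * f (s + 1)"
    using zeta1_repr by metis
  obtain Q c where Q: "continuous_on {0..1} Q" "integral {0..1} Q = 0"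
    "\<And>s. Re s > 1 \<Longrightarrow> zkersum (\<lambda>t. t - 1 / 2) s = - of_real c + s * zkersum Q (s + 1)"
    using zkersum_step[OF half_mean] by metis
  have cont: "f s = - of_real c + s * zkersum Q (s + 1)" if "Re s > 0" for s
  proof -
    have "(\<lambda>s. zkersum Q (s + 1)) holomorphic_on {s. Re s > 0}"
      by (rule holomorphic_on_shift[OF zkersum_holomorphic[OF Q(1)]]) auto
    hence hol: "(\<lambda>s. f s - (- of_real c + s * zkersum Q (s + 1))) holomorphic_on {s. Re s > 0}"
      by (intro holomorphic_intros holomorphic_on_subset[OF f(1)]) auto
    have "f s - (- of_real c + s * zkersum Q (s + 1)) = 0"
    proof (rule analytic_continuation[OF hol, where U = "{s. Re s > 1}" and \<xi> = 2])
      show "2 islimpt {s. Re s > 1}"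
        by (rule open_imp_islimpt) (auto simp: open_halfspace_Re_gt)
      fix z assume "z \<in> {s. Re s > 1}"
      thus "f z - (- of_real c + z * zkersum Q (z + 1)) = 0"
        using Q(3) f(2) by simp
    qed (use that in \<open>auto simp: open_halfspace_Re_gt connected_halfspace_Re_gt\<close>)
    thus ?thesis by simp
  qed
  obtain B where B: "B \<ge> 0" "\<And>s. Re s \<ge> 3 / 2 \<Longrightarrow> norm (zkersum Q s) \<le> B"
    by (rule zkersum_bound[OF Q(1), of "3/2"]) auto
  show ?thesis
  proof (rule that)
    show "2 + (\<bar>c\<bar> + 2 * B) > 0" using B by simp
    fix s :: complex assume s: "Re s \<ge> - 1 / 2"
    define x where "x = norm s"
    have x: "x \<ge> 0" by (simp add: x_def)
    have fs: "norm (f (s + 1)) \<le> \<bar>c\<bar> + (x + 1) * B"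
    proof -
      have "norm (f (s + 1)) \<le> norm (complex_of_real c) + norm ((s + 1) * zkersum Q (s + 1 + 1))"
        using s norm_triangle_ineq[of "- complex_of_real c" "(s + 1) * zkersum Q (s + 1 + 1)"]
        by (subst cont) auto
      also have "norm ((s + 1) * zkersum Q (s + 1 + 1)) \<le> (x + 1) * B"
        unfolding norm_mult x_def using B s norm_triangle_ineq[of s 1] by (intro mult_mono) auto
      finally show ?thesis by simp
    qed
    have s1: "norm (s - 1) \<le> x + 1" using norm_triangle_ineq4[of s 1] by (simp add: x_def)
    have "norm (zeta1 s) \<le> norm (1 + (s - 1) / 2) + norm (s * (s - 1) * f (s + 1))"
      unfolding f(3) by (rule norm_triangle_ineq4)
    also have "norm (1 + (s - 1) / 2) \<le> 1 + (x + 1) / 2"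
      by (rule order_trans[OF norm_triangle_ineq]) (use s1 in \<open>simp add: norm_divide\<close>)
    also have "norm (s * (s - 1) * f (s + 1)) \<le> x * (x + 1) * (\<bar>c\<bar> + (x + 1) * B)"
      unfolding norm_mult using s1 fs x B by (intro mult_mono) (auto simp: x_def)
    also have "1 + (x + 1) / 2 + x * (x + 1) * (\<bar>c\<bar> + (x + 1) * B) \<le> (2 + (\<bar>c\<bar> + 2 * B)) * (1 + x) ^ 3"
    proof -
      define y where "y = 1 + x"
      have y: "y \<ge> 1" using x by (simp add: y_def)
      have "1 \<le> y ^ 3" "y \<le> y ^ 3"
        using y self_le_power[OF y, of 3] by auto
      moreover have "x * y * \<bar>c\<bar> \<le> y ^ 2 * \<bar>c\<bar>"
        using y x by (intro mult_right_mono) (auto simp: y_def power2_eq_square)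
      moreover have "y ^ 2 * \<bar>c\<bar> \<le> y ^ 3 * \<bar>c\<bar>"
        using y by (intro mult_right_mono power_increasing) auto
      moreover have "x * y * (y * B) \<le> y ^ 3 * B"
      proof -
        have "(x * y * y) * B \<le> (y * y * y) * B"
          using y x B by (intro mult_right_mono) (auto simp: y_def)
        thus ?thesis by (simp add: power3_eq_cube mult.assoc)
      qed
      moreover have "0 \<le> y ^ 3 * B" using y B by simp
      ultimately have "1 + y / 2 + x * y * (\<bar>c\<bar> + y * B) \<le> (2 + (\<bar>c\<bar> + 2 * B)) * y ^ 3"
        by (simp add: algebra_simps)
      thus ?thesis by (simp add: y_def add_ac)
    qed
    finally show "norm (zeta1 s) \<le> (2 + (\<bar>c\<bar> + 2 * B)) * (1 + norm s) ^ 3"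
      by (simp add: x_def)
  qed
qed

text \<open>Conjugating both argument and value gives another function satisfying
  \<open>is_zeta\<close>, hence the same function away from 1.\<close>

lemma zeta_cnj:
  assumes "s \<noteq> 1" shows "zeta (cnj s) = cnj (zeta s)"
proof -
  have "is_zeta (cnj \<circ> zeta \<circ> cnj)"
    unfolding is_zeta_def
  proof (intro conjI allI impI)
    show "cnj \<circ> zeta \<circ> cnj holomorphic_on - {1}"
      by (rule holomorphic_on_compose_cnj_cnj) 
        (auto simp: zeta_holomorphic image_def complex_eq_iff intro!: holomorphic_on_subset[OF zeta_holomorphic])
    fix s assume "1 < Re s"
    hence "(\<lambda>n. cnj (1 / of_nat (Suc n) powr (cnj s))) sums cnj (zeta (cnj s))"
      by (subst sums_cnj) (intro zeta_sums, simp)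
    also have "(\<lambda>n. cnj (1 / of_nat (Suc n) powr (cnj s))) = (\<lambda>n. 1 / of_nat (Suc n) powr s)"
      by (auto simp: cnj_powr simp del: of_nat_Suc)
    finally show "(\<lambda>n. 1 / of_nat (Suc n) powr s) sums (cnj \<circ> zeta \<circ> cnj) s"
      by simp
  qed
  from zeta_unique[OF this assms] show ?thesis
    by (metis complex_cnj_cnj comp_apply)
qed

text \<open>Adding \<open>1 / 2\<close> to the sawtooth turns it into the fractional part, whose
  integrals against the positive kernel are nonnegative, and adds \<open>1 / (2 * s)\<close> to the
  sum. This gives \<open>zeta x \<le> x / (x - 1) < 0\<close>. The ordinates that occur as
  denominators in \<open>W_fun\<close> are therefore nonzero.\<close>

lemma zeta_real_nonzero:
  assumes "0 < x" "x < 1"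
  shows "zeta (of_real x) \<noteq> 0"
proof -
  define s where "s = complex_of_real x"
  obtain f where f: 
    "\<And>s. Re s > 1 \<Longrightarrow> f s = zkersum (\<lambda>t. t - 1 / 2) s"
    "\<And>s. s \<noteq> 1 \<Longrightarrow> zeta s = 1 / (s - 1) + 1 / 2 - s * f (s + 1)"
    using zeta_entire_repr by metis
  have s1: "s \<noteq> 1" using assms by (auto simp: s_def)
  have z: "zeta s = 1 / (s - 1) + 1 / 2 - s * zkersum (\<lambda>t. t - 1 / 2) (s + 1)"
    using f(2)[OF s1] f(1)[of "s+1"] assms by (simp add: s_def)
  have I1: "zkerint (\<lambda>_. 1) n (s + 1) = (zker n 0 s - zker (Suc n) 0 s) / s" for n
    using zkerint_by_parts[of "\<lambda>_. 0" "\<lambda>_. 1" n "s"] assms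
    by (simp add: zkerint_def field_simps s_def)
  have "(\<lambda>n. (zker n 0 s - zker (Suc n) 0 s) / s) sums ((zker 0 0 s - 0) / s)"
    using assms by (intro sums_divide telescope_sums' zker_tendsto_0) (auto simp: s_def)
  hence sum1: "(\<lambda>n. zkerint (\<lambda>_. 1) n (s + 1)) sums (1 / s)"
    by (simp add: I1 zker_def)
  have sP: "(\<lambda>n. zkerint (\<lambda>t. t - 1/2) n (s + 1)) sums zkersum (\<lambda>t. t - 1 / 2) (s + 1)"
    unfolding zkersum_def using assms by (intro summable_sums zkerint_summable half_mean) (auto simp: s_def)
  have Iid: "zkerint (\<lambda>t. t - 1/2) n (s + 1) = zkerint (\<lambda>t. t) n (s + 1) - 1/2 * zkerint (\<lambda>_. 1) n (s + 1)" for n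
  proof -
    have "integral (cbox 0 1) (\<lambda>t. complex_of_real (t - 1/2) * zker n t (s + 1)) = 
       integral (cbox 0 1) (\<lambda>t. of_real t * zker n t (s + 1) - 1/2 * (of_real 1 * zker n t (s + 1)))"
      by (rule arg_cong[of _ _ "integral _"]) (auto simp: algebra_simps)
    also have "\<dots> = integral (cbox 0 1) (\<lambda>t. of_real t * zker n t (s + 1)) - integral (cbox 0 1) (\<lambda>t. 1/2 * (of_real 1 * zker n t (s + 1)))"
      by (intro integral_diff integrable_continuous) (auto intro!: continuous_intros)
    also have "integral (cbox 0 1) (\<lambda>t. 1/2 * (of_real 1 * zker n t (s + 1))) = 1/2 * integral (cbox 0 1) (\<lambda>t. of_real 1 * zker n t (s + 1))"
      by (rule integral_mult_right)
    finally show ?thesis by (simp add: zkerint_def)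
  qed
  have pos: "Re (zkerint (\<lambda>t. t) n (s + 1)) \<ge> 0" for n
  proof -
    have int: "(\<lambda>t. complex_of_real t * zker n t (s + 1)) integrable_on cbox 0 1"
      by (intro integrable_continuous) (auto intro!: continuous_intros)
    have "Re (zkerint (\<lambda>t. t) n (s + 1)) = integral (cbox 0 1) (\<lambda>t. Re (complex_of_real t * zker n t (s + 1)))"
      unfolding zkerint_def using integral_linear[OF int bounded_linear_Re] by (simp add: o_def)
    also have "\<dots> \<ge> 0"
    proof (rule integral_nonneg)
      show "(\<lambda>t. Re (complex_of_real t * zker n t (s + 1))) integrable_on cbox 0 1"
        using integrable_linear[OF int bounded_linear_Re] by (simp add: o_def)
      fix t :: real assume t: "t \<in> cbox 0 1"
      have "zker n t (s + 1) = of_real (exp (- (x + 1) * ln (real (Suc n) + t)))"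
        unfolding zker_def s_def by (simp flip: exp_of_real)
      thus "0 \<le> Re (complex_of_real t * zker n t (s + 1))" using t by auto
    qed
    finally show ?thesis .
  qed
  have "(\<lambda>n. Re (zkerint (\<lambda>t. t - 1/2) n (s + 1) + 1/2 * zkerint (\<lambda>_. 1) n (s + 1))) sums 
     Re (zkersum (\<lambda>t. t - 1 / 2) (s + 1) + 1/2 * (1 / s))"
    by (intro sums_Re sums_add sums_mult sP sum1)
  from sums_le[OF _ sums_zero this] have "Re (zkersum (\<lambda>t. t - 1 / 2) (s + 1) + 1/2 * (1 / s)) \<ge> 0"
    using pos Iid by simp
  hence ge: "Re (zkersum (\<lambda>t. t - 1 / 2) (s + 1)) \<ge> - 1 / (2 * x)"
    by (simp add: s_def)
  have "Re (zeta s) = 1 / (x - 1) + 1 / 2 - x * Re (zkersum (\<lambda>t. t - 1 / 2) (s + 1))"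
  proof -
    have "1 / (s - 1) = complex_of_real (1 / (x - 1))" by (simp add: s_def)
    hence "Re (1 / (s - 1)) = 1 / (x - 1)" by (metis Re_complex_of_real)
    moreover have "Re (s * z) = x * Re z" for z by (simp add: s_def)
    ultimately show ?thesis unfolding z by (simp del: times_complex.simps)
  qed
  also have "\<dots> \<le> 1 / (x - 1) + 1 / 2 - x * (- 1 / (2 * x))"
    using ge assms by (intro diff_left_mono mult_left_mono) auto
  also have "\<dots> = x / (x - 1)" using assms by (simp add: field_simps)
  also have "\<dots> < 0" using assms by (simp add: divide_pos_neg)
  finally show ?thesis by (auto simp: s_def)
qed

section \<open>Euler product and non-vanishing on the line of abscissa one\<close>

definition npow :: "nat \<Rightarrow> complex \<Rightarrow> complex" where
  "npow n s = of_nat n powr (- s)"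

lemma npow_mult: "npow (m * n) s = npow m s * npow n s"
  by (simp add: npow_def powr_times_real)

lemma npow_1 [simp]: "npow (Suc 0) s = 1"
  by (simp add: npow_def)

lemma npow_prod: "npow (prod f A) s = (\<Prod>x\<in>A. npow (f x) s)"
  by (induction A rule: infinite_finite_induct) (auto simp: npow_mult)

lemma norm_npow: "n > 0 \<Longrightarrow> norm (npow n s) = real n powr (- Re s)"
  unfolding npow_def using norm_powr_real_powr[of "of_nat n" "-s"] by simp

lemma npow_holomorphic [holomorphic_intros]: "n > 0 \<Longrightarrow> npow n holomorphic_on S"
  unfolding npow_def by (auto intro!: holomorphic_intros)

lemma npow_add: "npow n (s + t) = npow n s * npow n t"
  by (simp add: npow_def powr_def algebra_simps flip: exp_add)

lemma summable_on_powr: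
  assumes "a > 1" shows "(\<lambda>n. real n powr (-a)) summable_on {1..}"
proof -
  have "summable (\<lambda>n. real (Suc n) powr (-a))"
    using summable_Suc_powr[OF assms, of 1] by simp
  hence "(\<lambda>n. real (Suc n) powr (-a)) summable_on UNIV"
    by (intro norm_summable_imp_summable_on) simp
  hence "(\<lambda>n. real n powr (-a)) summable_on (Suc ` UNIV)"
    by (subst summable_on_reindex) (auto simp: o_def)
  also have "Suc ` UNIV = {1..}" by (auto simp: image_iff Suc_le_eq gr0_conv_Suc)
  finally show ?thesis .
qed

lemma npow_abs_summable:
  assumes "Re s > 1" shows "(\<lambda>n. norm (npow n s)) summable_on {1..}"
  using summable_on_powr[OF assms] by (rule summable_on_cong[THEN iffD1, rotated]) (simp add: norm_npow)

lemma zeta_has_sum: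
  assumes "Re s > 1" shows "((\<lambda>n. npow n s) has_sum zeta s) {1..}"
proof -
  have eq: "1 / of_nat (Suc n) powr s = npow (Suc n) s" for n
    by (simp add: npow_def powr_minus inverse_eq_divide)
  have "summable (\<lambda>n. real (Suc n) powr (-Re s))"
    using summable_Suc_powr[OF assms, of 1] by simp
  hence "summable (\<lambda>n. norm (npow (Suc n) s))"
    by (simp add: norm_npow)
  moreover have "(\<lambda>n. npow (Suc n) s) sums zeta s"
    using zeta_sums[OF assms] unfolding eq .
  ultimately have "((\<lambda>n. npow (Suc n) s) has_sum zeta s) UNIV"
    by (rule norm_summable_imp_has_sum)
  hence "((\<lambda>n. npow n s) has_sum zeta s) (Suc ` UNIV)"
    by (subst has_sum_reindex) (auto simp: o_def)
  also have "Suc ` UNIV = {1..}" by (auto simp: image_iff Suc_le_eq gr0_conv_Suc)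
  finally show ?thesis .
qed

section \<open>Moebius inversion, the series of \<open>1 / zeta\<close> and the Euler
  product\<close>

lemma abs_moebius_le: "\<bar>moebius n\<bar> \<le> 1"
  by (auto simp: moebius_def power_abs)

lemma prod_primes:
  fixes A :: "nat set"
  assumes "finite A" "\<And>p. p \<in> A \<Longrightarrow> prime p"
  shows "prime_factors (\<Prod>A) = A" "squarefree (\<Prod>A)" "moebius (\<Prod>A) = (-1) ^ card A"
proof -
  have "0 \<notin> A" using assms(2)[of 0] by auto
  hence "prime_factors (\<Prod>A) = (\<Union>p\<in>A. prime_factors p)"
    using assms prime_factors_prod[of A "\<lambda>x. x"] by (simp add: o_def)
  also have "\<dots> = A" using assms by (auto simp: prime_factorization_prime)
  finally show *: "prime_factors (\<Prod>A) = A" .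
  show "squarefree (\<Prod>A)"
    by (rule squarefree_prod_coprime) (use assms squarefree_prime in \<open>auto intro!: primes_coprime\<close>)
  thus "moebius (\<Prod>A) = (-1) ^ card A" by (simp add: moebius_def *)
qed

lemma squarefree_prod_prime_factors:
  assumes "squarefree (n::nat)" shows "\<Prod>(prime_factors n) = n"
proof -
  have n: "n > 0" using assms by (auto intro!: Nat.gr0I)
  have "n = (\<Prod>p \<in> prime_factors n. p ^ multiplicity p n)" by (rule prime_factorization_nat[OF n])
  also have "\<dots> = (\<Prod>p \<in> prime_factors n. p)"
    using assms n squarefree_factorial_semiring'[of n] by (intro prod.cong) auto
  finally show ?thesis by simp
qed

text \<open>A squarefree number is determined by its set of prime factors. Through this bijection
  both the divisor sum of the Moebius function and the finite Euler products become expansions of a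
  product over a finite set of primes.\<close>

lemma sum_squarefree:
  fixes P :: "nat set" and f :: "nat \<Rightarrow> 'a :: comm_monoid_add"
  assumes "finite P" "\<And>p. p \<in> P \<Longrightarrow> prime p"
  shows "(\<Sum>n | squarefree n \<and> prime_factors n \<subseteq> P. f n) = (\<Sum>A\<in>Pow P. f (\<Prod>A))"
proof (rule sum.reindex_bij_witness[of _ "\<lambda>A. \<Prod>A" prime_factors])
  fix A assume A: "A \<in> Pow P"
  hence "finite A" "\<And>p. p \<in> A \<Longrightarrow> prime p" using assms finite_subset by auto
  from prod_primes[OF this] A show "prime_factors (\<Prod>A) = A" 
    "\<Prod>A \<in> {n. squarefree n \<and> prime_factors n \<subseteq> P}" by auto
qed (auto simp: squarefree_prod_prime_factors)

text \<open>Only squarefree divisors contribute, and these are the products over subsets of the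
  prime factors of \<open>n\<close>. The signed sum over subsets expands a product of factors
  \<open>1 - 1\<close>, which is empty exactly for \<open>n = 1\<close>.\<close>

lemma sum_moebius_divisors:
  assumes "n > 0"
  shows "(\<Sum>d | d dvd n. moebius d) = (if n = 1 then 1 else 0)"
proof -
  let ?P = "prime_factors n"
  have fin: "finite {d. d dvd n}" using assms by simp
  have "(\<Sum>d | d dvd n. moebius d) = (\<Sum>d | squarefree d \<and> prime_factors d \<subseteq> ?P. moebius d)"
  proof (rule sum.mono_neutral_cong_right[OF fin])
    show "{d. squarefree d \<and> prime_factors d \<subseteq> ?P} \<subseteq> {d. d dvd n}"
    proof safe
      fix d assume d: "squarefree d" "prime_factors d \<subseteq> ?P"
      have d0: "d \<noteq> 0" using d by (metis not_squarefree_0)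
      show "d dvd n"
      proof (rule multiplicity_le_imp_dvd[OF d0])
        fix p :: nat assume p: "prime p"
        show "multiplicity p d \<le> multiplicity p n"
        proof (cases "p \<in> prime_factors d")
          case True
          hence "multiplicity p n > 0" using d(2) by (auto simp: prime_factors_multiplicity)
          moreover have "multiplicity p d \<le> 1"
            using d(1) p squarefree_factorial_semiring''[OF d0] by auto
          ultimately show ?thesis by linarith
        next
          case False
          thus ?thesis using p d0 by (auto simp: prime_factors_multiplicity)
        qed
      qed
    qed
  qed (use assms dvd_prime_factors in \<open>auto simp: moebius_def\<close>)
  also have "\<dots> = (\<Sum>A\<in>Pow ?P. moebius (\<Prod>A))"
    by (rule sum_squarefree) auto
  also have "\<dots> = (\<Sum>A\<in>Pow ?P. (-1) ^ card A * (\<Prod>x\<in>A. 1) * (\<Prod>x\<in>?P-A. 1))"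
  proof (rule sum.cong[OF refl])
    fix A assume "A \<in> Pow ?P"
    hence "finite A" "\<And>p. p \<in> A \<Longrightarrow> prime p" using finite_subset by auto
    from prod_primes(3)[OF this] show "moebius (\<Prod>A) = (-1) ^ card A * (\<Prod>x\<in>A. 1) * (\<Prod>x\<in>?P-A. 1)" by simp
  qed
  also have "\<dots> = (\<Prod>p\<in>?P. 1 - 1)"
    by (subst prod_diff_conv_sum) auto
  also have "\<dots> = (if n = 1 then 1 else 0)"
    using assms prime_factorization_empty_iff[of n] by (auto simp: power_0_left)
  finally show ?thesis .
qed

lemma moebius_abs_summable:
  assumes "Re s > 1"
  shows "(\<lambda>n. norm (of_int (moebius n) * npow n s)) summable_on {1..}"
proof (rule summable_on_comparison_test[OF npow_abs_summable[OF assms]])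
  fix n show "norm (of_int (moebius n) * npow n s) \<le> norm (npow n s)"
    using abs_moebius_le[of n] by (auto simp: norm_mult intro!: mult_left_le_one_le)
qed auto

text \<open>Both series converge absolutely, so their product may be regrouped along
  \<open>n = a * b\<close>; the inner sums are the divisor sums just computed. The product being 1
  also shows that zeta has no zero in \<open>Re s > 1\<close>.\<close>

lemma moebius_has_sum:
  assumes "Re s > 1"
  shows "zeta s \<noteq> 0" "((\<lambda>n. of_int (moebius n) * npow n s) has_sum (1 / zeta s)) {1..}"
proof -
  define f where "f = (\<lambda>n. of_int (moebius n) * npow n s)"
  define g where "g = (\<lambda>n. npow n s)"
  define F where "F = infsum f {1..}"
  have fs: "(\<lambda>n. norm (f n)) summable_on {1..}" unfolding f_def by (rule moebius_abs_summable[OF assms])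
  have f: "(f has_sum F) {1..}"
    unfolding F_def by (rule has_sum_infsum[OF abs_summable_summable[OF fs]])
  have gs: "(\<lambda>n. norm (g n)) summable_on {1..}" unfolding g_def by (rule npow_abs_summable[OF assms])
  have g: "(g has_sum zeta s) {1..}" unfolding g_def by (rule zeta_has_sum[OF assms])
  have "(\<lambda>(a,b). norm (f a * g b)) summable_on {1..} \<times> {1..}"
  proof (rule summable_on_SigmaI)
    show "((\<lambda>b. case (a, b) of (a, b) \<Rightarrow> norm (f a * g b)) has_sum norm (f a) * infsum (\<lambda>b. norm (g b)) {1..}) {1..}" for a
      unfolding norm_mult prod.case by (intro has_sum_cmult_right has_sum_infsum gs)
    show "(\<lambda>a. norm (f a) * infsum (\<lambda>b. norm (g b)) {1..}) summable_on {1..}"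
      by (intro summable_on_cmult_left fs)
  qed auto
  hence "(\<lambda>(a,b). f a * g b) summable_on {1..} \<times> {1..}"
    by (subst abs_summable_summable) (simp_all add: case_prod_unfold)
  moreover have "((\<lambda>b. f a * g b) has_sum f a * zeta s) {1..}" for a
    by (intro has_sum_cmult_right g)
  moreover have "((\<lambda>a. f a * zeta s) has_sum F * zeta s) {1..}"
    by (intro has_sum_cmult_left f)
  ultimately have 1: "((\<lambda>(a,b). f a * g b) has_sum F * zeta s) (Sigma {1..} (\<lambda>_. {1..}))"
    by (intro has_sum_SigmaI[where g = "\<lambda>a. f a * zeta s"]) auto
  have "((\<lambda>(n,d). of_int (moebius d) * npow n s) has_sum F * zeta s) (Sigma {1..} (\<lambda>n. {d. d dvd n})) \<longleftrightarrow>
    ((\<lambda>(a,b). f a * g b) has_sum F * zeta s) ({1..} \<times> {1..})"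
    by (rule has_sum_reindex_bij_witness[of _ "\<lambda>(a,b). (a*b, a)" "\<lambda>(n,d). (d, n div d)"])
       (auto simp: f_def g_def npow_mult Suc_le_eq elim!: dvdE)
  with 1 have 2: "((\<lambda>(n,d). of_int (moebius d) * npow n s) has_sum F * zeta s) (Sigma {1..} (\<lambda>n. {d. d dvd n}))"
    by blast
  have "((\<lambda>n::nat. if n = 1 then 1 else 0 :: complex) has_sum F * zeta s) {1..}"
  proof (rule has_sum_SigmaD[OF 2, of "\<lambda>n. if n = 1 then 1 else 0"])
    fix n :: nat assume n: "n \<in> {1..}"
    have "((\<lambda>d. of_int (moebius d) * npow n s) has_sum (\<Sum>d | d dvd n. of_int (moebius d) * npow n s)) {d. d dvd n}"
      using n by (intro has_sum_finite) auto
    also have "(\<Sum>d | d dvd n. of_int (moebius d) * npow n s) = of_int (\<Sum>d | d dvd n. moebius d) * npow n s"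
      by (simp add: sum_distrib_right)
    also have "\<dots> = (if n = 1 then 1 else 0)"
      using n by (subst sum_moebius_divisors) auto
    finally show "((\<lambda>d. case (n, d) of (n, d) \<Rightarrow> of_int (moebius d) * npow n s) has_sum (if n = 1 then 1 else 0)) {d. d dvd n}"
      by simp
  qed
  note l = this
  have "((\<lambda>n::nat. if n = 1 then 1 else 0 :: complex) has_sum 1) {1} \<longleftrightarrow>
    ((\<lambda>n::nat. if n = 1 then 1 else 0 :: complex) has_sum 1) {1..}"
    by (rule has_sum_cong_neutral) auto
  moreover have "((\<lambda>n::nat. if n = 1 then 1 else 0 :: complex) has_sum 1) {1}"
    using has_sum_finite[of "{1::nat}" "\<lambda>n. if n = 1 then 1 else 0 :: complex"] by simp
  ultimately have "((\<lambda>n::nat. if n = 1 then 1 else 0 :: complex) has_sum 1) {1..}" by simp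
  from has_sum_unique[OF l this] have eq: "F * zeta s = 1" .
  thus "zeta s \<noteq> 0" by auto
  with eq have "F = 1 / zeta s" by (simp add: field_simps)
  with f show "((\<lambda>n. of_int (moebius n) * npow n s) has_sum (1 / zeta s)) {1..}"
    by (simp add: f_def)
qed

text \<open>The product over primes up to \<open>N\<close> is the sum over the finite set
  \<open>A N\<close> of squarefree numbers composed of these primes. The sets \<open>A N\<close> are
  no initial segments, but they exhaust the squarefree numbers, which is all that unordered
  summation asks for.\<close>

lemma euler_product:
  assumes "Re s > 1"
  shows "(\<lambda>N. \<Prod>p | prime p \<and> p \<le> N. 1 - npow p s) \<longlonglongrightarrow> 1 / zeta s"
proof -
  define f where "f = (\<lambda>n. complex_of_int (moebius n) * npow n s)"
  define A where "A = (\<lambda>N. {n::nat. squarefree n \<and> prime_factors n \<subseteq> {p. prime p \<and> p \<le> N}})"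
  have fin: "finite (A N)" for N
  proof -
    have "A N \<subseteq> (\<lambda>S. \<Prod>S) ` Pow {p. p \<le> N}"
    proof
      fix n assume "n \<in> A N"
      hence "n = \<Prod>(prime_factors n)" "prime_factors n \<in> Pow {p. p \<le> N}"
        using squarefree_prod_prime_factors by (auto simp: A_def)
      thus "n \<in> (\<lambda>S. \<Prod>S) ` Pow {p. p \<le> N}" by (rule image_eqI)
    qed
    thus ?thesis by (rule finite_subset) auto
  qed
  have sum: "(\<Sum>n\<in>A N. f n) = (\<Prod>p | prime p \<and> p \<le> N. 1 - npow p s)" for N
  proof -
    have "(\<Sum>n\<in>A N. f n) = (\<Sum>X\<in>Pow {p. prime p \<and> p \<le> N}. f (\<Prod>X))"
      unfolding A_def by (rule sum_squarefree) auto
    also have "\<dots> = (\<Sum>X\<in>Pow {p. prime p \<and> p \<le> N}. (-1) ^ card X * (\<Prod>p\<in>X. npow p s) * (\<Prod>p\<in>{p. prime p \<and> p \<le> N}-X. 1))"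
    proof (rule sum.cong[OF refl])
      fix X :: "nat set" assume "X \<in> Pow {p. prime p \<and> p \<le> N}"
      moreover from this have "finite X" by (auto intro: finite_subset[of X "{..N}"])
      ultimately show "f (\<Prod>X) = (-1) ^ card X * (\<Prod>p\<in>X. npow p s) * (\<Prod>p\<in>{p. prime p \<and> p \<le> N}-X. 1)"
        using prod_primes(3)[of X] by (subst f_def, subst prod_primes(3)) (auto simp: npow_prod)
    qed
    also have "\<dots> = (\<Prod>p | prime p \<and> p \<le> N. 1 - npow p s)"
      by (subst prod_diff_conv_sum) auto
    finally show ?thesis .
  qed
  have lim: "filterlim A (finite_subsets_at_top {n. squarefree n}) sequentially"
    unfolding filterlim_finite_subsets_at_top
  proof (intro allI impI)
    fix X :: "nat set" assume X: "finite X \<and> X \<subseteq> {n. squarefree n}"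
    show "\<forall>\<^sub>F N in sequentially. finite (A N) \<and> X \<subseteq> A N \<and> A N \<subseteq> {n. squarefree n}"
    proof (rule eventually_sequentiallyI[of "Max (insert 0 X)"])
      fix N assume N: "Max (insert 0 X) \<le> N"
      have "X \<subseteq> A N"
      proof
        fix n assume n: "n \<in> X"
        hence sq: "squarefree n" using X by auto
        hence "n > 0" by (auto intro!: Nat.gr0I)
        moreover have "n \<le> N" using N X n by (meson Max_ge dual_order.trans finite_insert insertCI)
        ultimately have "prime_factors n \<subseteq> {p. prime p \<and> p \<le> N}"
          by (auto simp: prime_factors_dvd dest: dvd_imp_le)
        thus "n \<in> A N" using sq by (simp add: A_def)
      qed
      thus "finite (A N) \<and> X \<subseteq> A N \<and> A N \<subseteq> {n. squarefree n}" using fin by (auto simp: A_def)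
    qed
  qed
  have "(f has_sum (1 / zeta s)) {1..}" unfolding f_def by (rule moebius_has_sum(2)[OF assms])
  hence "(f has_sum (1 / zeta s)) {n. squarefree n}"
    by (rule has_sum_cong_neutral[THEN iffD1, rotated -1])
       (auto simp: f_def moebius_def intro!: Suc_leI Nat.gr0I)
  hence "(sum f \<longlongrightarrow> 1 / zeta s) (finite_subsets_at_top {n. squarefree n})"
    by (simp add: has_sum_def)
  from filterlim_compose[OF this lim] show ?thesis by (simp add: sum)
qed

section \<open>The 3-4-1 inequality and the line \<open>Re s = 1\<close>\<close>

lemma three_four_one:
  fixes w :: complex
  assumes "0 \<le> r" "r < 1" "norm w = 1"
  shows "norm (1 - complex_of_real r) ^ 3 * norm (1 - of_real r * w) ^ 4 * norm (1 - of_real r * w\<^sup>2) \<le> 1"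
proof -
  have ln: "(\<lambda>n. - (r ^ n * Re (v ^ n)) / n) sums ln (norm (1 - of_real r * v))" 
    and nz: "1 - of_real r * v \<noteq> 0" if "norm v = 1" for v :: complex
  proof -
    have v: "norm (- (of_real r * v)) < 1" using assms that by (simp add: norm_mult)
    show nz: "1 - of_real r * v \<noteq> 0" using v by (metis eq_iff_diff_eq_0 norm_minus_cancel norm_one order_less_irrefl)
    have "(\<lambda>n. - ((- (- (of_real r * v)))^n) / of_nat n) sums ln (1 + - (of_real r * v))"
      using Ln_series'[OF v] by simp
    from sums_Re[OF this] show "(\<lambda>n. - (r ^ n * Re (v ^ n)) / n) sums ln (norm (1 - of_real r * v))"
      using nz by (simp add: power_mult_distrib flip: of_real_power)
  qed
  have l1: "(\<lambda>n. - (r ^ n) / n) sums ln (norm (1 - complex_of_real r))" using ln[of 1] by simp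
  have w2: "norm (w\<^sup>2) = 1" using assms by (simp add: norm_power)
  have sums: "(\<lambda>n. 3 * (- (r ^ n) / n) + 4 * (- (r ^ n * Re (w ^ n)) / n) + (- (r ^ n * Re ((w\<^sup>2) ^ n)) / n)) sums
     (3 * ln (norm (1 - complex_of_real r)) + 4 * ln (norm (1 - of_real r * w)) + ln (norm (1 - of_real r * w\<^sup>2)))"
    by (intro sums_add sums_mult l1 ln w2 assms)
  \<comment> \<open>The coefficients combine to
    \<open>3 + 4 * cos a + cos (2 * a) = 2 * (1 + cos a)^2\<close>, where \<open>c = cos a\<close>
    is the real part of \<open>w ^ n\<close>. For \<open>n = 0\<close> every quotient is 0, matching
    the missing constant term of the logarithm series.\<close>
  have "3 * (- (r ^ n) / n) + 4 * (- (r ^ n * Re (w ^ n)) / n) + (- (r ^ n * Re ((w\<^sup>2) ^ n)) / n) \<le> 0" for n :: nat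
  proof -
    define c where "c = Re (w ^ n)"
    have "norm (w ^ n) = 1" using assms by (simp add: norm_power)
    hence "(Re (w ^ n))\<^sup>2 + (Im (w ^ n))\<^sup>2 = 1" by (metis cmod_power2 one_power2)
    hence e: "(Im (w ^ n))\<^sup>2 = 1 - c\<^sup>2" by (simp add: c_def)
    have "Re ((w\<^sup>2) ^ n) = Re ((w ^ n)\<^sup>2)" by (simp add: mult.commute flip: power_mult)
    also have "\<dots> = 2 * c\<^sup>2 - 1" using e by (simp add: Re_power2 c_def)
    finally have R: "Re ((w\<^sup>2) ^ n) = 2 * c\<^sup>2 - 1" .
    have "3 * (- (r ^ n) / n) + 4 * (- (r ^ n * Re (w ^ n)) / n) + (- (r ^ n * Re ((w\<^sup>2) ^ n)) / n) = 
      - (2 * (1 + c)\<^sup>2 * r ^ n / n)"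
      unfolding R c_def[symmetric] by (cases "n = 0") (auto simp: divide_simps, simp add: algebra_simps power2_eq_square)
    also have "\<dots> \<le> 0" using assms by simp
    finally show ?thesis .
  qed note le = this
  from sums_le[OF le sums sums_zero] have le0: "3 * ln (norm (1 - complex_of_real r)) + 4 * ln (norm (1 - of_real r * w)) + ln (norm (1 - of_real r * w\<^sup>2)) \<le> 0"
    .
  have ln_eq: "ln (norm (1 - complex_of_real r) ^ 3 * norm (1 - of_real r * w) ^ 4 * norm (1 - of_real r * w\<^sup>2)) = 
    3 * ln (norm (1 - complex_of_real r)) + 4 * ln (norm (1 - of_real r * w)) + ln (norm (1 - of_real r * w\<^sup>2))"
    using nz[of 1] nz[of w] nz[of "w\<^sup>2"] assms w2 by (simp add: ln_mult ln_realpow del: norm_mult)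
  have pos: "norm (1 - complex_of_real r) ^ 3 * norm (1 - of_real r * w) ^ 4 * norm (1 - of_real r * w\<^sup>2) > 0"
    using nz[of 1] nz[of w] nz[of "w\<^sup>2"] assms w2 by simp
  show ?thesis using le0 unfolding ln_eq[symmetric] ln_le_zero_iff[OF pos] .
qed

text \<open>The inequality is applied to each Euler factor with \<open>r\<close> and
  \<open>w\<close> the modulus and the direction of \<open>npow p (x + i * t)\<close>; the finite
  products converge to the reciprocals, which reverses the inequality.\<close>

lemma zeta_three_four_one:
  assumes "x > 1"
  shows "norm (zeta (of_real x)) ^ 3 * norm (zeta (Complex x t)) ^ 4 * norm (zeta (Complex x (2 * t))) \<ge> 1"
proof -
  let ?P = "\<lambda>s N. \<Prod>p | prime p \<and> p \<le> N. 1 - npow p s"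
  have le: "norm (?P (of_real x) N) ^ 3 * norm (?P (Complex x t) N) ^ 4 * norm (?P (Complex x (2 * t)) N) \<le> 1" for N
  proof -
    have "norm (?P (of_real x) N) ^ 3 * norm (?P (Complex x t) N) ^ 4 * norm (?P (Complex x (2 * t)) N) =
      (\<Prod>p | prime p \<and> p \<le> N. norm (1 - npow p (of_real x)) ^ 3 * norm (1 - npow p (Complex x t)) ^ 4 * norm (1 - npow p (Complex x (2*t))))"
      (is "_ = prod ?f _")
      by (simp add: prod.distrib prod_power_distrib flip: prod_norm)
    also have "\<dots> \<le> 1"
    proof (intro prod_le_1 conjI)
      show "0 \<le> ?f p" for p by simp
      fix p :: nat assume "p \<in> {p. prime p \<and> p \<le> N}"
      hence p: "prime p" by simp
      have p1: "p > 1" using p prime_gt_1_nat by blast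
      define w where "w = npow p (\<i> * of_real t)"
      define r where "r = real p powr (-x)"
      have r: "0 \<le> r" "r < 1" unfolding r_def using p1 assms by (auto intro: powr_less_one)
      have w: "norm w = 1" using p1 unfolding w_def by (subst norm_npow) auto
      have r': "npow p (of_real x) = of_real r"
        unfolding npow_def r_def using powr_of_real[of "real p" "-x"] by simp
      have 1: "Complex x t = of_real x + \<i> * of_real t" "Complex x (2*t) = of_real x + (\<i> * of_real t + \<i> * of_real t)"
        by (auto simp: complex_eq_iff)
      show "norm (1 - npow p (of_real x)) ^ 3 * norm (1 - npow p (Complex x t)) ^ 4 * norm (1 - npow p (Complex x (2*t))) \<le> 1"
        unfolding 1 npow_add r' w_def[symmetric] using three_four_one[OF r w]
        by (simp add: power2_eq_square)
    qed
    finally show ?thesis .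
  qed
  have "(\<lambda>N. norm (?P (of_real x) N) ^ 3 * norm (?P (Complex x t) N) ^ 4 * norm (?P (Complex x (2 * t)) N)) \<longlonglongrightarrow>
     norm (1 / zeta (of_real x)) ^ 3 * norm (1 / zeta (Complex x t)) ^ 4 * norm (1 / zeta (Complex x (2 * t)))"
    by (intro tendsto_intros euler_product) (use assms in auto)
  from tendsto_upperbound[OF this, of 1] le 
  have "norm (1 / zeta (of_real x)) ^ 3 * norm (1 / zeta (Complex x t)) ^ 4 * norm (1 / zeta (Complex x (2 * t))) \<le> 1"
    by auto
  moreover have "zeta (of_real x) \<noteq> 0" "zeta (Complex x t) \<noteq> 0" "zeta (Complex x (2 * t)) \<noteq> 0"
    by (rule moebius_has_sum(1); use assms in simp)+
  ultimately have "1 / (norm (zeta (of_real x)) ^ 3 * norm (zeta (Complex x t)) ^ 4 * norm (zeta (Complex x (2 * t)))) \<le> 1"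
    and "norm (zeta (of_real x)) ^ 3 * norm (zeta (Complex x t)) ^ 4 * norm (zeta (Complex x (2 * t))) > 0"
    by (simp_all add: norm_divide power_one_over inverse_eq_divide)
  thus ?thesis by (metis divide_le_eq_1_pos)
qed

text \<open>For \<open>t \<noteq> 0\<close> a zero at \<open>1 + i * t\<close> enters with the
  fourth power, the pole at 1 only with the third. One factor \<open>x - 1\<close> is then left over
  and forces the 3-4-1 product to 0 as \<open>x\<close> decreases to 1, although the product is at
  least 1.\<close>

lemma zeta1_nonzero_line_1:
  "zeta1 (Complex 1 t) \<noteq> 0"
proof (cases "t = 0")
  case True
  hence "Complex 1 t = 1" by (auto simp: complex_eq_iff)
  thus ?thesis by simp
next
  case False
  show ?thesis
  proof
    assume z: "zeta1 (Complex 1 t) = 0"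
    define a where "a = Complex 1 t"
    have a1: "a \<noteq> 1" and b1: "Complex 1 (2 * t) \<noteq> 1" using False by (auto simp: a_def complex_eq_iff)
    have za: "zeta a = 0" using z a1 by (simp add: zeta_eq_zeta1 a_def)
    have lim0: "((\<lambda>x. x - 1) \<longlongrightarrow> 0) (at_right (1::real))"
      by (rule tendsto_eq_intros refl)+ auto
    have cpl: "((\<lambda>x. Complex x u) \<longlongrightarrow> Complex 1 u) (at_right 1)" for u
      by (intro tendsto_intros)
    have lim1: "((\<lambda>x. zeta1 (of_real x)) \<longlongrightarrow> zeta1 1) (at_right (1::real))"
    proof (rule isCont_tendsto_compose[where g = zeta1])
      show "isCont zeta1 1"
        using zeta1_continuous[of UNIV] by (simp add: continuous_on_eq_continuous_at)
      show "((\<lambda>x. complex_of_real x) \<longlongrightarrow> 1) (at_right 1)"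
        by (rule tendsto_eq_intros refl)+ auto
    qed
    have iso: "isCont zeta s" if "s \<noteq> 1" for s
      using holomorphic_on_imp_continuous_on[OF zeta_holomorphic] that
      by (simp add: continuous_on_eq_continuous_at open_Compl)
    have lim3: "((\<lambda>x. zeta (Complex x (2 * t))) \<longlongrightarrow> zeta (Complex 1 (2 * t))) (at_right 1)"
      by (rule isCont_tendsto_compose[OF iso[OF b1] cpl])
    have "(zeta has_field_derivative deriv zeta a) (at a)"
      using holomorphic_derivI[OF zeta_holomorphic] a1 by auto
    hence "((\<lambda>z. (zeta z - zeta a) / (z - a)) \<longlongrightarrow> deriv zeta a) (at a)"
      by (simp add: has_field_derivative_iff)
    moreover have "filterlim (\<lambda>x. Complex x t) (at a) (at_right 1)"
      unfolding filterlim_at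
    proof
      show "\<forall>\<^sub>F x in at_right 1. Complex x t \<in> UNIV \<and> Complex x t \<noteq> a"
        by (rule eventually_mono[OF eventually_at_right_less]) (auto simp: a_def complex_eq_iff)
      show "((\<lambda>x. Complex x t) \<longlongrightarrow> a) (at_right 1)"
        using cpl[of t] by (simp add: a_def)
    qed

    ultimately have "((\<lambda>x. (zeta (Complex x t) - zeta a) / (Complex x t - a)) \<longlongrightarrow> deriv zeta a) (at_right 1)"
      by (rule filterlim_compose)
    moreover have "Complex x t - a = of_real (x - 1)" for x by (auto simp: a_def complex_eq_iff)
    ultimately have lim2: "((\<lambda>x. zeta (Complex x t) / of_real (x - 1)) \<longlongrightarrow> deriv zeta a) (at_right 1)"
      using za by simp
    have "((\<lambda>x. (x - 1) * norm (zeta1 (of_real x)) ^ 3 * norm (zeta (Complex x t) / of_real (x - 1)) ^ 4 * norm (zeta (Complex x (2 * t)))) \<longlongrightarrow>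
       0 * norm (zeta1 1) ^ 3 * norm (deriv zeta a) ^ 4 * norm (zeta (Complex 1 (2 * t)))) (at_right 1)"
      by (intro tendsto_intros lim0 lim1 lim2 lim3)
    moreover have "eventually (\<lambda>x. (x - 1) * norm (zeta1 (of_real x)) ^ 3 * norm (zeta (Complex x t) / of_real (x - 1)) ^ 4 * norm (zeta (Complex x (2 * t))) \<ge> 1) (at_right 1)"
    proof (rule eventually_mono[OF eventually_at_right_less])
      fix x :: real assume x: "1 < x"
      define d where "d = x - 1"
      have d: "d > 0" using x by (simp add: d_def)
      have "norm (zeta1 (of_real x)) = d * norm (zeta (of_real x))"
        using x d norm_of_real[of "x - 1", where 'a = complex] by (simp add: zeta1_def norm_mult d_def)
      moreover have "norm (zeta (Complex x t) / of_real (x - 1)) = norm (zeta (Complex x t)) / d"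
        using d by (simp add: norm_divide d_def del: of_real_diff)
      moreover have "d * (d * A) ^ 3 * (B / d) ^ 4 = A ^ 3 * B ^ 4" for A B
        using d by (simp add: field_simps power4_eq_xxxx power3_eq_cube)
      ultimately have "(x - 1) * norm (zeta1 (of_real x)) ^ 3 * norm (zeta (Complex x t) / of_real (x - 1)) ^ 4 * norm (zeta (Complex x (2 * t))) =
         norm (zeta (of_real x)) ^ 3 * norm (zeta (Complex x t)) ^ 4 * norm (zeta (Complex x (2 * t)))"
        unfolding d_def by (simp del: of_real_diff)
      thus "(x - 1) * norm (zeta1 (of_real x)) ^ 3 * norm (zeta (Complex x t) / of_real (x - 1)) ^ 4 * norm (zeta (Complex x (2 * t))) \<ge> 1"
        using zeta_three_four_one[OF x, of t] by linarith
    qed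
    ultimately have "(1::real) \<le> 0 * norm (zeta1 1) ^ 3 * norm (deriv zeta a) ^ 4 * norm (zeta (Complex 1 (2 * t)))"
      by (rule tendsto_lowerbound) simp
    thus False by simp
  qed
qed

lemma zeta1_nonzero:
  assumes "Re s \<ge> 1" shows "zeta1 s \<noteq> 0"
proof (cases "Re s = 1")
  case True
  thus ?thesis using zeta1_nonzero_line_1[of "Im s"] by (metis complex.collapse)
next
  case False
  thus ?thesis using assms moebius_has_sum(1)[of s] by (auto simp: zeta1_def)
qed

section \<open>Littlewood's bound in a zero-free half-plane\<close>

text \<open>\<open>Re (g z) < A\<close> means that \<open>g z\<close> is nearer to 0 than to
  \<open>2 * A\<close>. Hence \<open>g / (2 * A - g)\<close> maps the disc into the unit disc and
  vanishes at the centre, and the Schwarz lemma applies.\<close>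

lemma borel_caratheodory:
  assumes hol: "g holomorphic_on ball c R" and g0: "g c = 0"
    and Re: "\<And>z. z \<in> ball c R \<Longrightarrow> Re (g z) < A" and z: "z \<in> ball c R"
  shows "norm (g z) * (R - dist c z) \<le> 2 * A * dist c z"
proof -
  have "dist c z < R" using z by simp
  with zero_le_dist[of c z] have R: "R > 0" by linarith
  have A: "A > 0" using Re[of c] R g0 by simp
  define \<phi> where "\<phi> = (\<lambda>w. g (c + of_real R * w) / (2 * of_real A - g (c + of_real R * w)))"
  have mem: "c + of_real R * w \<in> ball c R" if "norm w < 1" for w
    using that R by (simp add: dist_norm norm_mult)
  have nz: "2 * of_real A - g (c + of_real R * w) \<noteq> 0" if "norm w < 1" for w
  proof
    assume "2 * of_real A - g (c + of_real R * w) = 0"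
    hence "Re (g (c + of_real R * w)) = 2 * A" by (metis Re_complex_of_real eq_iff_diff_eq_0 of_real_mult of_real_numeral)
    thus False using Re[OF mem[OF that]] A by simp
  qed
  have lt: "norm (g u) < norm (2 * of_real A - g u)" if "u \<in> ball c R" for u
  proof -
    have "(Re (g u))\<^sup>2 < (2 * A - Re (g u))\<^sup>2"
      using A Re[OF that] by (simp add: power2_eq_square algebra_simps)
    hence "(norm (g u))\<^sup>2 < (norm (2 * of_real A - g u))\<^sup>2"
      by (simp add: cmod_power2)
    thus ?thesis by (rule power_less_imp_less_base) auto
  qed
  define w where "w = (z - c) / of_real R"
  have w: "norm w = dist c z / R" "norm w < 1" "c + of_real R * w = z"
    using R z by (auto simp: w_def norm_divide dist_norm norm_minus_commute)
  have "norm (\<phi> w) \<le> norm w"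
  proof (rule Schwarz_Lemma(1))
    have "(\<lambda>w. g (c + of_real R * w)) holomorphic_on ball 0 1"
      using holomorphic_on_compose_gen[OF _ hol, of "\<lambda>w. c + of_real R * w" "ball 0 1"] mem
      by (force simp: o_def intro!: holomorphic_intros)
    thus "\<phi> holomorphic_on ball 0 1"
      unfolding \<phi>_def by (intro holomorphic_intros) (use nz in auto)
    show "\<phi> 0 = 0" by (simp add: \<phi>_def g0)
    show "norm (\<phi> u) < 1" if "norm u < 1" for u
      using lt[OF mem[OF that]] nz[OF that] by (simp add: \<phi>_def norm_divide divide_simps)
  qed (use w in auto)
  hence "norm (g z) / norm (2 * of_real A - g z) \<le> dist c z / R"
    unfolding \<phi>_def w by (simp add: norm_divide)
  moreover have "norm (2 * of_real A - g z) > 0" using lt[OF z] by (meson norm_ge_zero order_le_less_trans)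
  ultimately have "norm (g z) * R \<le> dist c z * norm (2 * of_real A - g z)"
    using R by (simp add: field_simps)
  also have "\<dots> \<le> dist c z * (2 * A + norm (g z))"
    using A norm_triangle_ineq4[of "2 * of_real A" "g z"] by (intro mult_left_mono) (auto simp: norm_mult)
  finally show ?thesis by (simp add: algebra_simps)
qed

text \<open>
  Only finitely many Taylor coefficients are controlled through the small disc; the tail is
  controlled through the large one. This replaces Hadamard's three circles theorem.
\<close>

lemma two_discs_bound:
  fixes r r1 R B \<epsilon> :: real
  assumes r: "0 < r" "r < R" and r1: "0 < r1" "r1 < R" and \<epsilon>: "\<epsilon> > 0"
  obtains C where "C \<ge> 0" 
    "\<And>A c g z. g holomorphic_on ball c R \<Longrightarrow> g c = 0 \<Longrightarrow> 
      (\<And>z. z \<in> ball c R \<Longrightarrow> Re (g z) < A) \<Longrightarrow> (\<And>z. z \<in> ball c r1 \<Longrightarrow> Re (g z) < B) \<Longrightarrow>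
      z \<in> cball c r \<Longrightarrow> norm (g z) \<le> \<epsilon> * A + C"
proof -
  define R' where "R' = (r + R) / 2"
  have R': "r < R'" "R' < R" using r by (auto simp: R'_def)
  define K where "K = 2 * R' / (R - R')"
  have K: "K > 0" using R' r by (simp add: K_def)
  \<comment> \<open>Cauchy's estimate on the circle of radius \<open>\<rho>\<close>, where
    \<open>g\<close> is bounded by Borel-Caratheodory from the one-sided bound on the disc of radius
    \<open>S\<close>. It is used with the pair \<open>R'\<close>, \<open>R\<close> and with the pair
    \<open>r1 / 2\<close>, \<open>r1\<close>.\<close>
  have coeff: "norm ((deriv ^^ k) g c / fact k) \<le> 2 * A * \<rho> / (S - \<rho>) / \<rho> ^ k"
    if hol: "g holomorphic_on ball c S" and "g c = 0" and Re: "\<And>z. z \<in> ball c S \<Longrightarrow> Re (g z) < A"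
      and \<rho>: "0 < \<rho>" "\<rho> < S" for g c A S \<rho> k
  proof -
    have "norm ((deriv ^^ k) g c) \<le> fact k * (2 * A * \<rho> / (S - \<rho>)) / \<rho> ^ k"
    proof (rule Cauchy_inequality)
      show "g holomorphic_on ball c \<rho>" using hol \<rho> by (auto intro: holomorphic_on_subset)
      show "continuous_on (cball c \<rho>) g"
        using hol \<rho> by (auto intro!: holomorphic_on_imp_continuous_on intro: holomorphic_on_subset)
      fix x assume x: "norm (c - x) = \<rho>"
      have "norm (g x) * (S - dist c x) \<le> 2 * A * dist c x"
        by (rule borel_caratheodory[OF hol]) (use that x in \<open>auto simp: dist_norm\<close>)
      thus "norm (g x) \<le> 2 * A * \<rho> / (S - \<rho>)"
        using x \<rho> by (simp add: dist_norm field_simps)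
    qed fact
    thus ?thesis by (simp add: norm_divide field_simps)
  qed
  define q where "q = r / R'"
  have q: "0 < q" "q < 1" using r R' by (auto simp: q_def)
  have "summable (\<lambda>k. K * q ^ k)" using q by (intro summable_mult summable_geometric) auto
  \<comment> \<open>\<open>N\<close> is chosen from \<open>K\<close> and \<open>q\<close>, thus from
    the radii and \<open>\<epsilon>\<close> alone. This makes \<open>C\<close> independent of
    \<open>A\<close>, of the centre and of \<open>g\<close>.\<close>
  from suminf_exist_split[OF \<epsilon> this] obtain N where N: "norm (\<Sum>i. K * q ^ (i + N)) < \<epsilon>" by blast
  have sumK: "summable (\<lambda>k. K * q ^ (k + N))"
    using \<open>summable (\<lambda>k. K * q ^ k)\<close> by (rule summable_ignore_initial_segment)
  define C where "C = (\<Sum>k<N. 2 * \<bar>B\<bar> * (r / (r1 / 2)) ^ k)"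
  show ?thesis
  proof (rule that)
    show "C \<ge> 0" unfolding C_def using r r1 by (intro sum_nonneg) auto
    fix A c g z assume hol: "g holomorphic_on ball c R" and g0: "g c = 0" 
      and A: "\<And>z. z \<in> ball c R \<Longrightarrow> Re (g z) < A" and B: "\<And>z. z \<in> ball c r1 \<Longrightarrow> Re (g z) < B"
      and z: "z \<in> cball c r"
    have A0: "A > 0" using A[of c] g0 r by simp
    have B0: "B > 0" using B[of c] g0 r1 by simp
    define b where "b = (\<lambda>k. (deriv ^^ k) g c / fact k)"
    have zr: "norm (z - c) \<le> r" using z by (simp add: dist_norm norm_minus_commute)
    have sums: "(\<lambda>k. b k * (z - c) ^ k) sums g z"
      unfolding b_def using z r by (intro holomorphic_power_series[OF hol]) auto
    have b1: "norm (b k) \<le> K * A / R' ^ k" for k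
      using coeff[OF hol g0 A, of R' k] R' r by (simp add: b_def K_def mult_ac)
    have b2: "norm (b k) \<le> 2 * B / (r1 / 2) ^ k" for k
    proof -
      have "norm (b k) \<le> 2 * B * (r1/2) / (r1 - r1/2) / (r1 / 2) ^ k"
        unfolding b_def by (rule coeff[where g = g, OF _ g0 B]) (use hol r1 in \<open>auto intro: holomorphic_on_subset\<close>)
      thus ?thesis using r1 by (simp add: mult.commute)
    qed
    have t1: "norm (b k * (z - c) ^ k) \<le> A * (K * q ^ k)" for k
    proof -
      have "norm (b k * (z - c) ^ k) \<le> (K * A / R' ^ k) * r ^ k"
        unfolding norm_mult norm_power using b1[of k] zr K A0 R' r by (intro mult_mono power_mono) auto
      thus ?thesis by (simp add: q_def power_divide mult_ac)
    qed
    have t2: "norm (b k * (z - c) ^ k) \<le> 2 * \<bar>B\<bar> * (r / (r1 / 2)) ^ k" for k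
    proof -
      have "norm (b k * (z - c) ^ k) \<le> (2 * B / (r1 / 2) ^ k) * r ^ k"
        unfolding norm_mult norm_power using b2[of k] zr B0 r1 r by (intro mult_mono power_mono) auto
      thus ?thesis using B0 by (simp add: power_divide mult_ac)
    qed
    have "g z = (\<Sum>k. b (k + N) * (z - c) ^ (k + N)) + (\<Sum>k<N. b k * (z - c) ^ k)"
      using sums suminf_split_initial_segment[of "\<lambda>k. b k * (z - c) ^ k" N] by (auto simp: sums_iff)
    also have "norm \<dots> \<le> (\<Sum>k. A * (K * q ^ (k + N))) + C"
    proof (rule order_trans[OF norm_triangle_ineq add_mono])
      show "norm (\<Sum>k. b (k + N) * (z - c) ^ (k + N)) \<le> (\<Sum>k. A * (K * q ^ (k + N)))"
        by (intro norm_suminf_le t1 summable_mult sumK)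
      show "norm (\<Sum>k<N. b k * (z - c) ^ k) \<le> C"
        unfolding C_def by (intro sum_norm_le t2)
    qed
    also have "(\<Sum>k. A * (K * q ^ (k + N))) = A * (\<Sum>k. K * q ^ (k + N))"
      by (rule suminf_mult[OF sumK])
    also have "\<dots> \<le> A * \<epsilon>" using N A0 by (intro mult_left_mono) auto
    finally show "norm (g z) \<le> \<epsilon> * A + C" by (simp add: mult_ac)
  qed
qed

lemma zeta_bounds_right:
  assumes "a > 1"
  obtains B where "B \<ge> 1" "\<And>s. Re s \<ge> a \<Longrightarrow> norm (zeta s) \<le> B" "\<And>s. Re s \<ge> a \<Longrightarrow> norm (1 / zeta s) \<le> B"
proof -
  define B where "B = infsum (\<lambda>n. real n powr (-a)) {1..}"
  have B: "((\<lambda>n. real n powr (-a)) has_sum B) {1..}"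
    unfolding B_def using summable_on_powr[OF assms] by (rule has_sum_infsum)
  have bound: "norm S \<le> B" if "\<And>n. norm (f n) \<le> norm (npow n s)" "(f has_sum S) {1..}" "Re s \<ge> a" for f S s
  proof -
    have le: "norm (f n) \<le> real n powr (-a)" if n: "n \<in> {1..}" for n
      using n that norm_npow[of n s] \<open>norm (f n) \<le> norm (npow n s)\<close> \<open>Re s \<ge> a\<close>
      by (intro order_trans[OF \<open>norm (f n) \<le> norm (npow n s)\<close>]) (auto intro!: powr_mono)
    hence "(\<lambda>n. norm (f n)) summable_on {1..}"
      by (intro summable_on_comparison_test[OF summable_on_powr[OF assms]]) auto
    then obtain T where T: "((\<lambda>n. norm (f n)) has_sum T) {1..}" by (auto simp: summable_on_def)
    have "norm S \<le> T" by (rule norm_has_sum_bound[OF T that(2)])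
    also have "T \<le> B" by (rule has_sum_mono[OF T B le])
    finally show ?thesis .
  qed
  show ?thesis
  proof (rule that[of "max 1 B"])
    fix s :: complex assume s: "a \<le> Re s"
    have "norm (zeta s) \<le> B"
      by (rule bound[OF _ zeta_has_sum, of s]) (use s assms in auto)
    thus "norm (zeta s) \<le> max 1 B" by simp
    have "norm (1 / zeta s) \<le> B"
    proof (rule bound[OF _ moebius_has_sum(2), of s])
      fix n show "norm (of_int (moebius n) * npow n s) \<le> norm (npow n s)"
        using abs_moebius_le[of n] by (auto simp: norm_mult intro!: mult_left_le_one_le)
    qed (use s assms in auto)
    thus "norm (1 / zeta s) \<le> max 1 B" by simp
  qed auto
qed

text \<open>On discs centred at \<open>2 + i * Im s\<close> a branch of \<open>log zeta\<close> has
  real part at most \<open>3 * ln t + O(1)\<close> by the cubic growth, and bounded real part on the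
  disc of radius \<open>1 / 2\<close>, where \<open>Re z \<ge> 3 / 2\<close>.
  \<open>two_discs_bound\<close> shrinks the factor 3 to \<open>\<epsilon>\<close>. Since the
  modulus of the logarithm is bounded, zeta is controlled from below as well as from above. The
  condition \<open>\<bar>Im s\<bar> \<ge> 4\<close> keeps discs of radius less than 2 away from the
  pole.\<close>

lemma zeta_subpolynomial_aux:
  assumes \<theta>: "0 \<le> \<theta>" "\<theta> < \<sigma>" "\<sigma> \<le> 1" and nz: "\<And>s. Re s > \<theta> \<Longrightarrow> zeta1 s \<noteq> 0" and \<epsilon>: "\<epsilon> > 0"
  obtains C where "C > 0"
    "\<And>s. \<sigma> \<le> Re s \<Longrightarrow> Re s \<le> 2 \<Longrightarrow> \<bar>Im s\<bar> \<ge> 4 \<Longrightarrow> \<bar>ln (norm (zeta s))\<bar> \<le> \<epsilon> * ln \<bar>Im s\<bar> + C"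
proof -
  \<comment> \<open>An abscissa strictly between \<open>\<theta>\<close> and
    \<open>\<sigma>\<close>: the disc of radius \<open>2 - \<theta>'\<close> is still free of zeros,
    and the disc of radius \<open>2 - \<sigma>\<close> containing \<open>s\<close> is strictly
    smaller.\<close>
  define \<theta>' where "\<theta>' = (\<theta> + \<sigma>) / 2"
  have \<theta>': "\<theta> < \<theta>'" "\<theta>' < \<sigma>" using \<theta> by (auto simp: \<theta>'_def)
  define R where "R = 2 - \<theta>'"
  define r where "r = 2 - \<sigma>"
  have R: "0 < r" "r < R" "1 < R" "R < 2" using \<theta> \<theta>' by (auto simp: R_def r_def)
  obtain K where K: "K > 0" "\<And>s. Re s \<ge> - 1 / 2 \<Longrightarrow> norm (zeta1 s) \<le> K * (1 + norm s) ^ 3"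
    using zeta1_growth by metis
  obtain B where B: "B \<ge> 1" "\<And>s. Re s \<ge> 3/2 \<Longrightarrow> norm (zeta s) \<le> B" "\<And>s. Re s \<ge> 3/2 \<Longrightarrow> norm (1 / zeta s) \<le> B"
    by (rule zeta_bounds_right[of "3/2"]) auto
  obtain C where C: "C \<ge> 0" 
    "\<And>A c g z. g holomorphic_on ball c R \<Longrightarrow> g c = 0 \<Longrightarrow> 
      (\<And>z. z \<in> ball c R \<Longrightarrow> Re (g z) < A) \<Longrightarrow> (\<And>z. z \<in> ball c (1/2) \<Longrightarrow> Re (g z) < 2 * ln B + 1) \<Longrightarrow>
      z \<in> cball c r \<Longrightarrow> norm (g z) \<le> (\<epsilon> / 3) * A + C"
    by (rule two_discs_bound[of r R "1/2" "\<epsilon> / 3" "2 * ln B + 1"]) (use R \<epsilon> in auto)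
  define D where "D = \<bar>ln (K * 27)\<bar> + ln B + 1"
  have B0: "ln B \<ge> 0" using B by simp
  show ?thesis
  proof (rule that)
    show "ln B + C + \<epsilon> * D + 1 > 0" using B0 C \<epsilon> by (auto simp: D_def intro!: add_nonneg_pos)
    fix s :: complex assume s: "\<sigma> \<le> Re s" "Re s \<le> 2" "4 \<le> \<bar>Im s\<bar>"
    define t where "t = \<bar>Im s\<bar>"
    define c where "c = Complex 2 (Im s)"
    have ballD: "Re z > \<theta>'" "\<bar>Im z\<bar> \<ge> 2" "norm z \<le> t + 4" if "z \<in> ball c R" for z
    proof -
      have d: "norm (z - c) < R" using that by (simp add: dist_norm norm_minus_commute)
      show "Re z > \<theta>'" using abs_Re_le_cmod[of "z - c"] d by (auto simp: c_def R_def)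
      show "\<bar>Im z\<bar> \<ge> 2" using abs_Im_le_cmod[of "z - c"] d R(4) s(3) by (auto simp: c_def)
      have "norm c \<le> 2 + t" using cmod_le[of c] by (simp add: c_def t_def)
      thus "norm z \<le> t + 4" using norm_triangle_ineq[of "z - c" c] d R(4) by simp
    qed
    have ne: "z \<noteq> 1" "zeta z \<noteq> 0" if "z \<in> ball c R" for z
    proof -
      show "z \<noteq> 1" using ballD(2)[OF that] by auto
      thus "zeta z \<noteq> 0" using nz[of z] ballD(1)[OF that] \<theta>'(1) by (simp add: zeta_eq_zeta1)
    qed
    obtain L where L: "L holomorphic_on ball c R" "\<And>z. z \<in> ball c R \<Longrightarrow> exp (L z) = zeta z"
    proof (rule holomorphic_logarithm_exists[of "ball c R" zeta c])
      show "zeta holomorphic_on ball c R"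
        by (rule holomorphic_on_subset[OF zeta_holomorphic]) (use ne in auto)
    qed (use ne R in auto)
    have ReL: "Re (L z) = ln (norm (zeta z))" if "z \<in> ball c R" for z
      using L(2)[OF that] by (metis ln_exp norm_exp_eq_Re)
    have lnle: "ln (norm (zeta z)) \<le> ln B" "- ln (norm (zeta z)) \<le> ln B" if "z \<in> ball c R" "Re z \<ge> 3/2" for z
    proof -
      have "norm (zeta z) > 0" using ne[OF that(1)] by simp
      thus "ln (norm (zeta z)) \<le> ln B" using B(2)[OF that(2)] B(1) by simp
      have "ln (norm (1 / zeta z)) \<le> ln B" using B(3)[OF that(2)] B(1) ne[OF that(1)] by simp
      thus "- ln (norm (zeta z)) \<le> ln B" using ne[OF that(1)] by (simp add: norm_divide ln_div)
    qed
    have c: "c \<in> ball c R" "Re c \<ge> 3/2" using R by (auto simp: c_def)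
    define g where "g = (\<lambda>z. L z - L c)"
    have sB: "s \<in> cball c r" 
    proof -
      have "norm (c - s) = 2 - Re s" using s by (simp add: c_def cmod_def)
      thus ?thesis using s by (simp add: dist_norm r_def)
    qed
    hence s': "s \<in> ball c R" using R by auto
    have "norm (g s) \<le> (\<epsilon> / 3) * (3 * ln t + D) + C"
    proof (rule C(2)[OF _ _ _ _ sB])
      show "g holomorphic_on ball c R" unfolding g_def by (intro holomorphic_intros L)
      show "g c = 0" by (simp add: g_def)
      show "Re (g z) < 2 * ln B + 1" if "z \<in> ball c (1/2)" for z
      proof -
        have z: "z \<in> ball c R" using that R by auto
        have "Re z \<ge> 3/2" using abs_Re_le_cmod[of "z - c"] that by (auto simp: c_def dist_norm norm_minus_commute)
        thus ?thesis using lnle(1)[OF z] lnle(2)[OF c] by (simp add: g_def ReL[OF z] ReL[OF c(1)])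
      qed
      show "Re (g z) < 3 * ln t + D" if z: "z \<in> ball c R" for z
      proof -
        have "norm (zeta z) \<le> norm (zeta1 z)"
        proof -
          have "norm (z - 1) \<ge> 1" using abs_Im_le_cmod[of "z - 1"] ballD(2)[OF z] by simp
          thus ?thesis unfolding zeta_eq_zeta1[OF ne(1)[OF z]] norm_divide 
            by (simp add: divide_le_eq mult_le_cancel_left1)
        qed
        also have "\<dots> \<le> K * (1 + norm z) ^ 3" using K(2)[of z] ballD(1)[OF z] \<theta> \<theta>' by auto
        also have "\<dots> \<le> K * (3 * t) ^ 3"
          using ballD(3)[OF z] s(3) K(1) by (intro mult_left_mono power_mono) (auto simp: t_def)
        also have "\<dots> = (K * 27) * t ^ 3" by (simp add: power_mult_distrib)
        finally have "ln (norm (zeta z)) \<le> ln ((K * 27) * t ^ 3)"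
          using ne(2)[OF z] by (intro ln_mono) auto
        also have "\<dots> = ln (K * 27) + 3 * ln t"
          using K(1) s(3) by (subst ln_mult) (auto simp: t_def ln_realpow)
        finally show ?thesis using lnle(2)[OF c] by (simp add: g_def ReL[OF z] ReL[OF c(1)] D_def)
      qed
    qed
    moreover have "\<bar>ln (norm (zeta s))\<bar> \<le> norm (g s) + ln B"
      using abs_Re_le_cmod[of "g s"] lnle[OF c] by (simp add: g_def ReL[OF s'] ReL[OF c(1)])
    moreover have "\<epsilon> * D / 3 \<le> \<epsilon> * D" using \<epsilon> B0 by (simp add: D_def)
    ultimately have "\<bar>ln (norm (zeta s))\<bar> \<le> \<epsilon> * ln t + (ln B + C + \<epsilon> * D + 1)"
      by (simp add: algebra_simps)
    thus "\<bar>ln (norm (zeta s))\<bar> \<le> \<epsilon> * ln \<bar>Im s\<bar> + (ln B + C + \<epsilon> * D + 1)" by (simp add: t_def)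
  qed
qed

text \<open>The quotient \<open>(s - 1) / zeta1 s\<close> is \<open>1 / zeta s\<close> made
  holomorphic at 1. The bounded part \<open>\<bar>Im s\<bar> \<le> 4\<close> is compact and contains
  no zero, so it affects only the constant. The extra 1 in the exponent for \<open>zeta1\<close> is
  the factor \<open>s - 1\<close>.\<close>

lemma zeta1_subpolynomial:
  assumes \<theta>: "0 \<le> \<theta>" "\<theta> < \<sigma>" "\<theta> < 1" and nz: "\<And>s. Re s > \<theta> \<Longrightarrow> zeta1 s \<noteq> 0" and \<epsilon>: "\<epsilon> > 0"
  obtains C where "C > 0"
    "\<And>s. \<sigma> \<le> Re s \<Longrightarrow> Re s \<le> 2 \<Longrightarrow> norm (zeta1 s) \<le> C * (1 + \<bar>Im s\<bar>) powr (1 + \<epsilon>)"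
    "\<And>s. \<sigma> \<le> Re s \<Longrightarrow> Re s \<le> 2 \<Longrightarrow> norm ((s - 1) / zeta1 s) \<le> C * (1 + \<bar>Im s\<bar>) powr \<epsilon>"
proof -
  define \<sigma>' where "\<sigma>' = min \<sigma> 1"
  have \<sigma>': "\<theta> < \<sigma>'" "\<sigma>' \<le> 1" "\<sigma>' \<le> \<sigma>" using \<theta> by (auto simp: \<sigma>'_def)
  obtain C where C: "C > 0"
    "\<And>s. \<sigma>' \<le> Re s \<Longrightarrow> Re s \<le> 2 \<Longrightarrow> \<bar>Im s\<bar> \<ge> 4 \<Longrightarrow> \<bar>ln (norm (zeta s))\<bar> \<le> \<epsilon> * ln \<bar>Im s\<bar> + C"
    using zeta_subpolynomial_aux[OF \<theta>(1) \<sigma>'(1,2) nz \<epsilon>] by metis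
  define Q where "Q = cbox (Complex \<sigma>' (-4)) (Complex 2 4)"
  have Q: "s \<in> Q \<longleftrightarrow> \<sigma>' \<le> Re s \<and> Re s \<le> 2 \<and> \<bar>Im s\<bar> \<le> 4" for s
    by (auto simp: Q_def in_cbox_complex_iff)
  have nzQ: "zeta1 s \<noteq> 0" if "s \<in> Q" for s using that nz[of s] \<sigma>' by (auto simp: Q)
  have "compact Q" by (simp add: Q_def)
  have "bounded (zeta1 ` Q)"
    by (intro compact_imp_bounded compact_continuous_image zeta1_continuous \<open>compact Q\<close>)
  then obtain B1 where B1: "\<And>s. s \<in> Q \<Longrightarrow> norm (zeta1 s) \<le> B1" unfolding bounded_iff by blast
  have "bounded ((\<lambda>s. (s - 1) / zeta1 s) ` Q)"
    by (intro compact_imp_bounded compact_continuous_image continuous_intros zeta1_continuous \<open>compact Q\<close>)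
       (use nzQ in auto)
  then obtain B2 where B2: "\<And>s. s \<in> Q \<Longrightarrow> norm ((s - 1) / zeta1 s) \<le> B2" unfolding bounded_iff by blast
  define D where "D = exp C * 2 + \<bar>B1\<bar> + \<bar>B2\<bar>"
  have D: "D > 0" "exp C \<le> D" "2 * exp C \<le> D" "B1 \<le> D" "B2 \<le> D" using exp_gt_zero[of C] unfolding D_def by linarith+
  show ?thesis
  proof (rule that[OF D(1)])
    fix s :: complex assume s: "\<sigma> \<le> Re s" "Re s \<le> 2"
    define t where "t = 1 + \<bar>Im s\<bar>"
    have t: "t \<ge> 1" by (simp add: t_def)
    have "norm (zeta1 s) \<le> D * t powr (1 + \<epsilon>) \<and> norm ((s - 1) / zeta1 s) \<le> D * t powr \<epsilon>"
    proof (cases "\<bar>Im s\<bar> \<le> 4")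
      case True
      hence "s \<in> Q" using s \<sigma>' by (auto simp: Q)
      moreover have "1 \<le> t powr (1 + \<epsilon>)" "1 \<le> t powr \<epsilon>" using t \<epsilon> by (auto intro!: ge_one_powr_ge_zero)
      moreover from this have "D * 1 \<le> D * t powr (1 + \<epsilon>)" "D * 1 \<le> D * t powr \<epsilon>"
        using D(1) by (intro mult_left_mono; simp)+
      ultimately show ?thesis using B1[of s] B2[of s] D(4,5) by auto
    next
      case False
      define u where "u = \<bar>Im s\<bar>"
      have u: "u \<ge> 4" "u \<le> t" using False by (auto simp: u_def t_def)
      have s1: "s \<noteq> 1" using False by auto
      have z0: "zeta s \<noteq> 0" using nz[of s] s \<theta> s1 by (simp add: zeta_eq_zeta1)
      have ln: "\<bar>ln (norm (zeta s))\<bar> \<le> \<epsilon> * ln u + C" unfolding u_def by (rule C(2)) (use s False \<sigma>' in auto)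
      have "exp (ln (norm (zeta s))) \<le> exp (\<epsilon> * ln u + C)" "exp (- ln (norm (zeta s))) \<le> exp (\<epsilon> * ln u + C)"
        using ln by auto
      moreover have "exp (\<epsilon> * ln u + C) = exp C * u powr \<epsilon>" using u by (simp add: powr_def exp_add)
      moreover have "exp C * u powr \<epsilon> \<le> exp C * t powr \<epsilon>" using u \<epsilon> by (intro mult_left_mono powr_mono2) auto
      ultimately have "exp (ln (norm (zeta s))) \<le> exp C * t powr \<epsilon>" "exp (- ln (norm (zeta s))) \<le> exp C * t powr \<epsilon>"
        by linarith+
      hence z: "norm (zeta s) \<le> exp C * t powr \<epsilon>" "1 / norm (zeta s) \<le> exp C * t powr \<epsilon>"
        using z0 by (auto simp: exp_minus inverse_eq_divide)
      have "norm (s - 1) \<le> 2 * t"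
      proof -
        have "norm (s - 1) \<le> \<bar>Re s - 1\<bar> + \<bar>Im s\<bar>" using cmod_le[of "s - 1"] by simp
        thus ?thesis using s \<theta> by (auto simp: t_def)
      qed
      hence "norm (zeta1 s) \<le> (2 * t) * (exp C * t powr \<epsilon>)"
        using z(1) s1 t by (auto simp: zeta1_def norm_mult intro!: mult_mono)
      also have "\<dots> = 2 * exp C * t powr (1 + \<epsilon>)" using t by (simp add: powr_add)
      also have "\<dots> \<le> D * t powr (1 + \<epsilon>)" using D by (intro mult_right_mono) auto
      finally have "norm (zeta1 s) \<le> D * t powr (1 + \<epsilon>)" .
      moreover have "norm ((s - 1) / zeta1 s) = 1 / norm (zeta s)"
        using s1 z0 by (simp add: zeta1_def norm_divide norm_mult)
      moreover have "exp C * t powr \<epsilon> \<le> D * t powr \<epsilon>" using D by (intro mult_right_mono) auto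
      ultimately show ?thesis using z(2) by simp
    qed
    thus "norm (zeta1 s) \<le> D * (1 + \<bar>Im s\<bar>) powr (1 + \<epsilon>)"
      "norm ((s - 1) / zeta1 s) \<le> D * (1 + \<bar>Im s\<bar>) powr \<epsilon>" by (auto simp: t_def)
  qed
qed

section \<open>Perron's formula\<close>

text \<open>The power \<open>y ^ s\<close> of a positive real \<open>y\<close>, written with the
  real logarithm so that it is visibly entire in \<open>s\<close>.\<close>

definition cp :: "real \<Rightarrow> complex \<Rightarrow> complex" where
  "cp y s = exp (s * of_real (ln y))"

lemma norm_cp: "y > 0 \<Longrightarrow> norm (cp y s) = y powr Re s"
  by (simp add: cp_def powr_def)

lemma cp_mult: "x > 0 \<Longrightarrow> y > 0 \<Longrightarrow> cp (x * y) s = cp x s * cp y s"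
  by (simp add: cp_def ln_mult algebra_simps flip: exp_add)

lemma cp_add: "cp y (s + t) = cp y s * cp y t"
  by (simp add: cp_def algebra_simps flip: exp_add)

lemma cp_of_real: "y > 0 \<Longrightarrow> cp y (of_real p) = of_real (y powr p)"
  by (simp add: cp_def powr_def flip: of_real_mult exp_of_real)

lemma npow_eq_cp: "n > 0 \<Longrightarrow> npow n s = cp (1 / n) s"
  by (simp add: npow_def cp_def powr_def ln_div)

lemma cp_npow: "n > 0 \<Longrightarrow> x > 0 \<Longrightarrow> npow n s * cp x s = cp (x / n) s"
  using cp_mult[of "1 / n" x s] by (simp add: npow_eq_cp)

lemma cp_holomorphic [holomorphic_intros]: "cp y holomorphic_on S"
  unfolding cp_def by (auto intro!: holomorphic_intros)

lemma cp_continuous: "continuous_on S (cp y)"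
  by (intro holomorphic_on_imp_continuous_on cp_holomorphic)

definition vint :: "real \<Rightarrow> real \<Rightarrow> (complex \<Rightarrow> complex) \<Rightarrow> complex" where
  "vint c T f = contour_integral (linepath (Complex c (-T)) (Complex c T)) f"

lemma vint_eq_integral:
  assumes "T > 0"
  shows "vint c T f = \<i> * integral {-T..T} (\<lambda>t. f (Complex c t))"
proof -
  let ?g = "\<lambda>z. f (of_real c + \<i> * z)"
  have "vint c T f = integral {0..1} (\<lambda>x. f (linepath (Complex c (-T)) (Complex c T) x) * (Complex c T - Complex c (-T)))"
    by (simp add: vint_def contour_integral_integral)
  also have "\<dots> = integral {0..1} (\<lambda>x. \<i> * (?g (linepath (of_real (-T)) (of_real T) x) * (of_real T - of_real (-T))))"
  proof (rule arg_cong[where f = "integral _"], rule ext)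
    fix x :: real
    have "linepath (Complex c (-T)) (Complex c T) x = of_real c + \<i> * linepath (of_real (-T)) (of_real T) x"
      by (simp add: linepath_def complex_eq_iff algebra_simps)
    moreover have "Complex c T - Complex c (-T) = \<i> * (of_real T - of_real (-T))"
      by (simp add: complex_eq_iff)
    ultimately show "f (linepath (Complex c (-T)) (Complex c T) x) * (Complex c T - Complex c (-T)) =
      \<i> * (?g (linepath (of_real (-T)) (of_real T) x) * (of_real T - of_real (-T)))"
      by (simp only: mult_ac)
  qed
  also have "\<dots> = \<i> * contour_integral (linepath (of_real (-T)) (of_real T)) ?g"
    by (simp add: contour_integral_integral)
  also have "contour_integral (linepath (of_real (-T)) (of_real T)) ?g = integral {-T..T} (\<lambda>x. ?g (of_real x))"
    using assms by (subst contour_integral_linepath_Reals_eq) auto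
  also have "(\<lambda>x. ?g (of_real x)) = (\<lambda>t. f (Complex c t))"
    by (auto simp: fun_eq_iff Complex_eq)
  finally show ?thesis .
qed

text \<open>The boundary integral \<open>I\<close> is the difference of the two vertical sides up to
  the horizontal sides, each of length \<open>c2 - c1\<close> with integrand at most
  \<open>E\<close>. It serves both to close a contour around poles and to move a line of
  integration.\<close>

lemma vint_rectangle:
  assumes c: "c1 < c2" and T: "T > 0"
    and I: "(f has_contour_integral I) (rectpath (Complex c1 (-T)) (Complex c2 T))"
    and cont: "continuous_on (path_image (rectpath (Complex c1 (-T)) (Complex c2 T))) f"
    and E: "E \<ge> 0" "\<And>s. c1 \<le> Re s \<Longrightarrow> Re s \<le> c2 \<Longrightarrow> \<bar>Im s\<bar> = T \<Longrightarrow> norm (f s) \<le> E"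
  shows "norm (vint c2 T f - vint c1 T f - I) \<le> 2 * (c2 - c1) * E"
proof -
  define a1 a2 a3 a4 where a: "a1 = Complex c1 (-T)" "a2 = Complex c2 (-T)" "a3 = Complex c2 T" "a4 = Complex c1 T"
  have rp: "rectpath a1 a3 = linepath a1 a2 +++ linepath a2 a3 +++ linepath a3 a4 +++ linepath a4 a1"
    by (simp add: rectpath_def Let_def a)
  have segs: "closed_segment a1 a2 \<subseteq> path_image (rectpath a1 a3)" "closed_segment a2 a3 \<subseteq> path_image (rectpath a1 a3)"
    "closed_segment a3 a4 \<subseteq> path_image (rectpath a1 a3)" "closed_segment a4 a1 \<subseteq> path_image (rectpath a1 a3)"
    unfolding rp by (auto simp: path_image_join)
  have ints: "f contour_integrable_on linepath a1 a2" "f contour_integrable_on linepath a2 a3" 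
    "f contour_integrable_on linepath a3 a4" "f contour_integrable_on linepath a4 a1"
    by (intro contour_integrable_continuous_linepath continuous_on_subset[OF cont] segs[unfolded a[symmetric]]; 
        use segs in \<open>simp add: a\<close>)+
  have "I = contour_integral (rectpath a1 a3) f" using I by (simp add: a contour_integral_unique)
  also have "\<dots> = contour_integral (linepath a1 a2) f + (contour_integral (linepath a2 a3) f + 
      (contour_integral (linepath a3 a4) f + contour_integral (linepath a4 a1) f))"
    unfolding rp using ints by (simp add: contour_integral_join)
  also have "contour_integral (linepath a4 a1) f = - vint c1 T f"
    unfolding vint_def a[symmetric]
    by (rule contour_integral_reverse_linepath) (intro continuous_on_subset[OF cont], use segs in \<open>simp add: a\<close>)
  also have "contour_integral (linepath a2 a3) f = vint c2 T f" by (simp add: vint_def a)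
  finally have "vint c2 T f - vint c1 T f - I = - (contour_integral (linepath a1 a2) f + contour_integral (linepath a3 a4) f)"
    by simp
  moreover have "norm (contour_integral (linepath a1 a2) f) \<le> E * norm (a2 - a1)"
    by (intro contour_integral_bound_linepath ints E) (use c T in \<open>auto simp: a closed_segment_same_Im closed_segment_eq_real_ivl\<close>)
  moreover have "norm (contour_integral (linepath a3 a4) f) \<le> E * norm (a4 - a3)"
    by (intro contour_integral_bound_linepath ints E) (use c T in \<open>auto simp: a closed_segment_same_Im closed_segment_eq_real_ivl split: if_splits\<close>)
  moreover have "norm (a2 - a1) = c2 - c1" "norm (a4 - a3) = c2 - c1"
    using c by (auto simp: a cmod_def)
  ultimately have "norm (vint c2 T f - vint c1 T f - I) \<le> E * (c2 - c1) + E * (c2 - c1)"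
    by (simp only: norm_minus_cancel) (rule norm_triangle_mono)
  thus ?thesis by (simp add: mult_ac)
qed

lemma vint_bound:
  assumes "T > 0" "continuous_on {s. Re s = c} f" "E \<ge> 0" "\<And>s. Re s = c \<Longrightarrow> norm (f s) \<le> E"
  shows "norm (vint c T f) \<le> 2 * T * E"
proof -
  have seg: "closed_segment (Complex c (-T)) (Complex c T) \<subseteq> {s. Re s = c}"
    by (auto simp: closed_segment_same_Re)
  have "norm (vint c T f) \<le> E * norm (Complex c T - Complex c (-T))"
    unfolding vint_def
    by (intro contour_integral_bound_linepath contour_integrable_continuous_linepath 
        continuous_on_subset[OF assms(2) seg] assms) (use seg in auto)
  also have "norm (Complex c T - Complex c (-T)) = 2 * T" using assms(1) by (simp add: cmod_def real_sqrt_mult)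
  finally show ?thesis by (simp add: mult_ac)
qed

text \<open>The contribution of a simple pole at \<open>p\<close> to the integral of
  \<open>y ^ s / (s - p)\<close> along \<open>Re s = c\<close>, divided by
  \<open>2 * pi * i\<close>. For \<open>y \<ge> 1\<close> the contour is closed on the left and
  meets the poles \<open>p < c\<close>; for \<open>y < 1\<close> it is closed on the right, where
  the reversed orientation gives the minus sign.\<close>

definition perron_term :: "real \<Rightarrow> real \<Rightarrow> real \<Rightarrow> real" where
  "perron_term c p y = (if p < c then if y \<ge> 1 then y powr p else 0 else if y < 1 then - (y powr p) else 0)"

definition perron_res :: "real \<Rightarrow> real \<Rightarrow> real \<Rightarrow> real \<Rightarrow> real" where
  "perron_res c a b y = (perron_term c b y - perron_term c a y) / (b - a)"

text \<open>The segment is completed to a rectangle of width and half-height \<open>T\<close> on the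
  side where \<open>y powr Re s\<close> does not exceed \<open>y powr c\<close>. Since
  \<open>a\<close> and \<open>b\<close> lie within \<open>T / 2\<close> of the line
  \<open>Re s = c\<close>, the denominator is at least \<open>T^2\<close> on the horizontal sides
  and \<open>T^2 / 4\<close> on the far side. These contribute 2 and 8 to the constant 10.\<close>

lemma perron_kernel:
  assumes ab: "a \<noteq> b" "a \<noteq> c" "b \<noteq> c" and y: "y > 0" and T: "T > 0" "T \<ge> 2 * \<bar>a - c\<bar>" "T \<ge> 2 * \<bar>b - c\<bar>"
  shows "norm (vint c T (\<lambda>s. cp y s / ((s - of_real a) * (s - of_real b))) - 2 * pi * \<i> * perron_res c a b y) \<le> 10 * y powr c / T"
proof -
  let ?f = "\<lambda>s. cp y s / ((s - of_real a) * (s - of_real b))"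
  have nz: "s \<noteq> of_real a \<and> s \<noteq> of_real b" if "\<bar>Im s\<bar> = T \<or> Re s = c \<or> Re s = c + T \<or> Re s = c - T" for s
    using that ab T by auto
  have far_im: "norm (?f s) \<le> y powr Re s / T\<^sup>2" if "\<bar>Im s\<bar> = T" for s
  proof -
    have "norm (s - of_real a) \<ge> T" "norm (s - of_real b) \<ge> T"
      using abs_Im_le_cmod[of "s - of_real a"] abs_Im_le_cmod[of "s - of_real b"] that by auto
    hence "T * T \<le> norm ((s - of_real a) * (s - of_real b))"
      unfolding norm_mult using T by (intro mult_mono) auto
    thus ?thesis unfolding norm_divide norm_cp[OF y] power2_eq_square
      using T y by (intro frac_le) auto
  qed
  have far_re: "norm (?f s) \<le> 4 * y powr Re s / T\<^sup>2" if "\<bar>Re s - c\<bar> = T" for s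
  proof -
    have "norm (s - of_real a) \<ge> T / 2" "norm (s - of_real b) \<ge> T / 2"
    proof -
      have "T / 2 \<le> \<bar>Re s - a\<bar>" "T / 2 \<le> \<bar>Re s - b\<bar>" 
        using abs_triangle_ineq[of "Re s - a" "a - c"] abs_triangle_ineq[of "Re s - b" "b - c"] that T by simp_all
      thus "norm (s - of_real a) \<ge> T / 2" "norm (s - of_real b) \<ge> T / 2"
        using abs_Re_le_cmod[of "s - of_real a"] abs_Re_le_cmod[of "s - of_real b"] by auto
    qed
    hence "(T / 2) * (T / 2) \<le> norm ((s - of_real a) * (s - of_real b))"
      unfolding norm_mult using T by (intro mult_mono) auto
    hence "norm (?f s) \<le> y powr Re s / ((T / 2) * (T / 2))"
      unfolding norm_divide norm_cp[OF y] using T y by (intro frac_le) auto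
    thus ?thesis by (simp add: power2_eq_square mult.commute)
  qed
  have cont: "continuous_on S ?f" if "\<And>s. s \<in> S \<Longrightarrow> s \<noteq> of_real a \<and> s \<noteq> of_real b" for S
    by (intro continuous_intros cp_continuous) (use that in auto)
  define W where "W = (\<lambda>c1 c2 p. if c1 < p \<and> p < c2 then cp y (of_real p) else 0)"
  have rect: "(?f has_contour_integral (2 * pi * \<i> * (W c1 c2 b - W c1 c2 a) / (of_real b - of_real a))) (rectpath (Complex c1 (-T)) (Complex c2 T))"
    if c12: "c1 < c2" "a \<noteq> c1" "a \<noteq> c2" "b \<noteq> c1" "b \<noteq> c2" for c1 c2
  proof -
    let ?\<gamma> = "rectpath (Complex c1 (-T)) (Complex c2 T)"
    have pole: "((\<lambda>s. cp y s / (s - of_real p)) has_contour_integral (2 * pi * \<i> * W c1 c2 p)) ?\<gamma>" if p: "p \<noteq> c1" "p \<noteq> c2" for p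
    proof -
      have "((\<lambda>s. cp y s / (s - of_real p)) has_contour_integral (2 * pi * \<i> * winding_number ?\<gamma> (of_real p) * cp y (of_real p))) ?\<gamma>"
      proof (rule Cauchy_integral_formula_convex_simple[of UNIV])
        show "path_image ?\<gamma> \<subseteq> UNIV - {of_real p}"
          using p c12 T by (subst path_image_rectpath) auto
      qed (auto intro!: holomorphic_intros)
      also have "winding_number ?\<gamma> (of_real p) = (if c1 < p \<and> p < c2 then 1 else 0)"
      proof (cases "c1 < p \<and> p < c2")
        case True
        thus ?thesis using T by (subst winding_number_rectpath) (auto simp: in_box_complex_iff)
      next
        case False
        thus ?thesis using T c12 p by (subst winding_number_rectpath_outside) (auto simp: in_cbox_complex_iff)
      qed
      finally show ?thesis by (auto simp: W_def split: if_splits)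
    qed
    have "((\<lambda>s. (cp y s / (s - of_real b) - cp y s / (s - of_real a)) / (of_real b - of_real a)) has_contour_integral 
        ((2 * pi * \<i> * W c1 c2 b - 2 * pi * \<i> * W c1 c2 a) / (of_real b - of_real a))) ?\<gamma>"
      by (intro has_contour_integral_div has_contour_integral_diff pole c12)
    hence "(?f has_contour_integral ((2 * pi * \<i> * W c1 c2 b - 2 * pi * \<i> * W c1 c2 a) / (of_real b - of_real a))) ?\<gamma>"
    proof (rule has_contour_integral_eq)
      fix s assume "s \<in> path_image ?\<gamma>"
      hence "s \<noteq> of_real a" "s \<noteq> of_real b" using c12 T by (auto simp: path_image_rectpath)
      moreover have "complex_of_real b \<noteq> of_real a" using ab by simp
      ultimately show "(cp y s / (s - of_real b) - cp y s / (s - of_real a)) / (of_real b - of_real a) = ?f s"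
        by (simp add: divide_simps) (simp add: algebra_simps)
    qed
    thus ?thesis by (simp add: algebra_simps)
  qed
  have imgnz: "s \<noteq> of_real a \<and> s \<noteq> of_real b" 
    if "s \<in> path_image (rectpath (Complex c1 (-T)) (Complex c2 T))" "c1 < c2" "{c1,c2} \<subseteq> {c, c+T, c-T}" for s c1 c2
    using that T by (intro nz) (auto simp: path_image_rectpath)
  show ?thesis
  proof (cases "y \<ge> 1")
    case True
    define I where "I = 2 * pi * \<i> * (W (c - T) c b - W (c - T) c a) / (of_real b - of_real a)"
    have ne: "a \<noteq> c - T" "b \<noteq> c - T" using nz[of "of_real a"] nz[of "of_real b"] by auto
    have I: "I = 2 * pi * \<i> * perron_res c a b y"
      using True y T ab unfolding I_def W_def perron_res_def perron_term_def by (auto simp: cp_of_real)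
    have "norm (vint c T ?f - vint (c - T) T ?f - I) \<le> 2 * (c - (c - T)) * (y powr c / T\<^sup>2)"
    proof (rule vint_rectangle)
      show "(?f has_contour_integral I) (rectpath (Complex (c - T) (-T)) (Complex c T))"
        unfolding I_def by (rule rect) (use ab ne T in auto)
      show "continuous_on (path_image (rectpath (Complex (c - T) (-T)) (Complex c T))) ?f"
        by (intro cont imgnz[of _ "c - T" c]) (use T in auto)
      fix s assume s: "c - T \<le> Re s" "Re s \<le> c" "\<bar>Im s\<bar> = T"
      have "y powr Re s \<le> y powr c" using True s by (intro powr_mono) auto
      thus "norm (?f s) \<le> y powr c / T\<^sup>2"
        using far_im[OF s(3)] T by (meson divide_right_mono order_trans zero_le_power2)
    qed (use T in auto)
    moreover have "norm (vint (c - T) T ?f) \<le> 2 * T * (4 * y powr c / T\<^sup>2)"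
    proof (rule vint_bound)
      show "continuous_on {s. Re s = c - T} ?f" by (intro cont nz) auto
      fix s assume s: "Re s = c - T"
      have "y powr Re s \<le> y powr c" using True s T by (intro powr_mono) auto
      thus "norm (?f s) \<le> 4 * y powr c / T\<^sup>2"
        using far_re[of s] s T by (smt (verit) divide_right_mono zero_le_power2)
    qed (use T in auto)
    ultimately have "norm (vint c T ?f - I) \<le> 2 * T * (y powr c / T\<^sup>2) + 2 * T * (4 * y powr c / T\<^sup>2)"
      using norm_triangle_ineq[of "vint c T ?f - vint (c - T) T ?f - I" "vint (c - T) T ?f"] by simp
    also have "\<dots> = 10 * y powr c / T" using T by (simp add: power2_eq_square)
    finally show ?thesis unfolding I .
  next
    case False
    define I where "I = 2 * pi * \<i> * (W c (c + T) b - W c (c + T) a) / (of_real b - of_real a)"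
    have ne: "a \<noteq> c + T" "b \<noteq> c + T" using nz[of "of_real a"] nz[of "of_real b"] by auto
    have I: "- I = 2 * pi * \<i> * perron_res c a b y"
    proof -
      have W: "W c (c + T) p = - of_real (perron_term c p y)" if "p \<in> {a, b}" for p
        using False y T ab that by (auto simp: W_def perron_term_def cp_of_real)
      have eq: "W c (c + T) b - W c (c + T) a = - of_real (perron_term c b y - perron_term c a y)"
        by (simp add: W)
      have neg: "- (K * (- z) / D) = K * (z / D)" for K z D :: complex by simp
      show ?thesis unfolding I_def perron_res_def eq neg by simp
    qed
    have "norm (vint (c + T) T ?f - vint c T ?f - I) \<le> 2 * (c + T - c) * (y powr c / T\<^sup>2)"
    proof (rule vint_rectangle)
      show "(?f has_contour_integral I) (rectpath (Complex c (-T)) (Complex (c + T) T))"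
        unfolding I_def by (rule rect) (use ab ne T in auto)
      show "continuous_on (path_image (rectpath (Complex c (-T)) (Complex (c + T) T))) ?f"
        by (intro cont imgnz[of _ c "c + T"]) (use T in auto)
      fix s assume s: "c \<le> Re s" "Re s \<le> c + T" "\<bar>Im s\<bar> = T"
      have "y powr Re s \<le> y powr c" using False y s by (intro powr_mono') auto
      thus "norm (?f s) \<le> y powr c / T\<^sup>2"
        using far_im[OF s(3)] T by (meson divide_right_mono order_trans zero_le_power2)
    qed (use T in auto)
    moreover have "norm (vint (c + T) T ?f) \<le> 2 * T * (4 * y powr c / T\<^sup>2)"
    proof (rule vint_bound)
      show "continuous_on {s. Re s = c + T} ?f" by (intro cont nz) auto
      fix s assume s: "Re s = c + T"
      have "y powr Re s \<le> y powr c" using False y s T by (intro powr_mono') auto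
      thus "norm (?f s) \<le> 4 * y powr c / T\<^sup>2"
        using far_re[of s] s T by (smt (verit) divide_right_mono zero_le_power2)
    qed (use T in auto)
    ultimately have "norm (vint c T ?f - (- I)) \<le> 2 * T * (y powr c / T\<^sup>2) + 2 * T * (4 * y powr c / T\<^sup>2)"
      using norm_triangle_ineq4[of "vint (c + T) T ?f" "vint (c + T) T ?f - vint c T ?f - I"] by simp
    also have "\<dots> = 10 * y powr c / T" using T by (simp add: power2_eq_square)
    finally show ?thesis unfolding I .
  qed
qed

text \<open>On a finite segment of the line \<open>Re s = c > 1\<close> the Dirichlet series
  converges uniformly, so it may be integrated termwise. The errors of \<open>perron_kernel\<close>
  at \<open>y = x / n\<close> are proportional to \<open>n powr (- c)\<close> and can be
  summed.\<close>

lemma perron_series: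
  fixes f :: "nat \<Rightarrow> real"
  assumes ab: "a \<noteq> b" "a \<noteq> c" "b \<noteq> c" and x: "x > 0" and T: "T > 0" "T \<ge> 2 * \<bar>a - c\<bar>" "T \<ge> 2 * \<bar>b - c\<bar>"
    and c: "c > 1" and coeff: "\<And>n. \<bar>f n\<bar> \<le> 1"
    and A: "\<And>s. Re s = c \<Longrightarrow> (\<lambda>n. f n * npow (Suc n) s) sums A s"
    and S: "(\<lambda>n. f n * perron_res c a b (x / Suc n)) sums S"
  shows "norm (vint c T (\<lambda>s. A s * (cp x s / ((s - of_real a) * (s - of_real b)))) - 2 * pi * \<i> * S)
           \<le> 10 * x powr c * (\<Sum>n. real (Suc n) powr (-c)) / T"
proof -
  define k where "k = (\<lambda>s. cp x s / ((s - complex_of_real a) * (s - of_real b)))"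
  let ?\<gamma> = "linepath (Complex c (-T)) (Complex c T)"
  have seg: "path_image ?\<gamma> \<subseteq> {s. Re s = c}"
    by (auto simp: closed_segment_same_Re)
  have nz: "s \<noteq> of_real a" "s \<noteq> of_real b" if "Re s = c" for s using that ab by auto
  have kcont: "continuous_on {s. Re s = c} k"
    unfolding k_def by (intro continuous_intros cp_continuous) (use nz in auto)
  have npc: "continuous_on S (npow (Suc n))" for S n
    by (intro holomorphic_on_imp_continuous_on npow_holomorphic) auto
  have "compact (k ` path_image ?\<gamma>)"
    by (intro compact_continuous_image continuous_on_subset[OF kcont seg]) auto
  hence "bounded (k ` path_image ?\<gamma>)" by (rule compact_imp_bounded)
  then obtain K where K: "\<And>s. s \<in> path_image ?\<gamma> \<Longrightarrow> norm (k s) \<le> K"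
    unfolding bounded_iff by blast
  have summ: "summable (\<lambda>n. real (Suc n) powr (-c))" using summable_Suc_powr[OF c, of 1] by simp
  have nle: "norm (f n * npow (Suc n) s) \<le> real (Suc n) powr (-c)" if "Re s = c" for n s
    using coeff[of n] that by (auto simp: norm_mult norm_npow intro!: mult_left_le_one_le simp del: of_nat_Suc)
  define F where "F = (\<lambda>n s. f n * npow (Suc n) s * k s)"
  have unif: "uniform_limit (path_image ?\<gamma>) (\<lambda>N s. \<Sum>n<N. F n s) (\<lambda>s. \<Sum>n. F n s) sequentially"
  proof (rule Weierstrass_m_test)
    show "summable (\<lambda>n. K * real (Suc n) powr (-c))" by (intro summable_mult summ)
    show "norm (F n s) \<le> K * real (Suc n) powr (-c)" if "s \<in> path_image ?\<gamma>" for n s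
      unfolding F_def norm_mult[of _ "k s"] using mult_mono[OF nle[of s n] K[OF that]] that seg by (auto simp: mult_ac)
  qed
  have Feq: "(\<Sum>n. F n s) = A s * k s" if "Re s = c" for s
    using sums_mult2[OF A[OF that], of "k s"] by (simp add: F_def sums_iff)
  have Fint: "F n contour_integrable_on ?\<gamma>" for n
    unfolding F_def by (intro contour_integrable_continuous_linepath continuous_intros npc 
        continuous_on_subset[OF kcont]) (use seg in auto)
  have "((\<lambda>N. contour_integral ?\<gamma> (\<lambda>s. \<Sum>n<N. F n s)) \<longlonglongrightarrow> contour_integral ?\<gamma> (\<lambda>s. \<Sum>n. F n s))"
  proof (rule contour_integral_uniform_limit(2)[OF _ unif, where B = "norm (Complex c T - Complex c (-T))"])
    show "\<forall>\<^sub>F N in sequentially. (\<lambda>s. \<Sum>n<N. F n s) contour_integrable_on ?\<gamma>"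
      by (intro always_eventually allI contour_integrable_sum Fint) auto
  qed auto
  also have "contour_integral ?\<gamma> (\<lambda>s. \<Sum>n. F n s) = contour_integral ?\<gamma> (\<lambda>s. A s * k s)"
    by (rule contour_integral_eq) (use seg Feq in blast)
  also have "(\<lambda>N. contour_integral ?\<gamma> (\<lambda>s. \<Sum>n<N. F n s)) = (\<lambda>N. \<Sum>n<N. contour_integral ?\<gamma> (F n))"
    by (intro ext contour_integral_sum) (auto intro: Fint)
  finally have s1: "(\<lambda>n. contour_integral ?\<gamma> (F n)) sums vint c T (\<lambda>s. A s * k s)"
    by (simp add: sums_def vint_def)
  have s2: "(\<lambda>n. contour_integral ?\<gamma> (F n) - 2 * pi * \<i> * (f n * perron_res c a b (x / Suc n))) sums
     (vint c T (\<lambda>s. A s * k s) - 2 * pi * \<i> * S)"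
    by (intro sums_diff s1 sums_mult sums_of_real S)
  have le: "norm (contour_integral ?\<gamma> (F n) - 2 * pi * \<i> * (f n * perron_res c a b (x / Suc n))) \<le> 
     (10 * x powr c / T) * real (Suc n) powr (-c)" for n
  proof -
    let ?y = "x / Suc n"
    have y: "?y > 0" using x by simp
    have "F n = (\<lambda>s. f n * (cp ?y s / ((s - of_real a) * (s - of_real b))))"
      using cp_npow[of "Suc n" x] x by (auto simp: F_def k_def fun_eq_iff mult.assoc)
    hence "contour_integral ?\<gamma> (F n) = f n * vint c T (\<lambda>s. cp ?y s / ((s - of_real a) * (s - of_real b)))"
      unfolding vint_def
      by (simp only:, intro contour_integral_lmul contour_integrable_continuous_linepath continuous_intros cp_continuous)
         (use nz seg in auto)
    hence "contour_integral ?\<gamma> (F n) - 2 * pi * \<i> * (f n * perron_res c a b ?y) = 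
      f n * (vint c T (\<lambda>s. cp ?y s / ((s - of_real a) * (s - of_real b))) - 2 * pi * \<i> * perron_res c a b ?y)"
      by (simp add: algebra_simps)
    also have "norm \<dots> \<le> 1 * (10 * ?y powr c / T)"
      unfolding norm_mult[of "complex_of_real (f n)"] norm_of_real real_norm_def
      by (intro mult_mono coeff perron_kernel ab T y) auto
    also have "?y powr c = x powr c * real (Suc n) powr (-c)"
      using x by (simp add: powr_divide powr_minus_divide)
    finally show ?thesis by (simp add: mult_ac)
  qed
  have "norm (vint c T (\<lambda>s. A s * k s) - 2 * pi * \<i> * S) \<le> (\<Sum>n. (10 * x powr c / T) * real (Suc n) powr (-c))"
    using norm_suminf_le[OF le summable_mult[OF summ]] s2 by (simp add: sums_iff)
  also have "\<dots> = 10 * x powr c * (\<Sum>n. real (Suc n) powr (-c)) / T"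
    by (subst suminf_mult[OF summ]) simp
  finally show ?thesis by (simp add: k_def)
qed

lemma tendsto_at_top_error_bound:
  fixes f :: "real \<Rightarrow> 'a::real_normed_vector"
  assumes "\<forall>\<^sub>F T in at_top. norm (f T - L) \<le> g T" "(g \<longlongrightarrow> 0) at_top"
  shows "(f \<longlongrightarrow> L) at_top"
  using Lim_null_comparison[OF assms] by (simp add: Lim_null[symmetric])

text \<open>The line of integration moves from abscissa 2 to \<open>\<sigma>\<close>. As neither
  \<open>a\<close> nor \<open>b\<close> lies in between, no residue is picked up and
  \<open>S\<close> is still formed with the residues for abscissa 2. The horizontal sides are
  \<open>O(T powr (\<epsilon> - 2))\<close>.\<close>

lemma perron_shifted:
  fixes f :: "nat \<Rightarrow> real"
  assumes ab: "a \<noteq> b" "a \<notin> {\<sigma>..2}" "b \<notin> {\<sigma>..2}" and x: "x > 0" and \<sigma>: "\<sigma>0 < \<sigma>" "\<sigma> < 2"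
    and coeff: "\<And>n. \<bar>f n\<bar> \<le> 1"
    and A: "\<And>s. Re s = 2 \<Longrightarrow> (\<lambda>n. f n * npow (Suc n) s) sums A s"
    and S: "(\<lambda>n. f n * perron_res 2 a b (x / Suc n)) sums S"
    and hol: "A holomorphic_on {s. Re s > \<sigma>0}"
    and \<epsilon>: "0 \<le> \<epsilon>" "\<epsilon> < 2" and growth: "\<And>s. \<sigma> \<le> Re s \<Longrightarrow> Re s \<le> 2 \<Longrightarrow> norm (A s) \<le> C * (1 + \<bar>Im s\<bar>) powr \<epsilon>"
  shows "((\<lambda>T. vint \<sigma> T (\<lambda>s. A s * (cp x s / ((s - of_real a) * (s - of_real b))))) \<longlongrightarrow> 2 * pi * \<i> * S) at_top"
proof -
  define F where "F = (\<lambda>s. A s * (cp x s / ((s - complex_of_real a) * (s - of_real b))))"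
  \<comment> \<open>The strip \<open>m < Re s < M\<close> is convex, contains
    \<open>\<sigma> \<le> Re s \<le> 2\<close>, avoids \<open>a\<close> and \<open>b\<close> and
    stays in the domain of \<open>A\<close>. The values \<open>\<sigma>0\<close> and 3 stand in when
    a pole is on the other side.\<close>
  define m where "m = max \<sigma>0 (max (if a < \<sigma> then a else \<sigma>0) (if b < \<sigma> then b else \<sigma>0))"
  define M where "M = min (if a > 2 then a else 3) (if b > 2 then b else 3)"
  define U where "U = {s. Re s > m} \<inter> {s. Re s < M}"
  have m: "m < \<sigma>" and M: "M > 2" using \<sigma> ab by (auto simp: m_def M_def)
  have nz: "s \<noteq> of_real a" "s \<noteq> of_real b" "Re s > \<sigma>0" if "s \<in> U" for s
    using that ab by (auto simp: U_def m_def M_def split: if_splits)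
  have U: "convex U" "open U" unfolding U_def
    by (auto intro!: convex_Int convex_halfspace_Re_gt convex_halfspace_Re_lt open_Int open_halfspace_Re_gt open_halfspace_Re_lt)
  have hF: "F holomorphic_on U"
    unfolding F_def by (intro holomorphic_intros holomorphic_on_subset[OF hol]) (use nz in auto)
  define D where "D = 10 * x powr 2 * (\<Sum>n. real (Suc n) powr (-2))"
  have "((\<lambda>T. vint 2 T F) \<longlongrightarrow> 2 * pi * \<i> * S) at_top"
  proof (rule tendsto_at_top_error_bound)
    show "\<forall>\<^sub>F T in at_top. norm (vint 2 T F - 2 * pi * \<i> * S) \<le> D / T"
      using eventually_ge_at_top[of "max 1 (max (2 * \<bar>a - 2\<bar>) (2 * \<bar>b - 2\<bar>))"]
    proof eventually_elim
      case (elim T)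
      show ?case unfolding F_def D_def
        by (rule perron_series) (use elim ab \<sigma> x coeff A S in auto)
    qed
    show "((\<lambda>T. D / T) \<longlongrightarrow> 0) at_top"
      by (intro tendsto_divide_0[OF tendsto_const] filterlim_at_top_imp_at_infinity filterlim_ident)
  qed
  moreover have "((\<lambda>T. vint 2 T F - vint \<sigma> T F) \<longlongrightarrow> 0) at_top"
  proof (rule tendsto_at_top_error_bound)
    define E where "E = \<bar>C\<bar> * (x powr \<sigma> + x powr 2) * 2 powr \<epsilon>"
    have E: "E \<ge> 0" by (simp add: E_def)
    show "\<forall>\<^sub>F T in at_top. norm (vint 2 T F - vint \<sigma> T F - 0) \<le> 2 * (2 - \<sigma>) * (E * T powr (\<epsilon> - 2))"
      using eventually_ge_at_top[of "1::real"]
    proof eventually_elim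
      case (elim T)
      show ?case
      proof (rule vint_rectangle)
        have img: "path_image (rectpath (Complex \<sigma> (-T)) (Complex 2 T)) \<subseteq> U"
          using elim \<sigma> m M by (subst path_image_rectpath) (auto simp: U_def)
        show "(F has_contour_integral 0) (rectpath (Complex \<sigma> (-T)) (Complex 2 T))"
          by (rule Cauchy_theorem_convex_simple[OF hF U(1)]) (use img in auto)
        show "continuous_on (path_image (rectpath (Complex \<sigma> (-T)) (Complex 2 T))) F"
          by (intro continuous_on_subset[OF holomorphic_on_imp_continuous_on[OF hF]] img)
        fix s assume s: "\<sigma> \<le> Re s" "Re s \<le> 2" "\<bar>Im s\<bar> = T"
        have "norm (s - of_real a) \<ge> T" "norm (s - of_real b) \<ge> T"
          using abs_Im_le_cmod[of "s - of_real a"] abs_Im_le_cmod[of "s - of_real b"] s by auto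
        hence den: "T * T \<le> norm ((s - of_real a) * (s - of_real b))"
          unfolding norm_mult using elim by (intro mult_mono) auto
        have "x powr Re s \<le> x powr \<sigma> \<or> x powr Re s \<le> x powr 2"
          using s x powr_mono[of "Re s" 2 x] powr_mono'[of \<sigma> "Re s" x] by (cases "x \<ge> 1") auto
        hence xp: "x powr Re s \<le> x powr \<sigma> + x powr 2" by (smt (verit) powr_ge_zero)
        have "norm (cp x s / ((s - of_real a) * (s - of_real b))) \<le> (x powr \<sigma> + x powr 2) / (T * T)"
          unfolding norm_divide norm_cp[OF x] using den xp elim by (intro frac_le) auto
        moreover have "norm (A s) \<le> \<bar>C\<bar> * (2 powr \<epsilon> * T powr \<epsilon>)"
        proof -
          have "norm (A s) \<le> C * (1 + T) powr \<epsilon>" using growth[of s] s by simp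
          also have "\<dots> \<le> \<bar>C\<bar> * (2 * T) powr \<epsilon>"
            using elim \<epsilon> by (intro mult_mono powr_mono2) auto
          finally show ?thesis using elim by (simp add: powr_mult)
        qed
        ultimately have "norm (F s) \<le> \<bar>C\<bar> * (2 powr \<epsilon> * T powr \<epsilon>) * ((x powr \<sigma> + x powr 2) / (T * T))"
          unfolding F_def norm_mult[of "A s"] by (intro mult_mono) auto
        also have "\<dots> = E * T powr (\<epsilon> - 2)"
          using elim by (simp add: E_def powr_diff power2_eq_square)
        finally show "norm (F s) \<le> E * T powr (\<epsilon> - 2)" .
      qed (use elim \<sigma> E in auto)
    qed
    have "((\<lambda>T. 2 * (2 - \<sigma>) * (E * T powr (\<epsilon> - 2))) \<longlongrightarrow> 2 * (2 - \<sigma>) * (E * 0)) at_top"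
      using \<epsilon> by (intro tendsto_intros tendsto_neg_powr filterlim_ident) auto
    thus "((\<lambda>T. 2 * (2 - \<sigma>) * (E * T powr (\<epsilon> - 2))) \<longlongrightarrow> 0) at_top" by simp
  qed
  ultimately have "((\<lambda>T. vint 2 T F - (vint 2 T F - vint \<sigma> T F)) \<longlongrightarrow> 2 * pi * \<i> * S - 0) at_top"
    by (rule tendsto_diff)
  thus ?thesis by (simp add: F_def)
qed

section \<open>The upper bound for M\<close>

text \<open>Mean value estimate: the derivative of \<open>u ^ s\<close> in \<open>u\<close> is
  \<open>s * u ^ (s - 1)\<close>. The variable is treated as complex on the real segment from
  \<open>x\<close> to \<open>y\<close>, where \<open>Ln\<close> is holomorphic.\<close>

lemma cp_diff_bound:
  assumes xy: "0 < x" "x \<le> y" and B: "\<And>u. x \<le> u \<Longrightarrow> u \<le> y \<Longrightarrow> u powr (Re s - 1) \<le> B"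
  shows "norm (cp y s - cp x s) \<le> norm s * B * (y - x)"
proof -
  define S where "S = closed_segment (complex_of_real x) (of_real y)"
  have S: "S = of_real ` {x..y}" using xy by (simp add: S_def closed_segment_of_real closed_segment_eq_real_ivl)
  have mem: "z \<in> S \<Longrightarrow> \<exists>u. z = of_real u \<and> x \<le> u \<and> u \<le> y" for z by (auto simp: S)
  have "norm (exp (s * Ln (of_real y)) - exp (s * Ln (of_real x))) \<le> (norm s * B) * norm (complex_of_real y - of_real x)"
  proof (rule field_differentiable_bound[where S = S])
    show "convex S" by (simp add: S_def)
    fix z assume z: "z \<in> S"
    then obtain u where u: "z = of_real u" "x \<le> u" "u \<le> y" using mem by blast
    have u0: "u > 0" using u xy by simp
    show "((\<lambda>z. exp (s * Ln z)) has_field_derivative exp (s * Ln z) * (s / z)) (at z within S)"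
      using u u0 by (auto intro!: derivative_eq_intros simp: complex_nonpos_Reals_iff divide_inverse mult_ac)
    have "exp (s * Ln z) * (s / z) = s * exp ((s - 1) * Ln z)"
    proof -
      have "exp (Ln z) = z" using u u0 by simp
      hence "exp ((s - 1) * Ln z) = exp (s * Ln z) / z" by (simp add: algebra_simps exp_diff)
      thus ?thesis by simp
    qed
    moreover have "norm (exp ((s - 1) * Ln z)) = u powr (Re s - 1)"
      using u0 by (simp add: u powr_def Ln_of_real)
    ultimately show "norm (exp (s * Ln z) * (s / z)) \<le> norm s * B"
      using B[OF u(2,3)] by (simp add: norm_mult mult_left_mono)
  qed (auto simp: S_def)
  moreover have "norm (complex_of_real y - of_real x) = y - x"
    using xy norm_of_real[of "y - x", where 'a = complex] by simp
  ultimately show ?thesis using xy by (simp add: cp_def Ln_of_real)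
qed

definition Mn :: "nat \<Rightarrow> int" where
  "Mn n = (\<Sum>k=1..n. moebius k)"

lemma Mn_0 [simp]: "Mn 0 = 0" and Mn_Suc: "Mn (Suc n) = Mn n + moebius (Suc n)"
  by (simp_all add: Mn_def)

lemma abs_Mn_le: "\<bar>Mn n\<bar> \<le> int n"
proof (induction n)
  case (Suc n)
  thus ?case using abs_moebius_le[of "Suc n"] by (simp add: Mn_Suc)
qed simp

lemma mertens_eq_Mn: "x \<ge> 0 \<Longrightarrow> mertens x = real_of_int (Mn (nat \<lfloor>x\<rfloor>))"
proof -
  assume x: "x \<ge> 0"
  have "{n. 1 \<le> n \<and> real n \<le> x} = {1..nat \<lfloor>x\<rfloor>}"
    using x by (auto simp: le_nat_floor le_nat_iff le_floor_iff)
  thus ?thesis by (simp add: mertens_def Mn_def)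
qed

text \<open>The sum of \<open>moebius k * (n - k)\<close> over \<open>k \<le> n\<close> is the
  integral of \<open>M\<close> over \<open>[0, n]\<close>, so its increment over one unit interval
  is the constant value of \<open>M\<close> there.\<close>

lemma sum_moebius_diff:
  "(\<Sum>k=1..Suc n. moebius k * (int (Suc n) - int k)) - (\<Sum>k=1..n. moebius k * (int n - int k)) = Mn n"
proof -
  have "(\<Sum>k=1..Suc n. moebius k * (int (Suc n) - int k)) = (\<Sum>k=1..n. moebius k * (int (Suc n) - int k))"
    by simp
  also have "\<dots> - (\<Sum>k=1..n. moebius k * (int n - int k)) = (\<Sum>k=1..n. moebius k)"
    unfolding sum_subtractf[symmetric] by (intro sum.cong) (auto simp: algebra_simps)
  finally show ?thesis by (simp add: Mn_def)
qed

lemma integral_powr_bound: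
  fixes e c T :: real
  assumes "e > 0" "T > 0" "c > 0"
  shows "integral {-T..T} (\<lambda>t. (c + \<bar>t\<bar>) powr (-1 - e)) \<le> 2 * c powr (-e) / e"
    and "(\<lambda>t. (c + \<bar>t\<bar>) powr (-1 - e)) integrable_on {-T..T}"
proof -
  let ?g = "\<lambda>t::real. (c + \<bar>t\<bar>) powr (-1 - e)"
  have cont: "continuous_on S ?g" for S by (intro continuous_intros) (use assms in auto)
  show int: "?g integrable_on {-T..T}" by (intro integrable_continuous_real cont)
  have "((\<lambda>t. (c + t) powr (-1 - e)) has_integral (- ((c + T) powr (-e)) / e) - (- ((c + 0) powr (-e)) / e)) {0..T}"
  proof (rule fundamental_theorem_of_calculus)
    fix t :: real assume "t \<in> {0..T}"
    thus "((\<lambda>t. - ((c + t) powr - e) / e) has_vector_derivative (c + t) powr (-1 - e)) (at t within {0..T})"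
      unfolding diff_conv_add_uminus[of "-1" e] add.commute[of "-1" "-e"]
      using assms by (auto intro!: derivative_eq_intros simp flip: has_real_derivative_iff_has_vector_derivative)
  qed (use assms in auto)
  hence "integral {0..T} (\<lambda>t. (c + t) powr (-1 - e)) = (c powr (-e) - (c + T) powr (-e)) / e"
    by (simp add: integral_unique diff_divide_distrib)
  also have "\<dots> \<le> c powr (-e) / e" using assms by (intro divide_right_mono) auto
  also have "integral {0..T} (\<lambda>t. (c + t) powr (-1 - e)) = integral {0..T} ?g"
    by (rule integral_cong) auto
  finally have 1: "integral {0..T} ?g \<le> c powr (-e) / e" .
  have "integral {-T..0} ?g = integral {0..T} ?g"
    using Henstock_Kurzweil_Integration.integral_reflect_real[of T 0 ?g] by simp
  hence "integral {-T..0} ?g + integral {0..T} ?g \<le> 2 * c powr (-e) / e" using 1 by simp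
  thus "integral {-T..T} ?g \<le> 2 * c powr (-e) / e"
    using Henstock_Kurzweil_Integration.integral_combine[OF _ _ int, of 0] assms by simp
qed

text \<open>
  Since \<open>M\<close> is constant between consecutive integers, it is the exact difference quotient with step
  \<open>1\<close> of its integral, for which the Perron integral converges absolutely.
\<close>

lemma Mn_bound_aux:
  assumes \<theta>: "0 \<le> \<theta>" "\<theta> < \<sigma>" "\<sigma> \<le> 1" and nz: "\<And>s. Re s > \<theta> \<Longrightarrow> zeta1 s \<noteq> 0" and e: "0 < e" "e < 1/2"
  obtains C where "\<And>n. n \<ge> 1 \<Longrightarrow> real_of_int \<bar>Mn n\<bar> \<le> C * real n powr (\<sigma> + 2 * e)"
proof -
  have \<theta>1: "\<theta> < 1" using \<theta> by simp
  define A where "A = (\<lambda>s. (s - 1) / zeta1 s)"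
  obtain C where C: "C > 0" "\<And>s. \<sigma> \<le> Re s \<Longrightarrow> Re s \<le> 2 \<Longrightarrow> norm (A s) \<le> C * (1 + \<bar>Im s\<bar>) powr e"
    using zeta1_subpolynomial[OF \<theta>(1,2) \<theta>1 nz e(1)] unfolding A_def by metis
  have hol: "A holomorphic_on {s. Re s > \<theta>}"
    unfolding A_def by (intro holomorphic_intros) (use nz in auto)
  have Asums: "(\<lambda>n. real_of_int (moebius (Suc n)) * npow (Suc n) s) sums A s" if "Re s = 2" for s
  proof -
    have "Suc ` UNIV = {1..}" by (auto simp: image_iff Suc_le_eq gr0_conv_Suc)
    hence "((\<lambda>n. of_int (moebius n) * npow n s) has_sum (1 / zeta s)) (Suc ` UNIV)"
      using moebius_has_sum(2)[of s] that by simp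
    hence "((\<lambda>n. of_int (moebius (Suc n)) * npow (Suc n) s) has_sum (1 / zeta s)) UNIV"
      by (subst (asm) has_sum_reindex) (auto simp: o_def)
    from has_sum_imp_sums[OF this] have "(\<lambda>n. of_int (moebius (Suc n)) * npow (Suc n) s) sums (1 / zeta s)" .
    moreover have "1 / zeta s = A s" using that by (auto simp: A_def zeta1_def)
    ultimately show ?thesis by simp
  qed
  \<comment> \<open>For the poles -1 and 0 the Perron residue is \<open>1 - 1 / y\<close> when
    \<open>y \<ge> 1\<close> and 0 otherwise. At \<open>y = n / j\<close> this is
    \<open>(n - j) / n\<close>, so \<open>n\<close> times the integral of \<open>k n\<close>
    represents the integral of \<open>M\<close> over \<open>[0, n]\<close>.\<close>
  define k where "k = (\<lambda>x s. A s * (cp x s / ((s - complex_of_real (-1)) * (s - of_real 0))))"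
  have perron: "((\<lambda>T. vint \<sigma> T (k (real n))) \<longlongrightarrow> 2 * pi * \<i> * ((\<Sum>j=1..n. moebius j * (int n - int j)) / real n)) at_top"
    if n: "n \<ge> 1" for n
  proof -
    have "(\<lambda>j. real_of_int (moebius (Suc j)) * perron_res 2 (-1) 0 (real n / real (Suc j))) sums 
      (\<Sum>j\<in>{..<n}. real_of_int (moebius (Suc j)) * perron_res 2 (-1) 0 (real n / real (Suc j)))"
      by (rule sums_finite) (auto simp: perron_res_def perron_term_def divide_simps)
    also have "(\<Sum>j\<in>{..<n}. real_of_int (moebius (Suc j)) * perron_res 2 (-1) 0 (real n / real (Suc j))) =
       (\<Sum>j\<in>{..<n}. real_of_int (moebius (Suc j)) * (real n - real (Suc j)) / n)"
      using n by (intro sum.cong) (auto simp: perron_res_def perron_term_def divide_simps powr_minus)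
    also have "\<dots> = (\<Sum>j=1..n. real_of_int (moebius j) * (real n - real j) / n)"
      by (rule sum.reindex_bij_witness[of _ "\<lambda>j. j - 1" Suc]) auto
    also have "\<dots> = (\<Sum>j=1..n. moebius j * (int n - int j)) / real n"
      by (simp add: sum_divide_distrib)
    finally have S: "(\<lambda>j. real_of_int (moebius (Suc j)) * perron_res 2 (-1) 0 (real n / real (Suc j))) sums 
       (real_of_int (\<Sum>j=1..n. moebius j * (int n - int j)) / real n)" .
    have coeff: "\<bar>real_of_int (moebius (Suc j))\<bar> \<le> 1" for j
      using abs_moebius_le[of "Suc j"] by linarith
    show ?thesis unfolding k_def
      by (rule perron_shifted[OF _ _ _ _ \<theta>(2) _ coeff Asums S hol _ _ C(2)]) (use \<theta> n e in auto)
  qed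
  have k0: "s \<noteq> 0 \<and> s + 1 \<noteq> 0" if "Re s = \<sigma>" for s
    using that \<theta> by (auto simp: complex_eq_iff)
  have kcont: "continuous_on {s. Re s = \<sigma>} (k x)" for x
    unfolding k_def by (intro continuous_intros cp_continuous continuous_on_subset[OF holomorphic_on_imp_continuous_on[OF hol]])
      (use \<theta> k0 in auto)
  define D where "D = 2 * C * (2 / \<sigma>) powr (1 + 2 * e)"
  have D: "D > 0" using C \<theta> by (simp add: D_def)
  have kbound: "norm (of_nat (Suc n) * k (Suc n) s - of_nat n * k n s) \<le> D * (real (Suc n) powr (\<sigma> + 2 * e) * (1 + \<bar>Im s\<bar>) powr (-1 - e))"
    if n: "n \<ge> 1" and s: "Re s = \<sigma>" for n s
  proof -
    let ?N = "real (Suc n)"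
    define d where "d = cp ?N (s + 1) - cp (real n) (s + 1)"
    have s0: "s \<noteq> 0" "s + 1 \<noteq> 0" using s \<theta> by (auto simp: complex_eq_iff)
    have cp1: "cp x (s + 1) = of_real x * cp x s" if "x > 0" for x
      using that cp_of_real[of x 1] by (simp add: cp_add mult.commute)
    have eqn: "of_nat (Suc n) * k (Suc n) s - of_nat n * k n s = A s * (d / ((s + 1) * s))"
      using n cp1[of ?N] cp1[of "real n"] by (simp add: k_def d_def diff_divide_distrib algebra_simps)
    have d1: "norm d \<le> norm (s + 1) * ?N powr \<sigma>"
    proof -
      have "norm d \<le> norm (s + 1) * (?N powr \<sigma>) * (?N - real n)"
        unfolding d_def using n s \<theta> by (intro cp_diff_bound) (auto intro!: powr_mono2)
      thus ?thesis by simp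
    qed
    have d2: "norm d \<le> 2 * ?N powr (\<sigma> + 1)"
    proof -
      have "norm d \<le> norm (cp ?N (s + 1)) + norm (cp (real n) (s + 1))"
        unfolding d_def by (rule norm_triangle_ineq4)
      also have "\<dots> = ?N powr (\<sigma> + 1) + real n powr (\<sigma> + 1)" using n s by (simp add: norm_cp)
      also have "real n powr (\<sigma> + 1) \<le> ?N powr (\<sigma> + 1)" using \<theta> by (intro powr_mono2) auto
      finally show ?thesis by simp
    qed
    \<comment> \<open>Interpolation with weights \<open>1 - 2 * e\<close> and \<open>2 * e\<close>
      between the mean value bound \<open>d1\<close>, which has the right power of \<open>N\<close>,
      and the trivial bound \<open>d2\<close>, which has more decay in \<open>s\<close>. The
      exponent \<open>-1 - 2 * e\<close> of \<open>norm s\<close> absorbs the growth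
      \<open>e\<close> of \<open>A\<close> and still leaves an integrable \<open>-1 - e\<close>; the
      price is \<open>N powr (2 * e)\<close>.\<close>
    have dd: "norm (d / ((s + 1) * s)) \<le> 2 * (?N powr (\<sigma> + 2 * e) * norm s powr (-1 - 2 * e))"
    proof -
      have ns: "norm s > 0" using s0 by simp
      have ns1: "norm s \<le> norm (s + 1)"
        using s \<theta> by (auto simp: cmod_def intro!: power_mono)
      define q where "q = norm (d / ((s + 1) * s))"
      have q0: "q \<ge> 0" by (simp add: q_def)
      have q1: "q \<le> ?N powr \<sigma> / norm s"
        using d1 s0 by (simp add: q_def norm_divide norm_mult divide_simps mult_ac)
      have q2: "q \<le> 2 * ?N powr (\<sigma> + 1) / (norm s * norm s)"
        unfolding q_def norm_divide norm_mult using d2 ns ns1 by (intro frac_le mult_mono) auto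
      have "q = q powr (1 - 2 * e) * q powr (2 * e)" using q0 by (simp flip: powr_add)
      also have "\<dots> \<le> (?N powr \<sigma> / norm s) powr (1 - 2 * e) * (2 * ?N powr (\<sigma> + 1) / (norm s * norm s)) powr (2 * e)"
        using q0 q1 q2 e by (intro mult_mono powr_mono2) auto
      also have "\<dots> = 2 powr (2 * e) * (?N powr (\<sigma> + 2 * e) * norm s powr (-1 - 2 * e))"
        using ns by (simp add: powr_divide powr_mult powr_powr powr_minus divide_simps flip: powr_add) (simp add: algebra_simps flip: powr_add)
      also have "2 powr (2 * e) \<le> 2 powr 1" using e by (intro powr_mono) auto
      finally show ?thesis by (simp add: q_def mult_right_mono)
    qed
    have ns: "\<sigma> / 2 * (1 + \<bar>Im s\<bar>) \<le> norm s"
    proof -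
      have "\<sigma> \<le> norm s" using abs_Re_le_cmod[of s] s by simp
      moreover have "\<sigma> * \<bar>Im s\<bar> \<le> norm s" using abs_Im_le_cmod[of s] \<theta> mult_right_mono[of \<sigma> 1 "\<bar>Im s\<bar>"] by simp
      ultimately show ?thesis by (simp add: algebra_simps)
    qed
    have "norm s powr (-1 - 2 * e) \<le> (\<sigma> / 2 * (1 + \<bar>Im s\<bar>)) powr (-1 - 2 * e)"
      using ns \<theta> e by (intro powr_mono2') auto
    also have "\<dots> = (2 / \<sigma>) powr (1 + 2 * e) * (1 + \<bar>Im s\<bar>) powr (-1 - 2 * e)"
    proof -
      have "(\<sigma> / 2 * (1 + \<bar>Im s\<bar>)) powr (-1 - 2 * e) = (\<sigma> / 2) powr (-1 - 2 * e) * (1 + \<bar>Im s\<bar>) powr (-1 - 2 * e)"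
        using \<theta> by (subst powr_mult) auto
      moreover have "(\<sigma> / 2) powr (-1 - 2 * e) = (2 / \<sigma>) powr (1 + 2 * e)"
        using \<theta> powr_minus[of "\<sigma> / 2" "1 + 2 * e"] inverse_powr[of "\<sigma> / 2" "1 + 2 * e"] by simp
      ultimately show ?thesis by simp
    qed
    finally have ns': "norm s powr (-1 - 2 * e) \<le> (2 / \<sigma>) powr (1 + 2 * e) * (1 + \<bar>Im s\<bar>) powr (-1 - 2 * e)" .
    have "norm (A s * (d / ((s + 1) * s))) \<le> (C * (1 + \<bar>Im s\<bar>) powr e) * 
      (2 * (?N powr (\<sigma> + 2 * e) * ((2 / \<sigma>) powr (1 + 2 * e) * (1 + \<bar>Im s\<bar>) powr (-1 - 2 * e))))"
      unfolding norm_mult[of "A s"] using C(1) s \<theta> 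
      by (intro mult_mono C(2) order_trans[OF dd] mult_left_mono ns') auto
    also have "\<dots> = D * (?N powr (\<sigma> + 2 * e) * ((1 + \<bar>Im s\<bar>) powr e * (1 + \<bar>Im s\<bar>) powr (-1 - 2 * e)))"
      by (simp add: D_def mult_ac)
    also have "(1 + \<bar>Im s\<bar>) powr e * (1 + \<bar>Im s\<bar>) powr (-1 - 2 * e) = (1 + \<bar>Im s\<bar>) powr (-1 - e)"
    proof -
      have "e + (-1 - 2 * e) = -1 - e" by simp
      thus ?thesis by (metis powr_add)
    qed
    finally show ?thesis unfolding eqn .
  qed
  show ?thesis
  proof (rule that)
    fix n :: nat assume n: "n \<ge> 1"
    let ?N = "real (Suc n)"
    define f where "f = (\<lambda>s. of_nat (Suc n) * k (Suc n) s - of_nat n * k n s)"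
    have fcont: "continuous_on {s. Re s = \<sigma>} f" unfolding f_def by (intro continuous_intros kcont)
    have "((\<lambda>T. of_nat (Suc n) * vint \<sigma> T (k (Suc n)) - of_nat n * vint \<sigma> T (k n)) \<longlongrightarrow> 
       of_nat (Suc n) * (2 * pi * \<i> * ((\<Sum>j=1..Suc n. moebius j * (int (Suc n) - int j)) / real (Suc n))) - 
       of_nat n * (2 * pi * \<i> * ((\<Sum>j=1..n. moebius j * (int n - int j)) / real n))) at_top"
      by (intro tendsto_intros perron) (use n in auto)
    also have "of_nat (Suc n) * (2 * pi * \<i> * ((\<Sum>j=1..Suc n. moebius j * (int (Suc n) - int j)) / real (Suc n))) - 
       of_nat n * (2 * pi * \<i> * ((\<Sum>j=1..n. moebius j * (int n - int j)) / real n)) = 2 * pi * \<i> * of_int (Mn n)"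
    proof -
      have c: "of_nat m * (2 * pi * \<i> * complex_of_real (real_of_int z / real m)) = 2 * pi * \<i> * of_int z" if "m > 0" for m z
        using that by simp
      have n0: "n > 0" using n by simp
      show ?thesis
        by (simp only: c[OF zero_less_Suc] c[OF n0] right_diff_distrib[symmetric] of_int_diff[symmetric] sum_moebius_diff)
    qed
    finally have lim: "((\<lambda>T. of_nat (Suc n) * vint \<sigma> T (k (Suc n)) - of_nat n * vint \<sigma> T (k n)) \<longlongrightarrow> 2 * pi * \<i> * of_int (Mn n)) at_top" .
    have "\<forall>\<^sub>F T in at_top. norm (of_nat (Suc n) * vint \<sigma> T (k (Suc n)) - of_nat n * vint \<sigma> T (k n)) \<le> D * ?N powr (\<sigma> + 2 * e) * (2 / e)"
      using eventually_gt_at_top[of "0::real"]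
    proof eventually_elim
      case (elim T)
      have seg: "closed_segment (Complex \<sigma> (-T)) (Complex \<sigma> T) \<subseteq> {s. Re s = \<sigma>}"
        by (auto simp: closed_segment_same_Re)
      have kint: "k x contour_integrable_on linepath (Complex \<sigma> (-T)) (Complex \<sigma> T)" for x
        by (intro contour_integrable_continuous_linepath continuous_on_subset[OF kcont seg])
      have "of_nat (Suc n) * vint \<sigma> T (k (Suc n)) - of_nat n * vint \<sigma> T (k n) = vint \<sigma> T f"
        unfolding vint_def f_def
        by (subst contour_integral_diff) (auto intro!: contour_integrable_lmul kint simp: contour_integral_lmul kint)
      also have "\<dots> = \<i> * integral {-T..T} (\<lambda>t. f (Complex \<sigma> t))" by (rule vint_eq_integral[OF elim])
      also have "norm \<dots> = norm (integral {-T..T} (\<lambda>t. f (Complex \<sigma> t)))" by (simp add: norm_mult)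
      also have "\<dots> \<le> integral {-T..T} (\<lambda>t. (D * ?N powr (\<sigma> + 2 * e)) * (1 + \<bar>t\<bar>) powr (-1 - e))"
      proof (rule Henstock_Kurzweil_Integration.integral_norm_bound_integral)
        have "continuous_on {-T..T} (\<lambda>t. f (Complex \<sigma> t))"
          by (rule continuous_on_compose2[OF fcont]) (auto intro!: continuous_intros simp: Complex_eq)
        thus "(\<lambda>t. f (Complex \<sigma> t)) integrable_on {-T..T}" by (rule integrable_continuous_real)
        show "(\<lambda>t. D * ?N powr (\<sigma> + 2 * e) * (1 + \<bar>t\<bar>) powr (-1 - e)) integrable_on {-T..T}"
          using integral_powr_bound(2)[OF e(1) elim, of 1] by (intro integrable_on_mult_right) simp
        show "norm (f (Complex \<sigma> t)) \<le> D * ?N powr (\<sigma> + 2 * e) * (1 + \<bar>t\<bar>) powr (-1 - e)" for t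
          using kbound[OF n, of "Complex \<sigma> t"] by (simp add: f_def mult.assoc)
      qed
      also have "\<dots> = (D * ?N powr (\<sigma> + 2 * e)) * integral {-T..T} (\<lambda>t. (1 + \<bar>t\<bar>) powr (-1 - e))"
        by (rule integral_mult_right)
      also have "\<dots> \<le> (D * ?N powr (\<sigma> + 2 * e)) * (2 / e)"
        using D integral_powr_bound(1)[OF e(1) elim, of 1] by (intro mult_left_mono) auto
      finally show ?case .
    qed
    from tendsto_upperbound[OF tendsto_norm[OF lim] this] 
    have "norm (2 * pi * \<i> * of_int (Mn n)) \<le> D * ?N powr (\<sigma> + 2 * e) * (2 / e)" by simp
    moreover have "norm (2 * pi * \<i> * of_int (Mn n)) = 2 * pi * real_of_int \<bar>Mn n\<bar>" by (simp add: norm_mult)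
    moreover have "1 * real_of_int \<bar>Mn n\<bar> \<le> 2 * pi * real_of_int \<bar>Mn n\<bar>"
      using pi_gt3 by (intro mult_right_mono) auto
    ultimately have 1: "real_of_int \<bar>Mn n\<bar> \<le> D * (2 / e) * ?N powr (\<sigma> + 2 * e)" by (simp add: mult_ac)
    have "?N powr (\<sigma> + 2 * e) \<le> (2 * real n) powr (\<sigma> + 2 * e)" using n \<theta> e by (intro powr_mono2) auto
    also have "\<dots> = 2 powr (\<sigma> + 2 * e) * real n powr (\<sigma> + 2 * e)" by (simp add: powr_mult)
    finally have 2: "D * (2 / e) * ?N powr (\<sigma> + 2 * e) \<le> D * (2 / e) * (2 powr (\<sigma> + 2 * e) * real n powr (\<sigma> + 2 * e))"
      by (rule mult_left_mono) (use D e in auto)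
    show "real_of_int \<bar>Mn n\<bar> \<le> (D * (2 / e) * 2 powr (\<sigma> + 2 * e)) * real n powr (\<sigma> + 2 * e)"
      using order_trans[OF 1 2] by (simp only: mult.assoc)
  qed
qed

text \<open>If \<open>\<theta> + e \<ge> 1\<close>, the trivial bound by \<open>n\<close> suffices.
  Otherwise the line \<open>\<theta> + e / 3\<close> is used with parameter \<open>e / 3\<close>,
  since \<open>e / 3 + 2 * (e / 3) = e\<close>.\<close>

lemma Mn_bound:
  assumes \<theta>: "0 \<le> \<theta>" "\<theta> \<le> 1" and nz: "\<And>s. Re s > \<theta> \<Longrightarrow> zeta1 s \<noteq> 0" and e: "e > 0"
  obtains C where "C > 0" "\<And>n. n \<ge> 1 \<Longrightarrow> real_of_int \<bar>Mn n\<bar> \<le> C * real n powr (\<theta> + e)"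
proof (cases "\<theta> + e \<ge> 1")
  case True
  show ?thesis
  proof (rule that[of 1])
    fix n :: nat assume n: "n \<ge> 1"
    have "real_of_int \<bar>Mn n\<bar> \<le> real n" using abs_Mn_le[of n] by linarith
    also have "real n = real n powr 1" using n by simp
    also have "\<dots> \<le> real n powr (\<theta> + e)" using n True by (intro powr_mono) auto
    finally show "real_of_int \<bar>Mn n\<bar> \<le> 1 * real n powr (\<theta> + e)" by simp
  qed auto
next
  case False
  obtain C where C: "\<And>n. n \<ge> 1 \<Longrightarrow> real_of_int \<bar>Mn n\<bar> \<le> C * real n powr (\<theta> + e / 3 + 2 * (e / 3))"
    by (rule Mn_bound_aux[of \<theta> "\<theta> + e / 3" "e / 3"]) (use False \<theta> nz e in auto)
  show ?thesis
  proof (rule that[of "\<bar>C\<bar> + 1"])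
    fix n :: nat assume n: "n \<ge> 1"
    have "real_of_int \<bar>Mn n\<bar> \<le> C * real n powr (\<theta> + e)" using C[OF n] by (simp add: add_ac)
    also have "\<dots> \<le> (\<bar>C\<bar> + 1) * real n powr (\<theta> + e)" by (intro mult_right_mono) auto
    finally show "real_of_int \<bar>Mn n\<bar> \<le> (\<bar>C\<bar> + 1) * real n powr (\<theta> + e)" .
  qed auto
qed

section \<open>Existence of nontrivial zeros\<close>

text \<open>Up to a factor \<open>- 1 / (2 * T)\<close> the Perron residue for the poles \<open>\<sigma> - T\<close> and \<open>\<sigma> + T\<close>.\<close>

definition kap :: "real \<Rightarrow> real \<Rightarrow> real \<Rightarrow> real" where
  "kap \<sigma> T y = (if y \<ge> 1 then y powr (\<sigma> - T) else y powr (\<sigma> + T))"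

lemma perron_res_kap:
  assumes "T > 0" "\<sigma> - T < c" "c < \<sigma> + T"
  shows "perron_res c (\<sigma> - T) (\<sigma> + T) y = - kap \<sigma> T y / (2 * T)"
  using assms by (auto simp: perron_res_def perron_term_def kap_def)

lemma kap_nonneg: "kap \<sigma> T y \<ge> 0"
  by (simp add: kap_def)

text \<open>Bernoulli's inequality gives \<open>(1 + k / i) ^ i \<ge> 1 + k\<close>, and
  \<open>p \<ge> 4 * i\<close> raises this to the fourth power, which exceeds
  \<open>4 * k * (k + 1)\<close>. The bound is written as a difference so that sums over
  \<open>k\<close> telescope.\<close>

lemma ratio_power_bound:
  fixes i k :: nat
  assumes "i \<ge> 1" "k \<ge> 1" and p: "p \<ge> 4 * real i"
  shows "(i / (i + k)) powr p \<le> 1 / 4 * (1 / k - 1 / (real k + 1))"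
proof -
  have k: "real k \<ge> 1" using assms by simp
  have "- 1 \<le> real k / real i" by (rule order_trans[of _ 0]) auto
  hence "1 + real k \<le> (1 + real k / i) ^ i"
    using Bernoulli_inequality[of "real k / i" i] assms by simp
  hence "(1 + real k) ^ 4 \<le> ((1 + real k / i) ^ i) ^ 4" by (intro power_mono) auto
  also have "\<dots> = (1 + real k / i) ^ (4 * i)" by (simp only: power_mult[symmetric] mult.commute)
  also have "\<dots> = (1 + real k / i) powr real (4 * i)"
    by (rule powr_realpow[symmetric]) (simp add: add_pos_nonneg)
  also have "\<dots> \<le> (1 + real k / i) powr p" using p by (intro powr_mono) auto
  finally have 1: "(1 + real k) ^ 4 \<le> (1 + real k / i) powr p" .
  have "(i / (i + k)) powr p = 1 / (1 + real k / i) powr p"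
  proof -
    have "i / (i + k) = 1 / (1 + real k / i)" using assms by (simp add: field_simps)
    thus ?thesis by (simp add: powr_divide)
  qed
  also have "\<dots> \<le> 1 / (1 + real k) ^ 4"
    using 1 by (intro divide_left_mono mult_pos_pos) (auto simp: add_pos_nonneg)
  also have "\<dots> \<le> 1 / (4 * (real k * (real k + 1)))"
  proof (intro divide_left_mono mult_pos_pos)
    have "4 * real k \<le> (1 + real k)\<^sup>2" using zero_le_power2[of "real k - 1"] by (simp add: power2_eq_square algebra_simps)
    also have "\<dots> \<le> (1 + real k) ^ 3" by (intro power_increasing) auto
    finally have "4 * real k * (real k + 1) \<le> (1 + real k) ^ 3 * (1 + real k)"
      by (intro mult_mono) auto
    thus "4 * (real k * (real k + 1)) \<le> (1 + real k) ^ 4" by (simp only: power4_eq_xxxx power3_eq_cube mult_ac)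
  qed (use k in auto)
  also have "\<dots> = 1 / 4 * (1 / k - 1 / (real k + 1))" using k by (simp add: field_simps)
  finally show ?thesis .
qed

text \<open>\<open>T \<ge> 4 * m\<close> makes the exponents \<open>T - \<sigma>\<close> and
  \<open>T + \<sigma>\<close> at least four times the smaller of \<open>m\<close> and
  \<open>j\<close>, as \<open>ratio_power_bound\<close> requires. The kernel thus concentrates on
  the diagonal.\<close>

lemma kap_bound:
  fixes m j :: nat
  assumes m: "m \<ge> 1" "j \<ge> 1" and \<sigma>: "0 \<le> \<sigma>" "\<sigma> \<le> 1" and T: "T \<ge> 4 * real m"
  shows "j < m \<Longrightarrow> kap \<sigma> T (m / j) \<le> 1 / 4 * (1 / (real m - real j) - 1 / (real m - real j + 1))"
    and "m < j \<Longrightarrow> kap \<sigma> T (m / j) \<le> 1 / 4 * (1 / (real j - real m) - 1 / (real j - real m + 1))"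
proof -
  assume j: "j < m"
  define k where "k = m - j"
  have k: "m = j + k" "k \<ge> 1" using j by (auto simp: k_def)
  have "kap \<sigma> T (m / j) = (m / j) powr (- (T - \<sigma>))" using j m by (simp add: kap_def)
  also have "\<dots> = 1 / (m / j) powr (T - \<sigma>)" by (subst powr_minus) (simp add: inverse_eq_divide)
  also have "\<dots> = (j / m) powr (T - \<sigma>)" by (simp add: powr_divide)
  also have "\<dots> \<le> 1 / 4 * (1 / k - 1 / (real k + 1))"
    unfolding k(1) using ratio_power_bound[OF m(2) k(2), of "T - \<sigma>"] T \<sigma> k by simp
  also have "1 / 4 * (1 / k - 1 / (real k + 1)) = 1 / 4 * (1 / (real m - real j) - 1 / (real m - real j + 1))"
    by (simp add: k(1))
  finally show "kap \<sigma> T (m / j) \<le> 1 / 4 * (1 / (real m - real j) - 1 / (real m - real j + 1))" .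
next
  assume j: "m < j"
  define k where "k = j - m"
  have k: "j = m + k" "k \<ge> 1" using j by (auto simp: k_def)
  have "kap \<sigma> T (m / j) = (m / j) powr (\<sigma> + T)" using j m by (simp add: kap_def)
  also have "\<dots> \<le> 1 / 4 * (1 / k - 1 / (real k + 1))"
    unfolding k(1) using ratio_power_bound[OF m(1) k(2), of "\<sigma> + T"] T \<sigma> k by simp
  also have "1 / 4 * (1 / k - 1 / (real k + 1)) = 1 / 4 * (1 / (real j - real m) - 1 / (real j - real m + 1))"
    by (simp add: k(1))
  finally show "kap \<sigma> T (m / j) \<le> 1 / 4 * (1 / (real j - real m) - 1 / (real j - real m + 1))" .
qed

text \<open>The diagonal term is 1, and the terms on either side of it telescope to at most
  \<open>1 / 4\<close>.\<close>

lemma sum_kap_le: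
  fixes m :: nat
  assumes m: "m \<ge> 1" and \<sigma>: "0 \<le> \<sigma>" "\<sigma> \<le> 1" and T: "T \<ge> 4 * real m"
  shows "(\<Sum>n<N. kap \<sigma> T (m / Suc n)) \<le> 3 / 2"
proof -
  \<comment> \<open>An explicit majorant of the partial sums: it reaches \<open>1 / 4\<close> just
    before the diagonal, jumps by 1 when \<open>Suc n = m\<close> is included, and rises by less
    than \<open>1 / 4\<close> afterwards.\<close>
  define h where "h = (\<lambda>N::nat. if N < m then 1 / 4 * (1 / (real m - real N)) else 5 / 4 + 1 / 4 * (1 - 1 / (real N - real m + 1)))"
  have "(\<Sum>n<N. kap \<sigma> T (m / Suc n)) \<le> h N"
  proof (induction N)
    case 0
    show ?case using m by (simp add: h_def)
  next
    case (Suc N)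
    consider "Suc N < m" | "Suc N = m" | "Suc N > m" by linarith
    hence "kap \<sigma> T (m / Suc N) \<le> h (Suc N) - h N"
    proof cases
      case 1
      show ?thesis using kap_bound(1)[OF m _ \<sigma> T 1] 1 by (simp add: h_def algebra_simps)
    next
      case 2
      hence mN: "m = Suc N" by simp
      show ?thesis by (simp add: mN kap_def h_def)
    next
      case 3
      show ?thesis using kap_bound(2)[OF m _ \<sigma> T 3] 3 by (simp add: h_def algebra_simps)
    qed
    thus ?case using Suc by simp
  qed
  also have "h N \<le> 3 / 2"
  proof (cases "N < m")
    case True
    hence "1 / (real m - real N) \<le> 1 / 1" by (intro divide_left_mono) auto
    moreover have "h N = 1 / 4 * (1 / (real m - real N))" using True by (simp only: h_def if_True)
    ultimately show ?thesis by linarith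
  next
    case False
    define v where "v = 1 / (real N - real m + 1)"
    have "v \<ge> 0" using False by (simp add: v_def)
    moreover have "h N = 5 / 4 + 1 / 4 * (1 - v)" using False by (simp only: h_def if_False v_def)
    ultimately show ?thesis by (simp add: field_simps)
  qed
  finally show ?thesis .
qed

text \<open>The diagonal term 1 outweighs all others, which total at most \<open>1 / 2\<close>. So
  the alternating sum has the sign of its diagonal term at \<open>n = m - 1\<close> and size at
  least \<open>1 / 2\<close>.\<close>

lemma alternating_kap_sums:
  fixes m :: nat
  assumes m: "m \<ge> 1" and \<sigma>: "0 \<le> \<sigma>" "\<sigma> \<le> 1" and T: "T \<ge> 4 * real m"
  obtains S where "(\<lambda>n. (-1) ^ n * kap \<sigma> T (m / Suc n)) sums S" "(-1) ^ (m - 1) * S \<ge> 1 / 2"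
proof -
  define f where "f = (\<lambda>n. kap \<sigma> T (m / Suc n))"
  define d where "d = (\<lambda>n. if n = m - 1 then 1 else 0 :: real)"
  have f: "summable f" "suminf f \<le> 3 / 2"
  proof -
    show s: "summable f" by (rule summableI_nonneg_bounded[of _ "3/2"]) (use sum_kap_le[OF assms] kap_nonneg in \<open>auto simp: f_def\<close>)
    show "suminf f \<le> 3 / 2" by (rule suminf_le_const[OF s]) (use sum_kap_le[OF assms] in \<open>auto simp: f_def\<close>)
  qed
  have "summable (\<lambda>n. (-1) ^ n * f n)"
    by (rule summable_comparison_test'[OF f(1), of 0]) (use kap_nonneg in \<open>auto simp: f_def abs_mult\<close>)
  then obtain S where S: "(\<lambda>n. (-1) ^ n * f n) sums S" by (auto simp: summable_def)
  have d: "d sums 1" unfolding d_def using sums_single[of "m - 1" "\<lambda>_. 1::real"] by simp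
  have fm: "f (m - 1) = 1" using m by (simp add: f_def kap_def)
  have s1: "(\<lambda>n. d n - (-1) ^ (m - 1) * ((-1) ^ n * f n)) sums (1 - (-1) ^ (m - 1) * S)"
    by (intro sums_diff sums_mult d S)
  have s2: "(\<lambda>n. f n - d n) sums (suminf f - 1)"
    by (intro sums_diff d summable_sums f)
  have le: "d n - (-1) ^ (m - 1) * ((-1) ^ n * f n) \<le> f n - d n" for n
  proof (cases "n = m - 1")
    case True
    have "(-1) ^ (m - 1) * ((-1) ^ (m - 1) * f (m - 1)) = (1::real)"
      unfolding fm by (simp flip: power_add add: mult_2[symmetric] power_mult)
    thus ?thesis using True fm by (simp add: d_def)
  next
    case False
    have "\<bar>(-1) ^ (m - 1) * ((-1) ^ n * f n)\<bar> = f n" using kap_nonneg[of \<sigma> T] by (simp add: abs_mult f_def)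
    thus ?thesis using False by (simp add: d_def)
  qed
  have "1 - (-1) ^ (m - 1) * S \<le> suminf f - 1" by (rule sums_le[OF le s1 s2])
  hence "(-1) ^ (m - 1) * S \<ge> 1 / 2" using f by linarith
  with S show ?thesis by (intro that[of S]) (simp_all add: f_def)
qed

section \<open>The alternating zeta function\<close>

lemma eta_exists:
  obtains h where "h holomorphic_on UNIV" "\<And>s. s \<noteq> 1 \<Longrightarrow> h s = (1 - exp ((1 - s) * of_real (ln 2))) / (s - 1)"
proof -
  let ?f = "\<lambda>s::complex. - exp ((1 - s) * of_real (ln 2))"
  have "?f holomorphic_on UNIV" by (intro holomorphic_intros)
  \<comment> \<open>The difference quotient at 1 of \<open>- 2 ^ (1 - s)\<close>, completed by the
    derivative, is entire. Its product with \<open>zeta1\<close> is the alternating zeta function,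
    the zero of \<open>1 - 2 ^ (1 - s)\<close> cancelling the pole.\<close>
  from pole_lemma_open[OF this open_UNIV, of 1] show ?thesis
    by (rule that) auto
qed

lemma eta_sums:
  assumes "Re s > 1"
  shows "(\<lambda>n. (-1) ^ n * npow (Suc n) s) sums ((1 - exp ((1 - s) * of_real (ln 2))) * zeta s)"
proof -
  have E: "exp ((1 - s) * of_real (ln 2)) = 2 * npow 2 s"
  proof -
    have "exp ((1 - s) * of_real (ln 2)) = exp (of_real (ln 2)) * exp (- s * complex_of_real (ln 2))"
      by (simp add: algebra_simps flip: exp_add)
    also have "exp (complex_of_real (ln 2)) = 2" by (simp add: exp_of_real)
    also have "exp (- s * complex_of_real (ln 2)) = npow 2 s"
      by (simp add: npow_eq_cp cp_def ln_div)
    finally show ?thesis .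
  qed
  have "((\<lambda>n. 2 * npow 2 s * npow n s) has_sum (2 * npow 2 s * zeta s)) {1..}"
    by (intro has_sum_cmult_right zeta_has_sum assms)
  hence "((\<lambda>n. if even n then 2 * npow n s else 0) has_sum (2 * npow 2 s * zeta s)) ((\<lambda>n. 2 * n) ` {1..})"
    by (subst has_sum_reindex) (auto simp: inj_on_def o_def npow_mult mult.assoc)
  hence "((\<lambda>n. if even n then 2 * npow n s else 0) has_sum (2 * npow 2 s * zeta s)) {1..}"
    by (rule has_sum_cong_neutral[THEN iffD1, rotated -1]) (auto simp: image_iff elim!: evenE)
  hence "((\<lambda>n. npow n s + (-1) * (if even n then 2 * npow n s else 0)) has_sum (zeta s + (-1) * (2 * npow 2 s * zeta s))) {1..}"
    by (intro has_sum_add has_sum_cmult_right zeta_has_sum assms)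
  also have "{1..} = Suc ` UNIV" by (auto simp: image_iff Suc_le_eq gr0_conv_Suc)
  finally have "((\<lambda>n. npow (Suc n) s + (-1) * (if even (Suc n) then 2 * npow (Suc n) s else 0)) has_sum (zeta s + (-1) * (2 * npow 2 s * zeta s))) UNIV"
    by (subst (asm) has_sum_reindex) (auto simp: o_def)
  also have "(\<lambda>n. npow (Suc n) s + (-1) * (if even (Suc n) then 2 * npow (Suc n) s else 0)) = (\<lambda>n. (-1) ^ n * npow (Suc n) s)"
    by (intro ext) (auto simp: minus_one_power_iff)
  finally have "(\<lambda>n. (-1) ^ n * npow (Suc n) s) sums (zeta s + (-1) * (2 * npow 2 s * zeta s))"
    by (rule has_sum_imp_sums)
  thus ?thesis unfolding E by (simp add: algebra_simps)
qed

text \<open>The function \<open>h\<close> is \<open>O(1 / \<bar>Im s\<bar>)\<close>, because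
  \<open>2 ^ (1 - s)\<close> is bounded in the strip. This compensates the factor
  \<open>s - 1\<close> in \<open>zeta1\<close> and reduces the exponent \<open>1 + e\<close> to
  \<open>e\<close>; near the real axis \<open>h\<close> is bounded by compactness.\<close>

lemma eta_bound:
  assumes nz: "\<And>s. Re s > \<theta> \<Longrightarrow> zeta1 s \<noteq> 0" and \<theta>: "0 \<le> \<theta>" "\<theta> < \<sigma>" "\<theta> < 1" and e: "e > 0"
  obtains A C where "A holomorphic_on UNIV" "C > 0"
    "\<And>s. Re s = 2 \<Longrightarrow> (\<lambda>n. (-1) ^ n * npow (Suc n) s) sums A s"
    "\<And>s. \<sigma> \<le> Re s \<Longrightarrow> Re s \<le> 2 \<Longrightarrow> norm (A s) \<le> C * (1 + \<bar>Im s\<bar>) powr e"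
proof -
  obtain h where h: "h holomorphic_on UNIV" "\<And>s. s \<noteq> 1 \<Longrightarrow> h s = (1 - exp ((1 - s) * of_real (ln 2))) / (s - 1)"
    using eta_exists by metis
  obtain C where C: "C > 0"
    "\<And>s. \<sigma> \<le> Re s \<Longrightarrow> Re s \<le> 2 \<Longrightarrow> norm (zeta1 s) \<le> C * (1 + \<bar>Im s\<bar>) powr (1 + e)"
    using zeta1_subpolynomial[OF \<theta>(1,2,3) nz e] by metis
  define Q where "Q = cbox (Complex \<sigma> (-1)) (Complex 2 1)"
  have "bounded (h ` Q)"
    by (intro compact_imp_bounded compact_continuous_image continuous_on_subset[OF holomorphic_on_imp_continuous_on[OF h(1)]])
       (auto simp: Q_def)
  then obtain B where B: "\<And>s. s \<in> Q \<Longrightarrow> norm (h s) \<le> B" unfolding bounded_iff by blast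
  define D where "D = 2 * \<bar>B\<bar> + 6"
  have hb: "norm (h s) * (1 + \<bar>Im s\<bar>) \<le> D" if s: "\<sigma> \<le> Re s" "Re s \<le> 2" for s
  proof (cases "\<bar>Im s\<bar> \<le> 1")
    case True
    hence "- 1 \<le> Im s" "Im s \<le> 1" by linarith+
    hence "norm (h s) \<le> B" using s by (intro B) (auto simp: Q_def in_cbox_complex_iff)
    hence "norm (h s) \<le> \<bar>B\<bar>" by linarith
    hence "norm (h s) * (1 + \<bar>Im s\<bar>) \<le> \<bar>B\<bar> * 2" using True by (intro mult_mono) auto
    thus ?thesis by (simp add: D_def)
  next
    case False
    hence s1: "s \<noteq> 1" by auto
    have "norm (exp ((1 - s) * complex_of_real (ln 2))) = 2 powr (1 - Re s)"
      by (simp add: powr_def)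
    also have "\<dots> \<le> 2 powr 1" using s \<theta> by (intro powr_mono) auto
    finally have "norm (1 - exp ((1 - s) * complex_of_real (ln 2))) \<le> 3"
      using norm_triangle_ineq4[of 1 "exp ((1 - s) * complex_of_real (ln 2))"] by simp
    moreover have "norm (s - 1) \<ge> \<bar>Im s\<bar>" using abs_Im_le_cmod[of "s - 1"] by simp
    ultimately have "norm (h s) \<le> 3 / \<bar>Im s\<bar>"
      unfolding h(2)[OF s1] norm_divide using False by (intro frac_le) auto
    hence "norm (h s) * (1 + \<bar>Im s\<bar>) \<le> 3 / \<bar>Im s\<bar> * (2 * \<bar>Im s\<bar>)" using False by (intro mult_mono) auto
    also have "\<dots> = 6" using False by simp
    finally show ?thesis by (simp add: D_def)
  qed
  show ?thesis
  proof (rule that[of "\<lambda>s. zeta1 s * h s" "C * D"])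
    show "(\<lambda>s. zeta1 s * h s) holomorphic_on UNIV" by (intro holomorphic_intros h)
    show "C * D > 0" using C by (auto simp: D_def add_nonneg_pos)
    fix s :: complex
    {
      assume s: "Re s = 2"
      hence "s \<noteq> 1" by auto
      hence "zeta1 s * h s = (1 - exp ((1 - s) * of_real (ln 2))) * zeta s" by (simp add: zeta1_def h)
      thus "(\<lambda>n. (-1) ^ n * npow (Suc n) s) sums (zeta1 s * h s)" using eta_sums[of s] s by simp
    next
      assume s: "\<sigma> \<le> Re s" "Re s \<le> 2"
      have "norm (zeta1 s * h s) \<le> (C * (1 + \<bar>Im s\<bar>) powr (1 + e)) * norm (h s)"
        unfolding norm_mult by (intro mult_right_mono C(2) s) auto
      also have "\<dots> = C * (1 + \<bar>Im s\<bar>) powr e * (norm (h s) * (1 + \<bar>Im s\<bar>))"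
        by (simp add: powr_add mult_ac)
      also have "\<dots> \<le> C * (1 + \<bar>Im s\<bar>) powr e * D"
        using C hb[OF s] by (intro mult_left_mono) auto
      finally show "norm (zeta1 s * h s) \<le> C * D * (1 + \<bar>Im s\<bar>) powr e" by (simp add: mult_ac)
    }
  qed
qed

section \<open>Mean squares with the weight \<open>1 / (T^2 + t^2)\<close>\<close>

lemma integral_le_weight:
  assumes T: "T \<ge> 1" and U: "U > 0" and e: "0 < e" "e < 1" and f: "continuous_on UNIV f" 
    and bound: "\<And>t. norm (f t :: complex) \<le> C * (1 + \<bar>t\<bar>) powr (e / 2)" and C: "C > 0"
  shows "integral {-U..U} (\<lambda>t. (norm (f t))\<^sup>2 / (T\<^sup>2 + t\<^sup>2)) \<le> 4 * C\<^sup>2 * T powr (e - 1) / (1 - e)"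
proof -
  have "integral {-U..U} (\<lambda>t. (norm (f t))\<^sup>2 / (T\<^sup>2 + t\<^sup>2)) \<le> integral {-U..U} (\<lambda>t. 2 * C\<^sup>2 * (T + \<bar>t\<bar>) powr (-1 - (1 - e)))"
  proof (rule integral_le)
    show "(\<lambda>t. (norm (f t))\<^sup>2 / (T\<^sup>2 + t\<^sup>2)) integrable_on {-U..U}"
      using T by (intro integrable_continuous_real continuous_intros continuous_on_subset[OF f])
        (auto simp: add_nonneg_eq_0_iff)
    show "(\<lambda>t. 2 * C\<^sup>2 * (T + \<bar>t\<bar>) powr (-1 - (1 - e))) integrable_on {-U..U}"
      by (intro integrable_on_mult_right integral_powr_bound(2)) (use e U T in auto)
    fix t :: real
    define u where "u = T + \<bar>t\<bar>"
    have u: "u \<ge> 1" "1 + \<bar>t\<bar> \<le> u" using T by (auto simp: u_def)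
    have "(norm (f t))\<^sup>2 \<le> (C * u powr (e / 2))\<^sup>2"
      using bound[of t] C u e by (intro power_mono order_trans[OF bound] mult_left_mono powr_mono2) auto
    also have "\<dots> = C\<^sup>2 * u powr e" using u by (simp add: power_mult_distrib power2_eq_square flip: powr_add)
    finally have 1: "(norm (f t))\<^sup>2 \<le> C\<^sup>2 * u powr e" .
    \<comment> \<open>The weight is comparable to \<open>(T + \<bar>t\<bar>) powr (-2)\<close>;
      against the growth exponent \<open>e\<close> of the squared norm this leaves the explicitly
      integrable power \<open>-1 - (1 - e)\<close>.\<close>
    have 2: "u\<^sup>2 / 2 \<le> T\<^sup>2 + t\<^sup>2"
      using zero_le_power2[of "T - \<bar>t\<bar>"] by (simp add: u_def power2_eq_square algebra_simps)
    have "(norm (f t))\<^sup>2 / (T\<^sup>2 + t\<^sup>2) \<le> (C\<^sup>2 * u powr e) / (u\<^sup>2 / 2)"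
      using 1 2 u by (intro frac_le) auto
    also have "\<dots> = 2 * C\<^sup>2 * (u powr e / u powr 2)" using u by simp
    also have "u powr e / u powr 2 = u powr (-1 - (1 - e))"
    proof -
      have "e - 2 = -1 - (1 - e)" by simp
      thus ?thesis by (metis powr_diff)
    qed
    finally show "(norm (f t))\<^sup>2 / (T\<^sup>2 + t\<^sup>2) \<le> 2 * C\<^sup>2 * (T + \<bar>t\<bar>) powr (-1 - (1 - e))" by (simp add: u_def)
  qed
  also have "\<dots> = 2 * C\<^sup>2 * integral {-U..U} (\<lambda>t. (T + \<bar>t\<bar>) powr (-1 - (1 - e)))"
    by (rule integral_mult_right)
  also have "\<dots> \<le> 2 * C\<^sup>2 * (2 * T powr (- (1 - e)) / (1 - e))"
    using e U T by (intro mult_left_mono integral_powr_bound) auto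
  finally show ?thesis by simp
qed

text \<open>The Fourier transform of the weight,
  \<open>pi / T * exp (- T * \<bar>ln y\<bar>)\<close>, read off from Perron's kernel on the
  imaginary axis with poles at \<open>- T\<close> and \<open>T\<close>.\<close>

lemma cp_weight_integral:
  assumes T: "T > 0" and y: "y > 0"
  shows "((\<lambda>U. integral {-U..U} (\<lambda>t. cp y (\<i> * of_real t) / of_real (T\<^sup>2 + t\<^sup>2))) \<longlongrightarrow> of_real (pi / T * kap 0 T y)) at_top"
proof -
  let ?f = "\<lambda>s. cp y s / ((s - of_real (0 - T)) * (s - of_real (0 + T)))"
  have lim: "((\<lambda>U. vint 0 U ?f) \<longlongrightarrow> 2 * pi * \<i> * perron_res 0 (0 - T) (0 + T) y) at_top"
  proof (rule tendsto_at_top_error_bound)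
    show "\<forall>\<^sub>F U in at_top. norm (vint 0 U ?f - 2 * pi * \<i> * perron_res 0 (0 - T) (0 + T) y) \<le> 10 * y powr 0 / U"
      using eventually_ge_at_top[of "2 * T"]
    proof eventually_elim
      case (elim U)
      show ?case by (rule perron_kernel) (use T y elim in auto)
    qed
    show "((\<lambda>U. 10 * y powr 0 / U) \<longlongrightarrow> 0) at_top"
      by (intro tendsto_divide_0[OF tendsto_const] filterlim_at_top_imp_at_infinity filterlim_ident)
  qed
  have "((\<lambda>U. \<i> * vint 0 U ?f) \<longlongrightarrow> \<i> * (2 * pi * \<i> * perron_res 0 (0 - T) (0 + T) y)) at_top"
    by (intro tendsto_intros lim)
  also have "\<i> * (2 * pi * \<i> * perron_res 0 (0 - T) (0 + T) y) = of_real (pi / T * kap 0 T y)"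
    using T perron_res_kap[of T 0 0 y] by (simp add: algebra_simps)
  finally show ?thesis
  proof (rule Lim_transform_eventually)
    show "\<forall>\<^sub>F U in at_top. \<i> * vint 0 U ?f = integral {-U..U} (\<lambda>t. cp y (\<i> * of_real t) / of_real (T\<^sup>2 + t\<^sup>2))"
      using eventually_gt_at_top[of "0::real"]
    proof eventually_elim
      case (elim U)
      have "\<i> * vint 0 U ?f = - integral {-U..U} (\<lambda>t. ?f (Complex 0 t))"
        by (subst vint_eq_integral[OF elim]) (simp add: mult.assoc[symmetric])
      also have "\<dots> = integral {-U..U} (\<lambda>t. - ?f (Complex 0 t))" by simp
      also have "(\<lambda>t. - ?f (Complex 0 t)) = (\<lambda>t. cp y (\<i> * of_real t) / of_real (T\<^sup>2 + t\<^sup>2))"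
      proof
        fix t :: real
        have eq1: "(Complex 0 t - of_real (0 - T)) * (Complex 0 t - of_real (0 + T)) = - of_real (T\<^sup>2 + t\<^sup>2)"
          by (simp add: complex_eq_iff power2_eq_square)
        have eq2: "Complex 0 t = \<i> * of_real t" by (simp add: complex_eq_iff)
        have neg: "- (z / - w) = z / w" for z w :: complex by simp
        show "- ?f (Complex 0 t) = cp y (\<i> * of_real t) / of_real (T\<^sup>2 + t\<^sup>2)"
          by (subst eq1, subst neg) (simp only: eq2)
      qed
      finally show ?case .
    qed
  qed
qed

text \<open>Expanding the square leads to the double sum of \<open>kap 0 T (m / n)\<close>. The
  choice \<open>T = 8 * X\<close> gives \<open>T \<ge> 4 * m\<close> for all
  \<open>m \<le> 2 * X\<close>, so every row sums to at most \<open>3 / 2\<close>, and the total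
  factor \<open>pi / T * X * 3 / 2 = 3 * pi / 16\<close> is below 1.\<close>

lemma mean_square_limit:
  fixes X :: nat and g :: "nat \<Rightarrow> real"
  assumes X: "X \<ge> 1" and g: "\<And>m. \<bar>g m\<bar> \<le> 1" and \<sigma>: "0 \<le> \<sigma>" and T: "T = 8 * real X"
  obtains q where "q \<le> real X powr (2 * \<sigma>) * 2 powr (2 * \<sigma>)"
    "((\<lambda>U. integral {-U..U} (\<lambda>t. (norm (\<Sum>m\<in>{X+1..2*X}. of_real (g m) * cp m (Complex \<sigma> t)))\<^sup>2 / (T\<^sup>2 + t\<^sup>2))) \<longlongrightarrow> q) at_top"
proof -
  define I where "I = {X+1..2*X}"
  have T0: "T > 0" using X T by simp
  have I: "finite I" "card I = X" "\<And>m. m \<in> I \<Longrightarrow> m \<ge> 1" "\<And>m. m \<in> I \<Longrightarrow> m \<le> 2 * X" by (auto simp: I_def)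
  define w where "w = (\<lambda>m n. g m * g n * (real m powr \<sigma> * real n powr \<sigma>))"
  define P where "P = (\<lambda>t. \<Sum>m\<in>I. of_real (g m) * cp m (Complex \<sigma> t))"
  have cp2: "cp m (Complex \<sigma> t) * cnj (cp n (Complex \<sigma> t)) = of_real (real m powr \<sigma> * real n powr \<sigma>) * cp (m / n) (\<i> * of_real t)"
    if "m \<in> I" "n \<in> I" for m n t
  proof -
    have mn: "real m > 0" "real n > 0" using I that by (auto simp: Suc_le_eq)
    have "Complex \<sigma> t = of_real \<sigma> + \<i> * of_real t" by (simp add: complex_eq_iff)
    hence "cp k (Complex \<sigma> t) = of_real (k powr \<sigma>) * cp k (\<i> * of_real t)" if "k > 0" for k
      using that by (simp add: cp_add cp_of_real)
    moreover have "cnj (cp n (\<i> * of_real t)) = cp (1 / n) (\<i> * of_real t)"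
      using mn by (simp add: cp_def exp_cnj ln_div)
    moreover have "cp (m / n) (\<i> * of_real t) = cp m (\<i> * of_real t) * cp (1 / n) (\<i> * of_real t)"
      using cp_mult[of "real m" "1 / real n" "\<i> * of_real t"] mn by simp
    ultimately show ?thesis using mn by (simp add: mult_ac)
  qed
  have cpc: "continuous_on S (\<lambda>t. cp y (\<i> * complex_of_real t))" for y S
    unfolding cp_def by (intro continuous_intros)
  define q where "q = (\<Sum>m\<in>I. \<Sum>n\<in>I. w m n * (pi / T * kap 0 T (m / n)))"
  have "((\<lambda>U. \<Sum>m\<in>I. \<Sum>n\<in>I. of_real (w m n) * integral {-U..U} (\<lambda>t. cp (m / n) (\<i> * of_real t) / of_real (T\<^sup>2 + t\<^sup>2))) \<longlongrightarrow>
    (\<Sum>m\<in>I. \<Sum>n\<in>I. of_real (w m n) * of_real (pi / T * kap 0 T (m / n)))) at_top"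
    by (intro tendsto_sum tendsto_mult tendsto_const cp_weight_integral T0) (use I in \<open>auto simp: Suc_le_eq\<close>)
  also have "(\<Sum>m\<in>I. \<Sum>n\<in>I. of_real (w m n) * of_real (pi / T * kap 0 T (m / n))) = complex_of_real q"
    by (simp add: q_def)
  finally have lim: "((\<lambda>U. Re (\<Sum>m\<in>I. \<Sum>n\<in>I. of_real (w m n) * integral {-U..U} (\<lambda>t. cp (m / n) (\<i> * of_real t) / of_real (T\<^sup>2 + t\<^sup>2)))) \<longlongrightarrow> q) at_top"
    using tendsto_Re by fastforce
  have eq: "Re (\<Sum>m\<in>I. \<Sum>n\<in>I. of_real (w m n) * integral {-U..U} (\<lambda>t. cp (m / n) (\<i> * of_real t) / of_real (T\<^sup>2 + t\<^sup>2))) = 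
     integral {-U..U} (\<lambda>t. (norm (P t))\<^sup>2 / (T\<^sup>2 + t\<^sup>2))" for U
  proof -
    have nz: "T\<^sup>2 + t\<^sup>2 \<noteq> 0" for t using T0 by (simp add: add_nonneg_eq_0_iff)
    have int: "(\<lambda>t. of_real (w m n) * (cp (m / n) (\<i> * of_real t) / of_real (T\<^sup>2 + t\<^sup>2))) integrable_on {-U..U}" for m n
      by (intro integrable_continuous_real continuous_intros cpc) (use nz in \<open>simp flip: of_real_power of_real_add\<close>)
    have "(\<Sum>m\<in>I. \<Sum>n\<in>I. of_real (w m n) * integral {-U..U} (\<lambda>t. cp (m / n) (\<i> * of_real t) / of_real (T\<^sup>2 + t\<^sup>2))) =
      integral {-U..U} (\<lambda>t. \<Sum>m\<in>I. \<Sum>n\<in>I. of_real (w m n) * (cp (m / n) (\<i> * of_real t) / of_real (T\<^sup>2 + t\<^sup>2)))"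
    proof -
      have "integral {-U..U} (\<lambda>t. \<Sum>m\<in>I. \<Sum>n\<in>I. of_real (w m n) * (cp (m / n) (\<i> * of_real t) / of_real (T\<^sup>2 + t\<^sup>2))) =
        (\<Sum>m\<in>I. integral {-U..U} (\<lambda>t. \<Sum>n\<in>I. of_real (w m n) * (cp (m / n) (\<i> * of_real t) / of_real (T\<^sup>2 + t\<^sup>2))))"
        by (intro Henstock_Kurzweil_Integration.integral_sum Henstock_Kurzweil_Integration.integrable_sum int I(1))
      also have "\<dots> = (\<Sum>m\<in>I. \<Sum>n\<in>I. integral {-U..U} (\<lambda>t. of_real (w m n) * (cp (m / n) (\<i> * of_real t) / of_real (T\<^sup>2 + t\<^sup>2))))"
        by (intro sum.cong refl Henstock_Kurzweil_Integration.integral_sum int I(1))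
      also have "\<dots> = (\<Sum>m\<in>I. \<Sum>n\<in>I. of_real (w m n) * integral {-U..U} (\<lambda>t. cp (m / n) (\<i> * of_real t) / of_real (T\<^sup>2 + t\<^sup>2)))"
        by (intro sum.cong refl integral_mult_right)
      finally show ?thesis ..
    qed
    also have "(\<lambda>t. \<Sum>m\<in>I. \<Sum>n\<in>I. of_real (w m n) * (cp (m / n) (\<i> * of_real t) / of_real (T\<^sup>2 + t\<^sup>2))) = 
      (\<lambda>t. complex_of_real ((norm (P t))\<^sup>2 / (T\<^sup>2 + t\<^sup>2)))"
    proof
      fix t
      have "complex_of_real ((norm (P t))\<^sup>2) = P t * cnj (P t)" by (rule complex_norm_square)
      also have "\<dots> = (\<Sum>m\<in>I. \<Sum>n\<in>I. (of_real (g m) * cp m (Complex \<sigma> t)) * (of_real (g n) * cnj (cp n (Complex \<sigma> t))))"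
        by (simp add: P_def sum_product)
      also have "\<dots> = (\<Sum>m\<in>I. \<Sum>n\<in>I. of_real (w m n) * cp (m / n) (\<i> * of_real t))"
      proof (intro sum.cong refl)
        fix m n assume mn: "m \<in> I" "n \<in> I"
        have "(of_real (g m) * cp m (Complex \<sigma> t)) * (of_real (g n) * cnj (cp n (Complex \<sigma> t))) = 
           of_real (g m * g n) * (cp m (Complex \<sigma> t) * cnj (cp n (Complex \<sigma> t)))" by (simp add: mult_ac)
        also have "\<dots> = of_real (w m n) * cp (m / n) (\<i> * of_real t)"
          unfolding cp2[OF mn] by (simp add: w_def mult_ac)
        finally show "(of_real (g m) * cp m (Complex \<sigma> t)) * (of_real (g n) * cnj (cp n (Complex \<sigma> t))) = of_real (w m n) * cp (m / n) (\<i> * of_real t)" .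
      qed
      finally show "(\<Sum>m\<in>I. \<Sum>n\<in>I. of_real (w m n) * (cp (m / n) (\<i> * of_real t) / of_real (T\<^sup>2 + t\<^sup>2))) = complex_of_real ((norm (P t))\<^sup>2 / (T\<^sup>2 + t\<^sup>2))"
        by (simp add: sum_divide_distrib)
    qed
    also have "integral {-U..U} (\<lambda>t. complex_of_real ((norm (P t))\<^sup>2 / (T\<^sup>2 + t\<^sup>2))) = of_real (integral {-U..U} (\<lambda>t. (norm (P t))\<^sup>2 / (T\<^sup>2 + t\<^sup>2)))"
    proof -
      have "(\<lambda>t. (norm (P t))\<^sup>2 / (T\<^sup>2 + t\<^sup>2)) integrable_on {-U..U}"
        unfolding P_def cp_def Complex_eq
        by (intro integrable_continuous_real continuous_intros) (use nz in auto)
      thus ?thesis by (rule integral_linear[OF _ bounded_linear_of_real, unfolded o_def])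
    qed
    finally show ?thesis by simp
  qed
  have pT: "pi / T * (X * (3 / 2)) \<le> 1"
    using X pi_less_4 unfolding T by (simp add: field_simps)
  have "q \<le> (\<Sum>m\<in>I. \<Sum>n\<in>I. ((2 * real X) powr (2 * \<sigma>)) * (pi / T * kap 0 T (m / n)))"
    unfolding q_def
  proof (intro sum_mono mult_right_mono)
    fix m n assume mn: "m \<in> I" "n \<in> I"
    have "w m n \<le> 1 * ((2 * real X) powr \<sigma> * (2 * real X) powr \<sigma>)"
      unfolding w_def
    proof (intro mult_mono powr_mono2)
      show "g m * g n \<le> 1" using mult_mono[OF g[of m] g[of n]] by (simp add: abs_mult[symmetric])
      show "real m \<le> 2 * real X" "real n \<le> 2 * real X" using I(4)[OF mn(1)] I(4)[OF mn(2)] by linarith+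
    qed (use \<sigma> in auto)
    thus "w m n \<le> (2 * real X) powr (2 * \<sigma>)" by (simp flip: powr_add)
  qed (use T0 kap_nonneg in auto)
  also have "\<dots> = (2 * real X) powr (2 * \<sigma>) * (pi / T * (\<Sum>m\<in>I. \<Sum>n\<in>I. kap 0 T (m / n)))"
    by (simp add: sum_distrib_left)
  also have "\<dots> \<le> (2 * real X) powr (2 * \<sigma>) * (pi / T * (\<Sum>m\<in>I. 3 / 2))"
  proof (intro mult_left_mono sum_mono)
    fix m assume m: "m \<in> I"
    have "(\<Sum>n\<in>I. kap 0 T (m / n)) = (\<Sum>n\<in>{X..<2*X}. kap 0 T (m / Suc n))"
      unfolding I_def by (rule sum.reindex_bij_witness[of _ Suc "\<lambda>n. n - 1"]) auto
    also have "\<dots> \<le> (\<Sum>n<2*X. kap 0 T (m / Suc n))"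
      by (intro sum_mono2) (auto simp: kap_nonneg)
    also have "\<dots> \<le> 3 / 2"
      by (rule sum_kap_le) (use I(3)[OF m] I(4)[OF m] T in auto)
    finally show "(\<Sum>n\<in>I. kap 0 T (m / n)) \<le> 3 / 2" .
  qed (use T0 in auto)
  also have "\<dots> = (2 * real X) powr (2 * \<sigma>) * (pi / T * (X * (3 / 2)))" by (simp add: I(2))
  also have "\<dots> \<le> (2 * real X) powr (2 * \<sigma>) * 1" by (intro mult_left_mono pT) auto
  also have "\<dots> = real X powr (2 * \<sigma>) * 2 powr (2 * \<sigma>)" by (simp add: powr_mult)
  finally have "q \<le> real X powr (2 * \<sigma>) * 2 powr (2 * \<sigma>)" .
  moreover have "((\<lambda>U. integral {-U..U} (\<lambda>t. (norm (P t))\<^sup>2 / (T\<^sup>2 + t\<^sup>2))) \<longlongrightarrow> q) at_top"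
    using lim unfolding eq .
  ultimately show ?thesis unfolding P_def I_def by (rule that)
qed

text \<open>
  With \<open>A\<close> the alternating zeta function and \<open>P\<close> the test polynomial, Perron's formula evaluates the
  integral of \<open>A * P / (T\<^sup>2 + t\<^sup>2)\<close> with \<open>T = 8 * X\<close>; it is bounded below because every
  \<open>m\<close> contributes with the same sign. Cauchy-Schwarz bounds the same integral by a negative power of \<open>X\<close>.
\<close>

lemma zeta1_has_zero: "\<exists>s. Re s > 1 / 8 \<and> zeta1 s = 0"
proof (rule ccontr)
  assume "\<not> (\<exists>s. Re s > 1 / 8 \<and> zeta1 s = 0)"
  hence nz: "\<And>s. Re s > 1 / 8 \<Longrightarrow> zeta1 s \<noteq> 0" by blast
  \<comment> \<open>The growth exponent \<open>1 / 16\<close> makes the weighted mean square of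
    \<open>A\<close> at most of order \<open>X powr (- 7 / 8)\<close>, while that of the test
    polynomial is at most of order \<open>X powr (2 * \<sigma>)\<close>. Since
    \<open>2 * \<sigma> = 1 / 2 < 7 / 8\<close>, the geometric mean tends to 0. The line lies
    strictly to the right of the assumed zero-free boundary \<open>1 / 8\<close>.\<close>
  define \<sigma> :: real where "\<sigma> = 1 / 4"
  obtain A C where A: "A holomorphic_on UNIV" "C > 0"
    "\<And>s. Re s = 2 \<Longrightarrow> (\<lambda>n. (-1) ^ n * npow (Suc n) s) sums A s"
    "\<And>s. \<sigma> \<le> Re s \<Longrightarrow> Re s \<le> 2 \<Longrightarrow> norm (A s) \<le> C * (1 + \<bar>Im s\<bar>) powr (1 / 16)"
    by (rule eta_bound[where \<theta> = "1 / 8" and \<sigma> = \<sigma> and e = "1 / 16"]) (use nz in \<open>auto simp: \<sigma>_def\<close>)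
  define B where "B = 4 * C\<^sup>2 / (7 / 8)"
  have B: "B \<ge> 0" by (simp add: B_def)
  define K where "K = (B + 2 powr (1 / 2)) / 2"
  have Acont: "continuous_on S (\<lambda>t. A (Complex \<sigma> t))" for S
    by (rule continuous_on_compose2[OF holomorphic_on_imp_continuous_on[OF A(1)]])
       (auto simp: Complex_eq intro!: continuous_intros)
  have main: "pi / 16 \<le> K * real X powr (- 3 / 16)" if X: "X \<ge> 1" for X :: nat
  proof -
    define T where "T = 8 * real X"
    have T: "T \<ge> 8" using X by (simp add: T_def)
    define I where "I = {X+1..2*X}"
    have I: "finite I" "card I = X" "\<And>m. m \<in> I \<Longrightarrow> m \<ge> 1" "\<And>m. m \<in> I \<Longrightarrow> real m \<le> 2 * real X" by (auto simp: I_def)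
    \<comment> \<open>The signs of the diagonal terms of the alternating sums; with them all
      contributions \<open>g m * S m\<close> become positive.\<close>
    define g where "g = (\<lambda>m::nat. (-1) ^ (m - 1) :: real)"
    have "\<exists>S. (\<lambda>n. (-1) ^ n * kap \<sigma> T (m / Suc n)) sums S \<and> g m * S \<ge> 1 / 2" if m: "m \<in> I" for m
    proof -
      obtain S where "(\<lambda>n. (-1) ^ n * kap \<sigma> T (m / Suc n)) sums S" "(-1) ^ (m - 1) * S \<ge> 1 / 2"
        by (rule alternating_kap_sums[of m \<sigma> T]) (use I(3,4)[OF m] in \<open>auto simp: \<sigma>_def T_def\<close>)
      thus ?thesis unfolding g_def by blast
    qed
    then obtain S where S: "\<And>m. m \<in> I \<Longrightarrow> (\<lambda>n. (-1) ^ n * kap \<sigma> T (m / Suc n)) sums S m"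
      "\<And>m. m \<in> I \<Longrightarrow> g m * S m \<ge> 1 / 2" by metis
    define F where "F = (\<lambda>m s. A s * (cp (real m) s / ((s - complex_of_real (\<sigma> - T)) * (s - of_real (\<sigma> + T)))))"
    have perron: "((\<lambda>U. vint \<sigma> U (F m)) \<longlongrightarrow> 2 * pi * \<i> * of_real (- S m / (2 * T))) at_top" if m: "m \<in> I" for m
      unfolding F_def
    proof (rule perron_shifted)
      have "(\<lambda>n. (- 1 / (2 * T)) * ((-1) ^ n * kap \<sigma> T (m / Suc n))) sums ((- 1 / (2 * T)) * S m)"
        by (intro sums_mult S m)
      moreover have "perron_res 2 (\<sigma> - T) (\<sigma> + T) y = - kap \<sigma> T y / (2 * T)" for y
        using T by (intro perron_res_kap) (auto simp: \<sigma>_def)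
      ultimately show "(\<lambda>n. (-1) ^ n * perron_res 2 (\<sigma> - T) (\<sigma> + T) (m / Suc n)) sums (- S m / (2 * T))"
        by (simp add: mult_ac)
      show "(\<lambda>n. complex_of_real ((-1) ^ n) * npow (Suc n) s) sums A s" if "Re s = 2" for s
        using A(3)[OF that] by simp
      show "A holomorphic_on {s. 0 < Re s}" using A(1) by (rule holomorphic_on_subset) simp
      show "norm (A s) \<le> C * (1 + \<bar>Im s\<bar>) powr (1 / 16)" if "\<sigma> \<le> Re s" "Re s \<le> 2" for s
        using A(4)[OF that] .
    qed (use T I(3)[OF m] in \<open>auto simp: \<sigma>_def power_abs\<close>)
    define L where "L = (\<Sum>m\<in>I. of_real (g m) * (2 * pi * \<i> * of_real (- S m / (2 * T))))"
    have lim: "((\<lambda>U. \<Sum>m\<in>I. of_real (g m) * vint \<sigma> U (F m)) \<longlongrightarrow> L) at_top"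
      unfolding L_def by (intro tendsto_sum tendsto_mult tendsto_const perron)
    have "L = - (pi * \<i> / T) * of_real (\<Sum>m\<in>I. g m * S m)"
      using T by (simp add: L_def sum_distrib_left sum_negf field_simps)
    hence "norm L = pi / T * \<bar>\<Sum>m\<in>I. g m * S m\<bar>" using T by (simp add: norm_mult norm_divide del: of_real_sum)
    \<comment> \<open>There are \<open>X\<close> contributions of at least \<open>1 / 2\<close>, and
      \<open>T = 8 * X\<close>, so the lower bound \<open>pi / 16\<close> does not depend on
      \<open>X\<close>.\<close>
    also have "\<dots> \<ge> pi / T * (\<Sum>m\<in>I. 1 / 2)"
    proof (rule mult_left_mono)
      have "(\<Sum>m\<in>I. 1 / 2) \<le> (\<Sum>m\<in>I. g m * S m)" by (intro sum_mono S)
      thus "(\<Sum>m\<in>I. 1 / 2) \<le> \<bar>\<Sum>m\<in>I. g m * S m\<bar>" by linarith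
    qed (use T in auto)
    also have "pi / T * (\<Sum>m\<in>I. 1 / 2) = pi / 16" using X by (simp add: I(2) T_def)
    finally have L: "pi / 16 \<le> norm L" .
    define P where "P = (\<lambda>t. \<Sum>m\<in>I. of_real (g m) * cp m (Complex \<sigma> t))"
    have Pcont: "continuous_on S P" for S unfolding P_def cp_def Complex_eq by (intro continuous_intros)
    have nz: "T\<^sup>2 + t\<^sup>2 > 0" for t using T by (simp add: add_pos_nonneg)
    define Q where "Q = (\<lambda>U. integral {-U..U} (\<lambda>t. (norm (P t))\<^sup>2 / (T\<^sup>2 + t\<^sup>2)))"
    \<comment> \<open>Cauchy-Schwarz is used in the form
      \<open>2 * a * b \<le> \<Lambda> * a^2 + b^2 / \<Lambda>\<close>. The exponent
      \<open>11 / 16\<close> balances both parts: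
      \<open>11 / 16 - 7 / 8 = 1 / 2 - 11 / 16 = - 3 / 16\<close>.\<close>
    define \<Lambda> where "\<Lambda> = real X powr (11 / 16)"
    have \<Lambda>: "\<Lambda> > 0" using X by (simp add: \<Lambda>_def)
    obtain q where q: "q \<le> real X powr (2 * \<sigma>) * 2 powr (2 * \<sigma>)" "(Q \<longlongrightarrow> q) at_top"
      unfolding Q_def P_def I_def by (rule mean_square_limit[of X g \<sigma> T]) (use X in \<open>auto simp: g_def T_def \<sigma>_def power_abs\<close>)
    have bound: "norm (\<Sum>m\<in>I. of_real (g m) * vint \<sigma> U (F m)) \<le> (\<Lambda> * (B * T powr (-7/8)) + Q U / \<Lambda>) / 2" if U: "U > 0" for U
    proof -
      let ?w = "\<lambda>t. T\<^sup>2 + t\<^sup>2"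
      have Feq: "F m (Complex \<sigma> t) = - (A (Complex \<sigma> t) * cp m (Complex \<sigma> t) / of_real (?w t))" for m t
      proof -
        have eq: "(Complex \<sigma> t - of_real (\<sigma> - T)) * (Complex \<sigma> t - of_real (\<sigma> + T)) = - of_real (?w t)"
          by (simp add: complex_eq_iff power2_eq_square algebra_simps)
        show ?thesis unfolding F_def eq
          by (simp only: divide_minus_right mult_minus_right times_divide_eq_right)
      qed
      have "continuous_on {-U..U} (\<lambda>t. F m (Complex \<sigma> t))" for m
        unfolding Feq using nz
        by (intro continuous_intros Acont; (unfold cp_def Complex_eq)?; (intro continuous_intros)?) 
           (metis less_irrefl of_real_eq_0_iff)
      hence int: "(\<lambda>t. of_real (g m) * F m (Complex \<sigma> t)) integrable_on {-U..U}" for m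
        by (intro integrable_continuous_real continuous_intros)
      have "(\<Sum>m\<in>I. of_real (g m) * vint \<sigma> U (F m)) = \<i> * (\<Sum>m\<in>I. of_real (g m) * integral {-U..U} (\<lambda>t. F m (Complex \<sigma> t)))"
        by (simp add: vint_eq_integral[OF U] sum_distrib_left mult_ac)
      also have "(\<Sum>m\<in>I. of_real (g m) * integral {-U..U} (\<lambda>t. F m (Complex \<sigma> t))) = 
          (\<Sum>m\<in>I. integral {-U..U} (\<lambda>t. of_real (g m) * F m (Complex \<sigma> t)))"
        by (intro sum.cong refl integral_mult_right[symmetric])
      also have "\<dots> = integral {-U..U} (\<lambda>t. \<Sum>m\<in>I. of_real (g m) * F m (Complex \<sigma> t))"
        by (intro Henstock_Kurzweil_Integration.integral_sum[symmetric] int I(1))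
      also have "(\<lambda>t. \<Sum>m\<in>I. of_real (g m) * F m (Complex \<sigma> t)) = (\<lambda>t. - (A (Complex \<sigma> t) * P t / of_real (?w t)))"
        by (simp add: Feq P_def sum_distrib_left sum_divide_distrib sum_negf mult_ac fun_eq_iff)
      also have "norm (\<i> * integral {-U..U} (\<lambda>t. - (A (Complex \<sigma> t) * P t / of_real (?w t)))) = 
        norm (integral {-U..U} (\<lambda>t. - (A (Complex \<sigma> t) * P t / of_real (?w t))))" by (simp add: norm_mult)
      also have "\<dots> \<le> integral {-U..U} (\<lambda>t. (\<Lambda> * ((norm (A (Complex \<sigma> t)))\<^sup>2 / ?w t) + (norm (P t))\<^sup>2 / ?w t / \<Lambda>) / 2)"
      proof (rule Henstock_Kurzweil_Integration.integral_norm_bound_integral)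
        show "(\<lambda>t. - (A (Complex \<sigma> t) * P t / of_real (?w t))) integrable_on {-U..U}"
          using nz by (intro integrable_continuous_real continuous_intros Acont Pcont) (metis less_irrefl of_real_eq_0_iff)
        show "(\<lambda>t. (\<Lambda> * ((norm (A (Complex \<sigma> t)))\<^sup>2 / ?w t) + (norm (P t))\<^sup>2 / ?w t / \<Lambda>) / 2) integrable_on {-U..U}"
          using nz \<Lambda> by (intro integrable_continuous_real continuous_intros Acont Pcont) (auto simp: less_imp_neq[symmetric])
        fix t
        define a b where "a = norm (A (Complex \<sigma> t))" "b = norm (P t)"
        have "0 \<le> (\<Lambda> * a - b)\<^sup>2 / \<Lambda>" using \<Lambda> by simp
        also have "\<dots> = \<Lambda> * a\<^sup>2 + b\<^sup>2 / \<Lambda> - 2 * (a * b)"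
          using \<Lambda> by (simp add: field_simps power2_eq_square)
        finally have "a * b \<le> (\<Lambda> * a\<^sup>2 + b\<^sup>2 / \<Lambda>) / 2" by simp
        hence "a * b / ?w t \<le> (\<Lambda> * a\<^sup>2 + b\<^sup>2 / \<Lambda>) / 2 / ?w t" using nz[of t] by (intro divide_right_mono) auto
        also have "\<dots> = (\<Lambda> * (a\<^sup>2 / ?w t) + b\<^sup>2 / ?w t / \<Lambda>) / 2" by (simp add: add_divide_distrib mult_ac)
        finally show "norm (- (A (Complex \<sigma> t) * P t / of_real (?w t))) \<le> (\<Lambda> * ((norm (A (Complex \<sigma> t)))\<^sup>2 / ?w t) + (norm (P t))\<^sup>2 / ?w t / \<Lambda>) / 2"
          using nz[of t] by (simp add: a_b_def norm_divide norm_mult del: of_real_add)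
      qed
      also have "\<dots> = (\<Lambda> * integral {-U..U} (\<lambda>t. (norm (A (Complex \<sigma> t)))\<^sup>2 / ?w t) + Q U / \<Lambda>) / 2"
      proof -
        have i1: "(\<lambda>t. (norm (A (Complex \<sigma> t)))\<^sup>2 / ?w t) integrable_on {-U..U}" "(\<lambda>t. (norm (P t))\<^sup>2 / ?w t) integrable_on {-U..U}"
          using nz by (intro integrable_continuous_real continuous_intros Acont Pcont; auto simp: less_imp_neq[symmetric])+
        have "((\<lambda>t. (\<Lambda> * ((norm (A (Complex \<sigma> t)))\<^sup>2 / ?w t) + (norm (P t))\<^sup>2 / ?w t / \<Lambda>) / 2) has_integral 
          (\<Lambda> * integral {-U..U} (\<lambda>t. (norm (A (Complex \<sigma> t)))\<^sup>2 / ?w t) + Q U / \<Lambda>) / 2) {-U..U}"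
          unfolding Q_def by (intro has_integral_divide has_integral_add has_integral_mult_right integrable_integral i1)
        thus ?thesis by (rule integral_unique)
      qed
      also have "\<dots> \<le> (\<Lambda> * (B * T powr (-7/8)) + Q U / \<Lambda>) / 2"
      proof -
        have "integral {-U..U} (\<lambda>t. (norm (A (Complex \<sigma> t)))\<^sup>2 / ?w t) \<le> 4 * C\<^sup>2 * T powr (1/8 - 1) / (1 - 1/8)"
          by (rule integral_le_weight) (use T U A(2) A(4)[of "Complex \<sigma> t" for t] Acont in \<open>auto simp: \<sigma>_def\<close>)
        thus ?thesis using \<Lambda> by (simp add: B_def)
      qed
      finally show ?thesis .
    qed
    have "norm L \<le> (\<Lambda> * (B * T powr (-7/8)) + q / \<Lambda>) / 2"
    proof (rule tendsto_le[OF _ _ tendsto_norm[OF lim]])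
      show "((\<lambda>U. (\<Lambda> * (B * T powr (-7/8)) + Q U / \<Lambda>) / 2) \<longlongrightarrow> (\<Lambda> * (B * T powr (-7/8)) + q / \<Lambda>) / 2) at_top"
        using \<Lambda> by (intro tendsto_intros q) auto
      show "\<forall>\<^sub>F U in at_top. norm (\<Sum>m\<in>I. of_real (g m) * vint \<sigma> U (F m)) \<le> (\<Lambda> * (B * T powr (-7/8)) + Q U / \<Lambda>) / 2"
        using eventually_gt_at_top[of "0::real"] by eventually_elim (rule bound)
    qed auto
    also have "\<dots> \<le> (B * real X powr (-3/16) + 2 powr (1/2) * real X powr (-3/16)) / 2"
    proof (intro divide_right_mono add_mono)
      have "T powr (-7/8) \<le> real X powr (-7/8)" using X by (intro powr_mono2') (auto simp: T_def)
      hence "\<Lambda> * (B * T powr (-7/8)) \<le> \<Lambda> * (B * real X powr (-7/8))" using \<Lambda> B by (intro mult_left_mono) auto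
      also have "\<dots> = B * (real X powr (11/16) * real X powr (-7/8))" by (simp add: \<Lambda>_def)
      also have "real X powr (11/16) * real X powr (-7/8) = real X powr (-3/16)" by (simp flip: powr_add)
      finally show "\<Lambda> * (B * T powr (-7/8)) \<le> B * real X powr (-3/16)" .
      have "q / \<Lambda> \<le> real X powr (1/2) * 2 powr (1/2) / \<Lambda>" using q(1) \<Lambda> by (intro divide_right_mono) (auto simp: \<sigma>_def)
      also have "\<dots> = 2 powr (1/2) * (real X powr (1/2) / real X powr (11/16))" by (simp add: \<Lambda>_def)
      also have "real X powr (1/2) / real X powr (11/16) = real X powr (-3/16)" by (simp flip: powr_diff)
      finally show "q / \<Lambda> \<le> 2 powr (1/2) * real X powr (-3/16)" .
    qed auto
    also have "\<dots> = K * real X powr (-3/16)" by (simp add: K_def algebra_simps)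
    finally show ?thesis using L by linarith
  qed
  have "((\<lambda>X::nat. K * real X powr (- 3 / 16)) \<longlonglongrightarrow> K * 0)"
    by (intro tendsto_intros tendsto_neg_powr filterlim_real_sequentially) auto
  hence "\<forall>\<^sub>F X in sequentially. K * real X powr (- 3 / 16) < pi / 16"
    by (rule order_tendstoD) auto
  hence "\<forall>\<^sub>F X::nat in sequentially. False"
    using eventually_ge_at_top[of 1] by eventually_elim (use main in fastforce)
  thus False by simp
qed

section \<open>The lower bound for averages of M\<close>

text \<open>This is \<open>s\<close> times the integral of \<open>M(u) * u ^ (- s - 1)\<close> over
  \<open>[1, N]\<close>, the partial sum of the series of \<open>1 / zeta\<close> without its
  boundary term at \<open>N\<close>. It depends on \<open>M\<close> only through the values at
  integers below \<open>N\<close>, and its terms are smaller by one power of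
  \<open>n\<close>.\<close>

definition abel_sum :: "nat \<Rightarrow> complex \<Rightarrow> complex" where
  "abel_sum N s = (\<Sum>n=1..<N. of_int (Mn n) * (npow n s - npow (Suc n) s))"

lemma npow_diff_bound:
  assumes "n \<ge> 1" "Re s \<ge> -1"
  shows "norm (npow n s - npow (Suc n) s) \<le> norm s * real n powr (- Re s - 1)"
proof -
  have cp: "npow k s = cp (real k) (- s)" if "k > 0" for k
    using that by (simp add: npow_eq_cp cp_def ln_div)
  have "norm (cp (real (Suc n)) (- s) - cp (real n) (- s)) \<le> norm (- s) * real n powr (- Re s - 1) * (real (Suc n) - real n)"
    by (rule cp_diff_bound) (use assms in \<open>auto intro!: powr_mono2'\<close>)
  thus ?thesis using assms cp by (simp add: norm_minus_commute)
qed

lemma abel_sum_eq: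
  "N \<ge> 1 \<Longrightarrow> abel_sum N s = (\<Sum>n=1..N. of_int (moebius n) * npow n s) - of_int (Mn N) * npow N s"
proof (induction N rule: dec_induct)
  case base
  thus ?case by (simp add: abel_sum_def Mn_Suc)
next
  case (step n)
  have "abel_sum (Suc n) s = abel_sum n s + of_int (Mn n) * (npow n s - npow (Suc n) s)"
    using step(1) by (simp add: abel_sum_def)
  thus ?case using step(1) by (simp add: step(3) Mn_Suc algebra_simps)
qed

lemma abel_sum_tendsto:
  assumes s: "Re s > 1"
  shows "(\<lambda>N. abel_sum N s) \<longlonglongrightarrow> 1 / zeta s"
proof -
  have "Suc ` UNIV = {1..}" by (auto simp: image_iff Suc_le_eq gr0_conv_Suc)
  hence "((\<lambda>n. of_int (moebius n) * npow n s) has_sum (1 / zeta s)) (Suc ` UNIV)"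
    using moebius_has_sum(2)[OF s] by simp
  hence "((\<lambda>n. of_int (moebius (Suc n)) * npow (Suc n) s) has_sum (1 / zeta s)) UNIV"
    by (subst (asm) has_sum_reindex) (auto simp: o_def)
  hence "(\<lambda>N. \<Sum>n<N. of_int (moebius (Suc n)) * npow (Suc n) s) \<longlonglongrightarrow> 1 / zeta s"
    using has_sum_imp_sums unfolding sums_def by blast
  also have "(\<lambda>N. \<Sum>n<N. of_int (moebius (Suc n)) * npow (Suc n) s) = (\<lambda>N. \<Sum>n=1..N. of_int (moebius n) * npow n s)"
    by (intro ext sum.reindex_bij_witness[of _ "\<lambda>n. n - 1" Suc]) auto
  finally have 1: "(\<lambda>N. \<Sum>n=1..N. of_int (moebius n) * npow n s) \<longlonglongrightarrow> 1 / zeta s" .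
  have "(\<lambda>N. of_int (Mn N) * npow N s) \<longlonglongrightarrow> 0"
  proof (rule Lim_null_comparison)
    show "\<forall>\<^sub>F N in sequentially. norm (of_int (Mn N) * npow N s) \<le> real N powr (1 - Re s)"
      using eventually_ge_at_top[of 1]
    proof eventually_elim
      case (elim N)
      have "norm (of_int (Mn N) * npow N s) \<le> real N * real N powr (- Re s)"
        unfolding norm_mult using elim abs_Mn_le[of N] by (intro mult_mono) (auto simp: norm_npow)
      also have "\<dots> = real N powr (1 - Re s)" using elim by (simp add: powr_diff powr_minus divide_inverse)
      finally show ?case .
    qed
    show "(\<lambda>N. real N powr (1 - Re s)) \<longlonglongrightarrow> 0"
      using s by (intro tendsto_neg_powr filterlim_real_sequentially) auto
  qed
  from tendsto_diff[OF 1 this] have "(\<lambda>N. (\<Sum>n=1..N. of_int (moebius n) * npow n s) - of_int (Mn N) * npow N s) \<longlonglongrightarrow> 1 / zeta s"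
    by simp
  thus ?thesis
    by (rule Lim_transform_eventually) (use abel_sum_eq in \<open>auto simp: eventually_sequentially intro!: exI[of _ 1]\<close>)
qed

lemma abel_sum_term_bound:
  assumes C: "\<And>n. n \<ge> 1 \<Longrightarrow> real_of_int \<bar>Mn n\<bar> \<le> C * real n powr t" and n: "n \<ge> 1" and s: "Re s \<ge> -1"
  shows "norm (of_int (Mn n) * (npow n s - npow (Suc n) s)) \<le> C * norm s * real n powr (t - Re s - 1)"
proof -
  have "norm (of_int (Mn n) * (npow n s - npow (Suc n) s)) \<le> (C * real n powr t) * (norm s * real n powr (- Re s - 1))"
    unfolding norm_mult using C[OF n] npow_diff_bound[OF n s] by (intro mult_mono) (auto intro: order_trans)
  also have "\<dots> = C * norm s * (real n powr t * real n powr (- Re s - 1))" by simp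
  also have "real n powr t * real n powr (- Re s - 1) = real n powr (t - Re s - 1)" 
    by (simp add: algebra_simps flip: powr_add)
  finally show ?thesis .
qed

text \<open>By the upper bound for \<open>M\<close> the Abel-summed series converges locally
  uniformly in \<open>Re s > \<theta>\<close>, and the identity spreads from \<open>Re s > 1\<close>
  by analytic continuation. Multiplying by \<open>zeta1\<close> lets the equation hold at
  \<open>s = 1\<close> too.\<close>

lemma abel_series:
  assumes \<theta>: "0 \<le> \<theta>" "\<theta> \<le> 1" and nz: "\<And>s. Re s > \<theta> \<Longrightarrow> zeta1 s \<noteq> 0"
    and s: "Re s > \<theta>"
  shows "\<exists>B. (\<lambda>n. of_int (Mn (Suc n)) * (npow (Suc n) s - npow (Suc (Suc n)) s)) sums B \<and> zeta1 s * B = s - 1"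
proof -
  define b where "b = (\<lambda>n s. complex_of_int (Mn (Suc n)) * (npow (Suc n) s - npow (Suc (Suc n)) s))"
  \<comment> \<open>Of the distance \<open>3 * d\<close> from the boundary line, one
    \<open>d\<close> is lost in the bound for \<open>M\<close> and one to the radius of the disc;
    the last one makes the exponent \<open>- (1 + d)\<close> summable.\<close>
  have lim: "uniform_limit (cball z d) (\<lambda>N s. \<Sum>n<N. b n s) (\<lambda>s. \<Sum>n. b n s) sequentially"
    if d: "d > 0" "\<theta> + 3 * d \<le> Re z" for z d
  proof -
    obtain C where C: "C > 0" "\<And>n. n \<ge> 1 \<Longrightarrow> real_of_int \<bar>Mn n\<bar> \<le> C * real n powr (\<theta> + d)"
      using Mn_bound[OF \<theta> nz d(1)] by metis
    show ?thesis
    proof (rule Weierstrass_m_test)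
      show "summable (\<lambda>n. (C * (norm z + d)) * real (Suc n) powr (- (1 + d)))"
        using d by (intro summable_Suc_powr) auto
      fix n w assume w: "w \<in> cball z d"
      have w1: "norm (w - z) \<le> d" using w by (simp add: dist_norm norm_minus_commute)
      have Rew: "Re w \<ge> \<theta> + 2 * d" using abs_Re_le_cmod[of "w - z"] w1 d by simp
      have nw: "norm w \<le> norm z + d" using norm_triangle_ineq[of "w - z" z] w1 by simp
      have "norm (b n w) \<le> C * norm w * real (Suc n) powr (\<theta> + d - Re w - 1)"
        unfolding b_def by (rule abel_sum_term_bound[OF C(2)]) (use Rew \<theta> d in auto)
      also have "\<dots> \<le> C * (norm z + d) * real (Suc n) powr (- (1 + d))"
        using C nw d Rew by (intro mult_mono powr_mono mult_nonneg_nonneg) auto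
      finally show "norm (b n w) \<le> C * (norm z + d) * real (Suc n) powr (- (1 + d))" .
    qed
  qed
  have sub: "Re w > \<theta>" if "d > 0" "\<theta> + 3 * d \<le> Re z" "w \<in> cball z d" for w z d
  proof -
    have "norm (w - z) \<le> d" using that by (simp add: dist_norm norm_minus_commute)
    thus ?thesis using abs_Re_le_cmod[of "w - z"] that by simp
  qed
  have dz: "(Re z - \<theta>) / 3 > 0" "\<theta> + 3 * ((Re z - \<theta>) / 3) \<le> Re z" if "Re z > \<theta>" for z
    using that by (auto simp: field_simps)
  have sums: "(\<lambda>n. b n z) sums (\<Sum>n. b n z)" if z: "Re z > \<theta>" for z
  proof -
    have "z \<in> cball z ((Re z - \<theta>) / 3)" using dz[OF z] by simp
    from tendsto_uniform_limitI[OF lim[OF dz[OF z]] this] show ?thesis by (simp add: sums_def)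
  qed
  have hol: "(\<lambda>s. \<Sum>n. b n s) holomorphic_on {s. Re s > \<theta>}"
  proof (rule holomorphic_uniform_sequence)
    show "open {s. Re s > \<theta>}" by (rule open_halfspace_Re_gt)
    show "(\<lambda>s. \<Sum>n<N. b n s) holomorphic_on {s. Re s > \<theta>}" for N
      unfolding b_def by (intro holomorphic_intros) auto
    fix z assume "z \<in> {s. Re s > \<theta>}"
    hence z: "Re z > \<theta>" by simp
    show "\<exists>d>0. cball z d \<subseteq> {s. \<theta> < Re s} \<and> uniform_limit (cball z d) (\<lambda>N s. \<Sum>n<N. b n s) (\<lambda>s. \<Sum>n. b n s) sequentially"
      using lim[OF dz[OF z]] dz[OF z] sub[OF dz[OF z]] by blast
  qed
  have eq1: "(\<Sum>n. b n z) = 1 / zeta z" if z: "Re z > 1" for z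
  proof -
    have "(\<lambda>N. abel_sum (Suc N) z) \<longlonglongrightarrow> 1 / zeta z"
      using abel_sum_tendsto[OF z] by (rule LIMSEQ_Suc)
    also have "(\<lambda>N. abel_sum (Suc N) z) = (\<lambda>N. \<Sum>n<N. b n z)"
      unfolding abel_sum_def b_def by (intro ext sum.reindex_bij_witness[of _ Suc "\<lambda>n. n - 1"]) auto
    finally show ?thesis using sums[of z] z \<theta> LIMSEQ_unique by (auto simp: sums_def)
  qed
  have "zeta1 s * (\<Sum>n. b n s) - (s - 1) = 0"
  proof (rule analytic_continuation[where f = "\<lambda>s. zeta1 s * (\<Sum>n. b n s) - (s - 1)" and S = "{s. Re s > \<theta>}" and U = "{s. Re s > 1}" and \<xi> = 2])
    show "(\<lambda>s. zeta1 s * (\<Sum>n. b n s) - (s - 1)) holomorphic_on {s. Re s > \<theta>}"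
      by (intro holomorphic_intros hol)
    show "2 islimpt {s. Re s > 1}"
      by (rule open_imp_islimpt) (auto simp: open_halfspace_Re_gt)
    fix z assume "z \<in> {s. Re s > 1}"
    hence z: "Re z > 1" by simp
    hence "z \<noteq> 1" by auto
    thus "zeta1 z * (\<Sum>n. b n z) - (z - 1) = 0"
      unfolding eq1[OF z] using moebius_has_sum(1)[OF z] by (simp add: zeta1_def)
  qed (use s \<theta> in \<open>auto simp: open_halfspace_Re_gt connected_halfspace_Re_gt\<close>)
  thus ?thesis using sums[OF s] by (intro exI[of _ "\<Sum>n. b n s"]) (simp add: b_def)
qed

text \<open>
  The function \<open>s - 1 - zeta1 s * abel_sum N s\<close> does not vanish at a zero \<open>\<rho>\<close> of zeta, whereas on a
  fixed circle around \<open>\<rho>\<close> it is small after multiplication by \<open>N powr ((1 - \<delta> / 2) * (s - \<rho>) + a * (s - \<rho>)\<^sup>2)\<close>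
  if \<open>M\<close> is small on average over \<open>[N powr (1 - \<delta>), N]\<close>: to the right of \<open>\<rho>\<close> it is a tail of the series for
  \<open>1 / zeta\<close>, to the left it is essentially a sum up to \<open>N powr (1 - \<delta>)\<close>. The quadratic term makes up
  for the lack of decay near the vertical diameter. The maximum principle then gives a contradiction.
\<close>

lemma exponent_bounds:
  fixes u \<delta> r \<tau> e \<epsilon> \<sigma> \<beta> \<theta> :: real
  assumes u: "\<bar>u\<bar> \<le> r" "u = \<sigma> - \<beta>" "\<tau> = \<theta> - \<beta>" and r: "0 < r" "r \<le> 1/4" and \<delta>: "0 < \<delta>" "\<delta> \<le> \<epsilon> / 6" "\<epsilon> \<le> 1"
    and e: "e > 0" "\<tau> \<ge> 0" "2 * \<tau> + 5 * e \<le> \<delta> * r / 8" and \<beta>: "\<beta> \<le> 1"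
  defines "W \<equiv> (1 - \<delta> / 2) * u + \<delta> / (4 * r) * (2 * u\<^sup>2 - r\<^sup>2)"
  shows "u \<ge> \<tau> + 2 * e \<Longrightarrow> \<theta> + 2 * e - \<sigma> + W \<le> - (\<delta> * r / 8)"
    and "u < \<tau> + 2 * e \<Longrightarrow> W \<le> - (\<delta> * r / 8)"
    and "u < \<tau> + 2 * e \<Longrightarrow> (1 - \<delta>) * (\<theta> + 3 * e - \<sigma>) + W \<le> - (\<delta> * r / 8)"
    and "u < \<tau> + 2 * e \<Longrightarrow> 1 + \<theta> - \<epsilon> - (1 - \<delta>) * (\<sigma> + 1) + W \<le> - (\<delta> * r / 8)"
proof -
  have \<delta>1: "\<delta> \<le> 1 / 6" using \<delta> by simp
  have "u\<^sup>2 \<le> r * \<bar>u\<bar>"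
    using mult_right_mono[OF u(1), of "\<bar>u\<bar>"] by (simp add: power2_eq_square abs_mult_self_eq)
  hence "\<delta> / (4 * r) * (2 * u\<^sup>2) \<le> \<delta> / (4 * r) * (2 * (r * \<bar>u\<bar>))"
    using \<delta> r by (intro mult_left_mono) auto
  also have "\<dots> = \<delta> / 2 * \<bar>u\<bar>" using r by simp
  finally have "\<delta> / (4 * r) * (2 * u\<^sup>2 - r\<^sup>2) \<le> \<delta> / 2 * \<bar>u\<bar> - \<delta> * r / 4"
    using r by (simp add: right_diff_distrib power2_eq_square)
  \<comment> \<open>As \<open>\<bar>u\<bar> \<le> r\<close>, the quadratic term costs at most
    \<open>\<delta> * \<bar>u\<bar> / 2\<close> and always gains \<open>\<delta> * r / 4\<close>. So
    the slope of the majorant is 1 on the right and \<open>1 - \<delta>\<close> on the left,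
    matching the decay of the tail and of the truncated sum.\<close>
  hence W: "W \<le> u - \<delta> * u / 2 + \<delta> * \<bar>u\<bar> / 2 - \<delta> * r / 4" by (simp add: W_def algebra_simps)
  have Wpos: "W \<le> u - \<delta> * r / 4" if "u \<ge> 0" using W that by simp
  have Wneg: "W \<le> u - \<delta> * u - \<delta> * r / 4" if "u \<le> 0" using W that by simp
  have dr: "\<delta> * r \<ge> 0" using \<delta> r by simp
  {
    assume "u \<ge> \<tau> + 2 * e"
    thus "\<theta> + 2 * e - \<sigma> + W \<le> - (\<delta> * r / 8)" using Wpos e u by simp
  next
    assume lt: "u < \<tau> + 2 * e"
    have du: "\<delta> * u \<le> \<tau> + 2 * e" if "u \<ge> 0"
      using lt that \<delta>1 mult_right_mono[of \<delta> 1 u] by linarith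
    have dun: "\<delta> * u \<ge> u" if "u \<le> 0" using that \<delta>1 mult_right_mono_neg[of \<delta> 1 u] by simp
    have dul: "\<delta> * u \<ge> - (\<delta> * r)" using u(1) \<delta> mult_left_mono[of "-r" u \<delta>] by simp
    have dt: "\<delta> * (\<tau> + 3 * e) \<ge> 0" using \<delta> e by simp
    show "W \<le> - (\<delta> * r / 8)"
      by (cases "u \<ge> 0") (use Wpos Wneg lt e dun dr in linarith)+
    have "(1 - \<delta>) * (\<theta> + 3 * e - \<sigma>) = \<tau> + 3 * e - u - \<delta> * (\<tau> + 3 * e) + \<delta> * u"
    proof -
      have "\<theta> + 3 * e - \<sigma> = \<tau> - u + 3 * e" using u by simp
      hence "(1 - \<delta>) * (\<theta> + 3 * e - \<sigma>) = (1 - \<delta>) * (\<tau> - u + 3 * e)" by (simp only:)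
      also have "\<dots> = \<tau> + 3 * e - u - \<delta> * (\<tau> + 3 * e) + \<delta> * u" by (simp add: algebra_simps)
      finally show ?thesis .
    qed
    thus "(1 - \<delta>) * (\<theta> + 3 * e - \<sigma>) + W \<le> - (\<delta> * r / 8)"
      by (cases "u \<ge> 0") (use Wpos Wneg e dt du in linarith)+
    \<comment> \<open>Beginning the average already at \<open>N powr (1 - \<delta>)\<close> costs at
      most \<open>3 * \<delta> \<le> \<epsilon> / 2\<close> in the exponent; this is the origin of
      the condition \<open>\<delta> \<le> \<epsilon> / 6\<close>.\<close>
    have "\<delta> * (\<sigma> + 1) \<le> \<delta> * 3" using \<delta> u r \<beta> by (intro mult_left_mono) auto
    moreover have "1 + \<theta> - \<epsilon> - (1 - \<delta>) * (\<sigma> + 1) = \<tau> - u - \<epsilon> + \<delta> * (\<sigma> + 1)"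
      using u by (simp add: algebra_simps)
    moreover have "\<delta> * r \<le> \<delta> * (1 / 4)" using r \<delta> by (intro mult_left_mono) auto
    ultimately show "1 + \<theta> - \<epsilon> - (1 - \<delta>) * (\<sigma> + 1) + W \<le> - (\<delta> * r / 8)"
      by (cases "u \<ge> 0") (use Wpos Wneg e dul \<delta> in linarith)+
  }
qed

lemma sum_Mn_lower_aux:
  assumes \<theta>: "0 < \<theta>" "\<theta> \<le> 1" and nz: "\<And>s. Re s > \<theta> \<Longrightarrow> zeta1 s \<noteq> 0"
    and zeros: "\<And>\<tau>. \<tau> > 0 \<Longrightarrow> \<exists>s. zeta1 s = 0 \<and> Re s > \<theta> - \<tau>"
    and \<delta>: "0 < \<delta>" "\<delta> \<le> \<epsilon> / 6" "\<epsilon> \<le> 1"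
  shows "\<forall>\<^sub>F N in sequentially. (\<Sum>n | 1 \<le> n \<and> n < N \<and> real N powr (1 - \<delta>) \<le> real n. real_of_int \<bar>Mn n\<bar>) \<ge> real N powr (1 + \<theta> - \<epsilon>)"
proof -
  \<comment> \<open>Small enough for the circle around \<open>\<rho>\<close> to stay in
    \<open>Re s > 0\<close>, where the term bounds for \<open>abel_sum\<close> apply.\<close>
  define r where "r = \<theta> / 4"
  have r: "0 < r" "r \<le> 1 / 4" using \<theta> by (auto simp: r_def)
  \<comment> \<open>With \<open>\<rho>\<close> within \<open>\<delta> * r / 100\<close> of the
    supremum this makes all losses, \<open>2 * \<tau> + 5 * e\<close>, smaller than half the gain
    \<open>\<delta> * r / 4\<close> from the quadratic term.\<close>
  define e where "e = \<delta> * r / 200"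
  have e: "e > 0" using \<delta> r by (simp add: e_def)
  have dr: "\<delta> * r > 0" "\<delta> * r \<le> r" using \<delta> r by (auto intro!: mult_left_le_one_le)
  obtain \<rho> where \<rho>: "zeta1 \<rho> = 0" "Re \<rho> > \<theta> - \<delta> * r / 100"
    using zeros[of "\<delta> * r / 100"] dr by auto
  define \<beta> where "\<beta> = Re \<rho>"
  define \<tau> where "\<tau> = \<theta> - \<beta>"
  have \<beta>\<theta>: "\<beta> \<le> \<theta>" using nz[of \<rho>] \<rho> by (force simp: \<beta>_def)
  have \<tau>: "\<tau> \<ge> 0" "2 * \<tau> + 5 * e \<le> \<delta> * r / 8" using \<beta>\<theta> \<rho>(2) dr by (auto simp: \<tau>_def \<beta>_def e_def)
  have \<rho>1: "\<rho> \<noteq> 1" using \<rho> by auto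
  obtain C where C: "C > 0" "\<And>n. n \<ge> 1 \<Longrightarrow> real_of_int \<bar>Mn n\<bar> \<le> C * real n powr (\<theta> + e)"
    using Mn_bound[of \<theta> e] nz e \<theta> by (metis less_imp_le)
  have "bounded (zeta1 ` cball \<rho> r)"
    by (intro compact_imp_bounded compact_continuous_image zeta1_continuous) auto
  then obtain B1 where B1: "\<And>s. s \<in> cball \<rho> r \<Longrightarrow> norm (zeta1 s) \<le> B1" unfolding bounded_iff by blast
  have B10: "B1 \<ge> 0" using B1[of \<rho>] r by (auto intro: order_trans[OF norm_ge_zero])
  define B2 where "B2 = norm \<rho> + 2"
  have B2: "norm s \<le> B2" "norm (s - 1) \<le> B2" if "s \<in> cball \<rho> r" for s
  proof -
    have "norm (s - \<rho>) \<le> 1" using that r by (simp add: dist_norm norm_minus_commute)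
    thus "norm s \<le> B2" using norm_triangle_ineq[of "s - \<rho>" \<rho>] by (simp add: B2_def)
    thus "norm (s - 1) \<le> B2" using norm_triangle_ineq4[of s 1] norm_triangle_ineq[of "s - \<rho>" \<rho>] \<open>norm (s - \<rho>) \<le> 1\<close> by (simp add: B2_def)
  qed
  have B20: "B2 \<ge> 0" by (simp add: B2_def)
  define Z where "Z = (\<Sum>n. real (Suc n) powr (- (1 + e)))"
  have Zs: "summable (\<lambda>n. real (Suc n) powr (- (1 + e)))" using summable_Suc_powr[of "1 + e" 1] e by simp
  have Zle: "(\<Sum>n\<in>A. real n powr (- (1 + e))) \<le> Z" if "finite A" "0 \<notin> A" for A
  proof -
    have A: "Suc (n - Suc 0) = n" if "n \<in> A" for n using that \<open>0 \<notin> A\<close> by (cases n) auto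
    have "(\<Sum>n\<in>A. real n powr (- (1 + e))) = (\<Sum>n\<in>(\<lambda>n. n - 1) ` A. real (Suc n) powr (- (1 + e)))"
      by (rule sum.reindex_bij_witness[of _ Suc "\<lambda>n. n - 1"]) (auto simp: A simp del: of_nat_Suc)
    also have "\<dots> \<le> Z" unfolding Z_def by (rule sum_le_suminf[OF Zs]) (use that in auto)
    finally show ?thesis .
  qed
  have Z0: "Z \<ge> 0" using Zle[of "{}"] by simp
  define K where "K = B2 + B1 * (C * B2 * Z) + B1 * B2"
  have main: "norm (\<rho> - 1) \<le> K * real N powr (- (\<delta> * r / 8))"
    if N: "N \<ge> 2" and small: "(\<Sum>n | 1 \<le> n \<and> n < N \<and> real N powr (1 - \<delta>) \<le> real n. real_of_int \<bar>Mn n\<bar>) < real N powr (1 + \<theta> - \<epsilon>)" for N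
  proof -
    \<comment> \<open>The tail beyond \<open>N\<close> behaves like \<open>N powr (- u)\<close> and
      the sum up to \<open>N powr (1 - \<delta>)\<close> like
      \<open>N powr (- (1 - \<delta>) * u)\<close>, so the linear slope of \<open>\<Phi>\<close> is
      taken midway at \<open>1 - \<delta> / 2\<close>. The coefficient \<open>a\<close> is such that
      at \<open>u = r\<close> and at \<open>u = - r\<close> both terms together still leave the gain
      \<open>\<delta> * r / 4\<close>.\<close>
    define a where "a = \<delta> / (4 * r)"
    define \<Phi> where "\<Phi> = (\<lambda>s. cp (real N) (of_real (1 - \<delta> / 2) * (s - \<rho>) + of_real a * (s - \<rho>)\<^sup>2))"
    define H where "H = (\<lambda>s. (s - 1) - zeta1 s * abel_sum N s)"
    define p where "p = - (\<delta> * r / 8)"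
    have hol: "(\<lambda>s. H s * \<Phi> s) holomorphic_on UNIV"
      unfolding H_def \<Phi>_def abel_sum_def cp_def by (intro holomorphic_intros) auto
    have "norm (H \<rho> * \<Phi> \<rho>) \<le> K * real N powr p"
    proof (rule maximum_modulus_frontier[where f = "\<lambda>s. H s * \<Phi> s" and S = "cball \<rho> r" and \<xi> = \<rho>])
      show "(\<lambda>s. H s * \<Phi> s) holomorphic_on interior (cball \<rho> r)" "continuous_on (closure (cball \<rho> r)) (\<lambda>s. H s * \<Phi> s)"
        using holomorphic_on_subset[OF hol] holomorphic_on_imp_continuous_on by blast+
      fix s assume "s \<in> frontier (cball \<rho> r)"
      hence sr: "norm (s - \<rho>) = r" using r by (simp add: frontier_cball dist_norm norm_minus_commute)
      hence sb: "s \<in> cball \<rho> r" by (simp add: dist_norm norm_minus_commute)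
      define \<sigma> where "\<sigma> = Re s"
      define u where "u = \<sigma> - \<beta>"
      have u: "\<bar>u\<bar> \<le> r" using abs_Re_le_cmod[of "s - \<rho>"] sr by (simp add: u_def \<sigma>_def \<beta>_def)
      have \<sigma>0: "\<sigma> > 0"
      proof -
        have "- u \<le> r" using abs_ge_minus_self[of u] u by linarith
        moreover have "\<sigma> = u + \<beta>" "\<beta> > \<theta> - \<delta> * r / 100" "\<theta> = 4 * r"
          using \<rho>(2) by (auto simp: u_def \<beta>_def r_def)
        ultimately show ?thesis using dr r by linarith
      qed
      define W where "W = (1 - \<delta> / 2) * u + \<delta> / (4 * r) * (2 * u\<^sup>2 - r\<^sup>2)"
      have \<Phi>: "norm (\<Phi> s) = real N powr W"
      proof -
        have "(Re (s - \<rho>))\<^sup>2 + (Im (s - \<rho>))\<^sup>2 = r\<^sup>2" using sr by (metis cmod_power2)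
        hence "Re ((s - \<rho>)\<^sup>2) = 2 * u\<^sup>2 - r\<^sup>2" by (simp add: Re_power2 u_def \<sigma>_def \<beta>_def)
        moreover have "Re (of_real (1 - \<delta> / 2) * (s - \<rho>)) = (1 - \<delta> / 2) * u" by (simp add: u_def \<sigma>_def \<beta>_def del: of_real_diff)
        moreover have "Re (of_real a * (s - \<rho>)\<^sup>2) = a * Re ((s - \<rho>)\<^sup>2)" by simp
        ultimately show ?thesis unfolding \<Phi>_def using N by (subst norm_cp) (auto simp: W_def a_def)
      qed
      have exps: "u \<ge> \<tau> + 2 * e \<Longrightarrow> \<theta> + 2 * e - \<sigma> + W \<le> p"
        "u < \<tau> + 2 * e \<Longrightarrow> W \<le> p"
        "u < \<tau> + 2 * e \<Longrightarrow> (1 - \<delta>) * (\<theta> + 3 * e - \<sigma>) + W \<le> p"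
        "u < \<tau> + 2 * e \<Longrightarrow> 1 + \<theta> - \<epsilon> - (1 - \<delta>) * (\<sigma> + 1) + W \<le> p"
        unfolding W_def p_def
        by (rule exponent_bounds[OF u u_def \<tau>_def r \<delta> e \<tau>]; use \<beta>\<theta> \<theta> in simp)+
      have powN: "real N powr x * real N powr W \<le> real N powr p" if "x + W \<le> p" for x
        using that N by (simp flip: powr_add)
      show "norm (H s * \<Phi> s) \<le> K * real N powr p"
      proof (cases "u \<ge> \<tau> + 2 * e")
        case True
        hence \<sigma>\<theta>: "\<sigma> \<ge> \<theta> + 2 * e" by (simp add: u_def \<tau>_def)
        \<comment> \<open>On this part of the circle the full series is available, so
          \<open>H s\<close> is \<open>zeta1 s\<close> times its tail from
          \<open>n = N\<close>.\<close>
        obtain B where B: "(\<lambda>n. of_int (Mn (Suc n)) * (npow (Suc n) s - npow (Suc (Suc n)) s)) sums B" "zeta1 s * B = s - 1"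
          using abel_series[of \<theta> s] \<theta> nz \<sigma>\<theta> e by (auto simp: \<sigma>_def)
        have "(\<lambda>n. of_int (Mn (Suc (n + (N - 1)))) * (npow (Suc (n + (N - 1))) s - npow (Suc (Suc (n + (N - 1)))) s)) sums
            (B - (\<Sum>n<N - 1. of_int (Mn (Suc n)) * (npow (Suc n) s - npow (Suc (Suc n)) s)))"
          by (rule sums_split_initial_segment[OF B(1)])
        also have "(\<Sum>n<N - 1. of_int (Mn (Suc n)) * (npow (Suc n) s - npow (Suc (Suc n)) s)) = abel_sum N s"
          unfolding abel_sum_def by (rule sum.reindex_bij_witness[of _ "\<lambda>n. n - 1" Suc]) auto
        finally have tail: "(\<lambda>n. of_int (Mn (Suc (n + (N - 1)))) * (npow (Suc (n + (N - 1))) s - npow (Suc (Suc (n + (N - 1)))) s)) sums (B - abel_sum N s)" .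
        \<comment> \<open>The power of \<open>k\<close> is split so that one factor has the
          nonpositive exponent \<open>\<theta> + 2 * e - \<sigma>\<close> and is largest at
          \<open>k = N\<close>, while the other, \<open>k powr (- (1 + e))\<close>, is
          summable.\<close>
        define c where "c = C * B2 * real N powr (\<theta> + 2 * e - \<sigma>)"
        have tb: "norm (of_int (Mn (Suc (n + (N - 1)))) * (npow (Suc (n + (N - 1))) s - npow (Suc (Suc (n + (N - 1)))) s)) \<le> 
            c * real (Suc n) powr (- (1 + e))" for n
        proof -
          define k where "k = Suc (n + (N - 1))"
          have k: "real k \<ge> real N" "real k \<ge> real (Suc n)" using N by (auto simp: k_def)
          have "norm (of_int (Mn k) * (npow k s - npow (Suc k) s)) \<le> C * norm s * real k powr (\<theta> + e - \<sigma> - 1)"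
            unfolding \<sigma>_def by (rule abel_sum_term_bound[OF C(2)]) (use \<sigma>0 in \<open>auto simp: k_def \<sigma>_def\<close>)
          also have "real k powr (\<theta> + e - \<sigma> - 1) = real k powr (\<theta> + 2 * e - \<sigma>) * real k powr (- (1 + e))"
          proof -
            have "\<theta> + e - \<sigma> - 1 = (\<theta> + 2 * e - \<sigma>) + (- (1 + e))" by simp
            thus ?thesis by (simp only: powr_add)
          qed
          also have "C * norm s * (real k powr (\<theta> + 2 * e - \<sigma>) * real k powr (- (1 + e))) \<le> 
              C * B2 * (real N powr (\<theta> + 2 * e - \<sigma>) * real (Suc n) powr (- (1 + e)))"
            using C(1) B2(1)[OF sb] B20 k N e \<sigma>\<theta> by (intro mult_mono powr_mono2' mult_nonneg_nonneg) auto
          finally show ?thesis by (simp add: k_def c_def mult_ac)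
        qed
        have "norm (B - abel_sum N s) \<le> (\<Sum>n. c * real (Suc n) powr (- (1 + e)))"
          using norm_suminf_le[OF tb summable_mult[OF Zs]] tail by (simp add: sums_iff)
        also have "\<dots> = c * Z" unfolding Z_def by (rule suminf_mult[OF Zs])
        finally have BA: "norm (B - abel_sum N s) \<le> c * Z" .
        have "H s = zeta1 s * (B - abel_sum N s)" using B(2) by (simp add: H_def algebra_simps)
        hence "norm (H s) \<le> B1 * (c * Z)"
          using B1[OF sb] BA B10 by (simp add: norm_mult mult_mono)
        hence "norm (H s * \<Phi> s) \<le> B1 * (c * Z) * real N powr W"
          unfolding norm_mult \<Phi> by (intro mult_right_mono) auto
        also have "\<dots> = B1 * (C * B2 * Z) * (real N powr (\<theta> + 2 * e - \<sigma>) * real N powr W)"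
          by (simp add: c_def mult_ac)
        also have "\<dots> \<le> B1 * (C * B2 * Z) * real N powr p"
          using powN[OF exps(1)[OF True]] B10 C Z0 B20 by (intro mult_left_mono) auto
        also have "\<dots> \<le> K * real N powr p"
          using B10 B20 by (intro mult_right_mono) (auto simp: K_def)
        finally show ?thesis .
      next
        case False
        hence lt: "u < \<tau> + 2 * e" by simp
        hence \<sigma>\<theta>: "\<sigma> < \<theta> + 2 * e" by (simp add: u_def \<tau>_def)
        \<comment> \<open>The sum is cut at \<open>Y\<close>: below it the pointwise bound for
          \<open>M\<close> is used, above it the assumed small sum of
          \<open>\<bar>M\<bar>\<close>.\<close>
        define Y where "Y = real N powr (1 - \<delta>)"
        have Y: "Y > 0" using N by (simp add: Y_def)
        define I where "I = {n. 1 \<le> n \<and> n < N \<and> Y \<le> real n}"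
        define J where "J = {n. 1 \<le> n \<and> n < N \<and> real n < Y}"
        have IJ: "{1..<N} = I \<union> J" "I \<inter> J = {}" "finite I" "finite J" "0 \<notin> J" by (auto simp: I_def J_def)
        have "norm (\<Sum>n\<in>J. of_int (Mn n) * (npow n s - npow (Suc n) s)) \<le> (\<Sum>n\<in>J. C * B2 * Y powr (\<theta> + 3 * e - \<sigma>) * real n powr (- (1 + e)))"
        proof (rule sum_norm_le)
          fix n assume n: "n \<in> J"
          have "norm (of_int (Mn n) * (npow n s - npow (Suc n) s)) \<le> C * norm s * real n powr (\<theta> + e - \<sigma> - 1)"
            unfolding \<sigma>_def by (rule abel_sum_term_bound[OF C(2)]) (use \<sigma>0 n in \<open>auto simp: J_def \<sigma>_def\<close>)
          also have "\<dots> \<le> C * norm s * (real n powr (\<theta> + 3 * e - \<sigma>) * real n powr (- (1 + e)))"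
            using n C e by (intro mult_left_mono) (auto simp: J_def simp flip: powr_add intro!: powr_mono)
          also have "\<dots> \<le> C * B2 * (Y powr (\<theta> + 3 * e - \<sigma>) * real n powr (- (1 + e)))"
          proof (rule mult_mono[OF mult_left_mono[OF B2(1)[OF sb]] mult_right_mono])
            show "real n powr (\<theta> + 3 * e - \<sigma>) \<le> Y powr (\<theta> + 3 * e - \<sigma>)"
              using n \<sigma>\<theta> e by (intro powr_mono2) (auto simp: J_def)
          qed (use C(1) B20 in auto)
          finally show "norm (of_int (Mn n) * (npow n s - npow (Suc n) s)) \<le> C * B2 * Y powr (\<theta> + 3 * e - \<sigma>) * real n powr (- (1 + e))"
            by (simp add: mult_ac)
        qed
        also have "\<dots> = C * B2 * Y powr (\<theta> + 3 * e - \<sigma>) * (\<Sum>n\<in>J. real n powr (- (1 + e)))"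
          by (simp add: sum_distrib_left)
        also have "\<dots> \<le> C * B2 * Y powr (\<theta> + 3 * e - \<sigma>) * Z"
          using C B20 by (intro mult_left_mono Zle IJ) auto
        also have "Y powr (\<theta> + 3 * e - \<sigma>) = real N powr ((1 - \<delta>) * (\<theta> + 3 * e - \<sigma>))" by (simp add: Y_def powr_powr)
        finally have SJ: "norm (\<Sum>n\<in>J. of_int (Mn n) * (npow n s - npow (Suc n) s)) \<le> C * B2 * Z * real N powr ((1 - \<delta>) * (\<theta> + 3 * e - \<sigma>))"
          by (simp add: mult_ac)
        have "norm (\<Sum>n\<in>I. of_int (Mn n) * (npow n s - npow (Suc n) s)) \<le> (\<Sum>n\<in>I. real_of_int \<bar>Mn n\<bar> * (B2 * Y powr (- \<sigma> - 1)))"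
        proof (rule sum_norm_le)
          fix n assume n: "n \<in> I"
          have "norm (npow n s - npow (Suc n) s) \<le> norm s * real n powr (- \<sigma> - 1)"
            unfolding \<sigma>_def by (rule npow_diff_bound) (use n \<sigma>0 in \<open>auto simp: I_def \<sigma>_def\<close>)
          also have "\<dots> \<le> B2 * Y powr (- \<sigma> - 1)"
            using B2(1)[OF sb] n Y \<sigma>0 B20 by (intro mult_mono powr_mono2') (auto simp: I_def)
          finally show "norm (of_int (Mn n) * (npow n s - npow (Suc n) s)) \<le> real_of_int \<bar>Mn n\<bar> * (B2 * Y powr (- \<sigma> - 1))"
            by (simp add: norm_mult mult_left_mono)
        qed
        also have "\<dots> = (B2 * Y powr (- \<sigma> - 1)) * (\<Sum>n\<in>I. real_of_int \<bar>Mn n\<bar>)"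
          by (simp add: sum_distrib_left mult_ac)
        also have "\<dots> \<le> (B2 * Y powr (- \<sigma> - 1)) * real N powr (1 + \<theta> - \<epsilon>)"
          using small B20 by (intro mult_left_mono) (auto simp: I_def Y_def)
        also have "Y powr (- \<sigma> - 1) = real N powr (- ((1 - \<delta>) * (\<sigma> + 1)))" by (simp add: Y_def powr_powr algebra_simps)
        also have "B2 * real N powr (- ((1 - \<delta>) * (\<sigma> + 1))) * real N powr (1 + \<theta> - \<epsilon>) = B2 * real N powr (1 + \<theta> - \<epsilon> - (1 - \<delta>) * (\<sigma> + 1))"
          by (simp add: mult.assoc algebra_simps flip: powr_add)
        finally have SI: "norm (\<Sum>n\<in>I. of_int (Mn n) * (npow n s - npow (Suc n) s)) \<le> B2 * real N powr (1 + \<theta> - \<epsilon> - (1 - \<delta>) * (\<sigma> + 1))" .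
        define x1 where "x1 = real N powr ((1 - \<delta>) * (\<theta> + 3 * e - \<sigma>))"
        define x2 where "x2 = real N powr (1 + \<theta> - \<epsilon> - (1 - \<delta>) * (\<sigma> + 1))"
        have "abel_sum N s = (\<Sum>n\<in>I. of_int (Mn n) * (npow n s - npow (Suc n) s)) + (\<Sum>n\<in>J. of_int (Mn n) * (npow n s - npow (Suc n) s))"
          unfolding abel_sum_def IJ(1) using IJ by (intro sum.union_disjoint) auto
        hence as: "norm (abel_sum N s) \<le> B2 * x2 + C * B2 * Z * x1"
          using SI SJ unfolding x1_def x2_def by (auto intro: norm_triangle_mono)
        have "norm (H s) \<le> norm (s - 1) + norm (zeta1 s) * norm (abel_sum N s)"
          unfolding H_def norm_mult[symmetric] by (rule norm_triangle_ineq4)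
        also have "\<dots> \<le> B2 + B1 * (B2 * x2 + C * B2 * Z * x1)"
          using B2(2)[OF sb] B1[OF sb] as B10 by (intro add_mono mult_mono) auto
        finally have "norm (H s * \<Phi> s) \<le> (B2 + B1 * (B2 * x2 + C * B2 * Z * x1)) * real N powr W"
          unfolding norm_mult \<Phi> by (intro mult_right_mono) auto
        also have "\<dots> = B2 * real N powr W + B1 * B2 * (x2 * real N powr W) + B1 * (C * B2 * Z) * (x1 * real N powr W)"
          by (simp add: algebra_simps)
        also have "\<dots> \<le> B2 * real N powr p + B1 * B2 * real N powr p + B1 * (C * B2 * Z) * real N powr p"
        proof (intro add_mono mult_left_mono)
          show "real N powr W \<le> real N powr p" using exps(2)[OF lt] N by simp
          show "x2 * real N powr W \<le> real N powr p" unfolding x2_def by (rule powN[OF exps(4)[OF lt]])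
          show "x1 * real N powr W \<le> real N powr p" unfolding x1_def by (rule powN[OF exps(3)[OF lt]])
        qed (use B10 B20 C Z0 in auto)
        also have "\<dots> = K * real N powr p" by (simp add: K_def algebra_simps)
        finally show ?thesis .
      qed
    qed (use r in auto)
    moreover have "H \<rho> * \<Phi> \<rho> = \<rho> - 1" by (simp add: H_def \<Phi>_def cp_def \<rho>(1))
    ultimately show ?thesis by (simp add: p_def)
  qed
  have "((\<lambda>N. K * real N powr (- (\<delta> * r / 8))) \<longlonglongrightarrow> K * 0)"
    using dr by (intro tendsto_intros tendsto_neg_powr filterlim_real_sequentially) auto
  moreover have "norm (\<rho> - 1) > K * 0" using \<rho>1 by simp
  ultimately have "\<forall>\<^sub>F N in sequentially. K * real N powr (- (\<delta> * r / 8)) < norm (\<rho> - 1)"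
    by (rule order_tendstoD)
  thus ?thesis using eventually_ge_at_top[of 2]
    by eventually_elim (use main in \<open>force simp: not_less[symmetric]\<close>)
qed

text \<open>Decreasing \<open>\<epsilon>\<close> raises the lower bound and decreasing
  \<open>\<delta>\<close> shortens the range of summation. Both strengthen the claim, so the
  parameters may be lowered until the auxiliary conditions hold.\<close>

lemma sum_Mn_lower:
  assumes \<theta>: "0 < \<theta>" "\<theta> \<le> 1" and nz: "\<And>s. Re s > \<theta> \<Longrightarrow> zeta1 s \<noteq> 0"
    and zeros: "\<And>\<tau>. \<tau> > 0 \<Longrightarrow> \<exists>s. zeta1 s = 0 \<and> Re s > \<theta> - \<tau>"
    and \<delta>: "0 < \<delta>" and \<epsilon>: "0 < \<epsilon>"
  shows "\<forall>\<^sub>F N in sequentially. (\<Sum>n | 1 \<le> n \<and> n < N \<and> real N powr (1 - \<delta>) \<le> real n. real_of_int \<bar>Mn n\<bar>) \<ge> real N powr (1 + \<theta> - \<epsilon>)"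
proof -
  define \<epsilon>' where "\<epsilon>' = min \<epsilon> 1"
  define \<delta>' where "\<delta>' = min \<delta> (\<epsilon>' / 6)"
  have "\<forall>\<^sub>F N in sequentially. (\<Sum>n | 1 \<le> n \<and> n < N \<and> real N powr (1 - \<delta>') \<le> real n. real_of_int \<bar>Mn n\<bar>) \<ge> real N powr (1 + \<theta> - \<epsilon>')"
    by (rule sum_Mn_lower_aux[OF \<theta> nz zeros]) (use \<delta> \<epsilon> in \<open>auto simp: \<delta>'_def \<epsilon>'_def\<close>)
  thus ?thesis using eventually_ge_at_top[of 1]
  proof eventually_elim
    case (elim N)
    have 1: "real N powr (1 + \<theta> - \<epsilon>) \<le> real N powr (1 + \<theta> - \<epsilon>')" using elim by (intro powr_mono) (auto simp: \<epsilon>'_def)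
    have le: "real N powr (1 - \<delta>) \<le> real N powr (1 - \<delta>')" using elim by (intro powr_mono) (auto simp: \<delta>'_def)
    have "(\<Sum>n | 1 \<le> n \<and> n < N \<and> real N powr (1 - \<delta>') \<le> real n. real_of_int \<bar>Mn n\<bar>) \<le> 
      (\<Sum>n | 1 \<le> n \<and> n < N \<and> real N powr (1 - \<delta>) \<le> real n. real_of_int \<bar>Mn n\<bar>)"
      by (rule sum_mono2) (auto intro: order_trans[OF le])
    with elim(1) 1 show ?case by linarith
  qed
qed

section \<open>Counting zeros\<close>

text \<open>Zeros are divided out one at a time, always with the order of \<open>f\<close> itself.
  Near \<open>a\<close> the factors belonging to the other zeros do not vanish, so the quotient
  equals \<open>zor_poly f a / P\<close> there and the singularity is removable.\<close>

lemma factor_zeros: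
  assumes hol: "f holomorphic_on ball c R" and fc: "f c \<noteq> 0" and A: "finite A" "A \<subseteq> ball c R" "\<And>a. a \<in> A \<Longrightarrow> f a = 0"
  shows "\<exists>g. g holomorphic_on ball c R \<and> (\<forall>z\<in>ball c R. f z = g z * (\<Prod>a\<in>A. (z - a) ^ nat (zorder f a)))"
  using A
proof (induction A rule: finite_induct)
  case empty
  thus ?case using hol by auto
next
  case (insert a A)
  obtain g where g: "g holomorphic_on ball c R" "\<And>z. z \<in> ball c R \<Longrightarrow> f z = g z * (\<Prod>a\<in>A. (z - a) ^ nat (zorder f a))"
    using insert by auto
  define P where "P = (\<lambda>z. \<Prod>a\<in>A. (z - a) ^ nat (zorder f a))"
  define n where "n = nat (zorder f a)"
  have a: "a \<in> ball c R" "f a = 0" using insert by auto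
  have "R > 0" using a(1) by (auto intro: le_less_trans[OF zero_le_dist])
  hence "\<exists>w\<in>ball c R. f w \<noteq> 0" using fc by (intro bexI[of _ c]) auto
  from zorder_exist_zero[OF hol _ _ a(1) this] a(2) obtain \<rho> where n0: "zorder f a > 0" and \<rho>: "\<rho> > 0" 
    "cball a \<rho> \<subseteq> ball c R" "zor_poly f a holomorphic_on cball a \<rho>" "\<And>w. w \<in> cball a \<rho> \<Longrightarrow> f w = zor_poly f a w * (w - a) ^ n"
    by (auto simp: n_def)
  have n: "n > 0" using n0 by (simp add: n_def)
  have Pa: "P a \<noteq> 0" using insert by (auto simp: P_def)
  have "continuous_on UNIV P" unfolding P_def by (intro continuous_intros)
  hence Plim: "(P \<longlongrightarrow> P a) (at a)" by (simp add: continuous_on_def)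
  have "continuous_on (cball a \<rho>) (zor_poly f a)" using \<rho>(3) by (rule holomorphic_on_imp_continuous_on)
  hence "continuous (at a) (zor_poly f a)" using \<rho>(1) by (intro continuous_on_interior) auto
  hence hlim: "(zor_poly f a \<longlongrightarrow> zor_poly f a a) (at a)" by (simp add: isCont_def)
  have "((\<lambda>z. (z - a) * (zor_poly f a z / P z)) \<longlongrightarrow> (a - a) * (zor_poly f a a / P a)) (at a)"
    by (intro tendsto_intros hlim Plim Pa)
  hence lim: "((\<lambda>z. (z - a) * (zor_poly f a z / P z)) \<longlongrightarrow> 0) (at a)" by simp
  have "\<exists>G. G holomorphic_on ball c R \<and> (\<forall>z\<in>ball c R - {a}. G z = g z / (z - a) ^ n)"
  proof (subst holomorphic_on_extend_lim)
    show "(\<lambda>z. g z / (z - a) ^ n) holomorphic_on ball c R - {a}"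
      by (intro holomorphic_intros holomorphic_on_subset[OF g(1)]) auto
    show "a \<in> interior (ball c R)" using a by simp
    have "eventually (\<lambda>z. P z \<noteq> 0) (at a)" using tendsto_imp_eventually_ne[OF Plim Pa] .
    moreover have "eventually (\<lambda>z. z \<in> cball a \<rho> \<and> z \<noteq> a) (at a)"
      using \<rho>(1) by (auto simp: eventually_at dist_commute intro!: exI[of _ \<rho>])
    ultimately have "eventually (\<lambda>z. (z - a) * (zor_poly f a z / P z) = (z - a) * (g z / (z - a) ^ n)) (at a)"
    proof eventually_elim
      case (elim z)
      hence "g z * P z = zor_poly f a z * (z - a) ^ n" using g(2)[of z] \<rho>(2,4) by (auto simp: P_def)
      thus ?case using elim by (simp add: field_simps)
    qed
    from Lim_transform_eventually[OF lim this] show "((\<lambda>z. (z - a) * (g z / (z - a) ^ n)) \<longlongrightarrow> 0) (at a)" .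
  qed
  then obtain G where G: "G holomorphic_on ball c R" "\<And>z. z \<in> ball c R - {a} \<Longrightarrow> G z = g z / (z - a) ^ n" by blast
  have "f z = G z * (\<Prod>a\<in>insert a A. (z - a) ^ nat (zorder f a))" if z: "z \<in> ball c R" for z
  proof (cases "z = a")
    case True
    thus ?thesis using a(2) n insert by (simp add: n_def)
  next
    case False
    thus ?thesis using G(2)[of z] g(2)[OF z] z insert by (simp add: n_def[symmetric])
  qed
  thus ?case using G(1) by blast
qed

text \<open>Each factor \<open>z - a\<close> is replaced by
  \<open>(R^2 - cnj (a - c) * (z - c)) / R\<close>, which has the same modulus on the circle of
  radius \<open>R\<close>. The maximum principle bounds the new function at the centre, where every
  factor has grown from at most \<open>r\<close> to exactly \<open>R\<close>.\<close>

lemma jensen_zero_count: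
  assumes hol: "f holomorphic_on ball c R'" and R: "0 < r" "r < R" "R < R'" and fc: "f c \<noteq> 0"
    and B: "\<And>z. dist c z = R \<Longrightarrow> norm (f z) \<le> B" and A: "finite A" "A \<subseteq> cball c r" "\<And>a. a \<in> A \<Longrightarrow> f a = 0"
  shows "(\<Sum>a\<in>A. real_of_int (zorder f a)) * ln (R / r) \<le> ln (B / norm (f c))"
proof -
  define n where "n = (\<lambda>a. nat (zorder f a))"
  have AR: "A \<subseteq> ball c R'" using A(2) R by force
  obtain g where g: "g holomorphic_on ball c R'" "\<And>z. z \<in> ball c R' \<Longrightarrow> f z = g z * (\<Prod>a\<in>A. (z - a) ^ n a)"
    using factor_zeros[OF hol fc A(1) AR A(3)] unfolding n_def by blast
  define G where "G = (\<lambda>z. g z * (\<Prod>a\<in>A. ((of_real (R\<^sup>2) - cnj (a - c) * (z - c)) / of_real R) ^ n a))"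
  have GB: "norm (G c) \<le> B"
  proof (rule maximum_modulus_frontier[where f = G and S = "cball c R"])
    have "G holomorphic_on ball c R'"
      unfolding G_def by (intro holomorphic_intros g) (use R in auto)
    thus "G holomorphic_on interior (cball c R)" "continuous_on (closure (cball c R)) G"
      using R by (auto intro!: holomorphic_on_imp_continuous_on elim!: holomorphic_on_subset)
    fix z assume "z \<in> frontier (cball c R)"
    hence z: "dist c z = R" using R by (simp add: frontier_cball)
    have eq: "norm ((of_real (R\<^sup>2) - cnj (a - c) * (z - c)) / of_real R) = norm (z - a)" for a
    proof -
      have "complex_of_real (R\<^sup>2) = (z - c) * cnj (z - c)"
        using z complex_norm_square[of "z - c"] by (simp add: dist_norm norm_minus_commute)
      hence "of_real (R\<^sup>2) - cnj (a - c) * (z - c) = (z - c) * cnj (z - a)"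
        by (simp only: complex_cnj_diff) (simp add: algebra_simps)
      hence "norm (of_real (R\<^sup>2) - cnj (a - c) * (z - c)) = R * norm (z - a)"
        using z by (simp only: norm_mult complex_mod_cnj dist_norm norm_minus_commute)
      thus ?thesis using R by (simp add: norm_divide)
    qed
    have zb: "z \<in> ball c R'" using z R by simp
    have "norm (G z) = norm (f z)"
      by (simp only: G_def norm_mult prod_norm[symmetric] norm_power eq g(2)[OF zb])
    thus "norm (G z) \<le> B" using B[OF z] by simp
  qed (use R in auto)
  have "norm (f c) * (\<Prod>a\<in>A. (R / r) ^ n a) \<le> B"
  proof -
    have "norm (f c) = norm (g c) * (\<Prod>a\<in>A. norm (c - a) ^ n a)"
      using g(2)[of c] R by (simp add: norm_mult norm_power flip: prod_norm)
    also have "\<dots> \<le> norm (g c) * (\<Prod>a\<in>A. r ^ n a)"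
      using A(2) by (intro mult_left_mono prod_mono conjI power_mono) (auto simp: dist_norm)
    finally have "norm (f c) * (\<Prod>a\<in>A. (R / r) ^ n a) \<le> norm (g c) * (\<Prod>a\<in>A. r ^ n a) * (\<Prod>a\<in>A. (R / r) ^ n a)"
      using R by (intro mult_right_mono prod_nonneg) auto
    also have "\<dots> = norm (g c) * (\<Prod>a\<in>A. R ^ n a)"
      using R by (simp add: mult.assoc power_divide flip: prod.distrib)
    also have "\<dots> = norm (G c)"
      using R by (simp add: G_def norm_mult norm_power norm_divide power2_eq_square flip: prod_norm)
    finally show ?thesis using GB by linarith
  qed
  moreover have "(\<Prod>a\<in>A. (R / r) ^ n a) = (R / r) ^ (\<Sum>a\<in>A. n a)" by (simp add: power_sum)
  ultimately have "(R / r) ^ (\<Sum>a\<in>A. n a) \<le> B / norm (f c)" using fc by (simp add: field_simps)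
  hence "ln ((R / r) ^ (\<Sum>a\<in>A. n a)) \<le> ln (B / norm (f c))" using R by (intro ln_mono) auto
  hence "real (\<Sum>a\<in>A. n a) * ln (R / r) \<le> ln (B / norm (f c))" using R by (simp add: ln_realpow)
  moreover have "(\<Sum>a\<in>A. real_of_int (zorder f a)) \<le> real (\<Sum>a\<in>A. n a)"
    by (simp add: n_def) (intro sum_mono, linarith)
  moreover have "ln (R / r) \<ge> 0" using R by simp
  ultimately show ?thesis by (meson mult_right_mono order_trans)
qed

section \<open>The number of zeros of zeta in windows of ordinates\<close>

lemma zorder_zeta_pos:
  assumes "r \<in> nontrivial_zeros" shows "zorder zeta r \<ge> 1"
proof -
  have r: "r \<noteq> 1" "zeta r = 0" using assms by (auto simp: nontrivial_zeros_def)
  have "\<exists>w\<in>-{1}. zeta w \<noteq> 0" using moebius_has_sum(1)[of 2] by (intro bexI[of _ 2]) auto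
  from zorder_exist_zero[OF zeta_holomorphic _ _ _ this, of r] r
  show ?thesis by (auto simp: connected_punctured_universe open_Compl)
qed

text \<open>A nonconstant entire function has finitely many zeros in a compact rectangle. If
  \<open>zeta1\<close> were constant, \<open>1 / zeta s\<close> would be \<open>s - 1\<close>,
  contradicting its boundedness for \<open>Re s \<ge> 2\<close>.\<close>

lemma nontrivial_zeros_finite: "finite {r \<in> nontrivial_zeros. \<bar>Im r\<bar> \<le> x}"
proof -
  define K where "K = cbox (Complex 0 (-x)) (Complex 1 x)"
  have nc: "\<not> zeta1 constant_on UNIV"
  proof
    assume "zeta1 constant_on UNIV"
    then obtain w where w: "\<And>z. zeta1 z = w" unfolding constant_on_def by auto
    have "zeta z = 1 / (z - 1)" if "z \<noteq> 1" for z using w[of 1] w[of z] that by (simp add: zeta_eq_zeta1)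
    note const = this
    have z: "zeta (of_nat n + 2) = 1 / (of_nat n + 1)" for n
      using const[of "of_nat n + 2"] by (auto simp: complex_eq_iff)
    obtain B where B: "\<And>s. Re s \<ge> 2 \<Longrightarrow> norm (1 / zeta s) \<le> B"
      by (rule zeta_bounds_right[of 2]) auto
    have "real n + 1 \<le> B" for n
    proof -
      have "norm (1 / zeta (of_nat n + 2)) \<le> B" by (rule B) simp
      moreover have "1 / zeta (of_nat n + 2) = of_nat (Suc n)" by (simp add: z add.commute)
      ultimately have "norm (of_nat (Suc n) :: complex) \<le> B" by simp
      hence "real (Suc n) \<le> B" by (subst (asm) norm_of_nat)
      thus ?thesis by simp
    qed
    moreover obtain n where "B < real n" using reals_Archimedean2 by blast
    moreover from calculation(1)[of n] have "real n + 1 \<le> B" .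
    ultimately show False by linarith
  qed
  have "finite {z \<in> K. zeta1 z = 0}"
    by (rule holomorphic_compact_finite_zeros[OF zeta1_entire]) (use nc in \<open>auto simp: K_def\<close>)
  moreover have "{r \<in> nontrivial_zeros. \<bar>Im r\<bar> \<le> x} \<subseteq> {z \<in> K. zeta1 z = 0}"
    by (auto simp: nontrivial_zeros_def K_def in_cbox_complex_iff zeta1_def)
  ultimately show ?thesis by (rule rev_finite_subset)
qed

text \<open>Jensen's bound around \<open>2 + i * T\<close>. Radius \<open>21 / 10\<close> covers the
  window because \<open>2^2 + (1 / 2)^2 = 17 / 4 < (21 / 10)^2\<close>; radius \<open>5 / 2\<close>
  still stays in \<open>Re s \<ge> - 1 / 2\<close>, where zeta grows polynomially, and
  \<open>12 / 5\<close> fits between. At the centre \<open>\<bar>zeta\<bar>\<close> is at least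
  \<open>1 / B\<close>, and \<open>\<bar>T\<bar> \<ge> 5\<close> keeps the disc away from the
  pole.\<close>

lemma zero_window_count:
  obtains C where "C > 0" "\<And>T. \<bar>T\<bar> \<ge> 5 \<Longrightarrow> 
    (\<Sum>r | r \<in> nontrivial_zeros \<and> \<bar>Im r - T\<bar> \<le> 1 / 2. real_of_int (zorder zeta r)) \<le> C * ln (\<bar>T\<bar> + 6)"
proof -
  obtain K where K: "K > 0" "\<And>s. Re s \<ge> - 1 / 2 \<Longrightarrow> norm (zeta1 s) \<le> K * (1 + norm s) ^ 3"
    using zeta1_growth by metis
  obtain B where B: "B \<ge> 1" "\<And>s. Re s \<ge> 2 \<Longrightarrow> norm (1 / zeta s) \<le> B"
    by (rule zeta_bounds_right[of 2]) auto
  define q where "q = ln ((12/5) / (21/10) :: real)"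
  have q: "q > 0" by (simp add: q_def)
  define C where "C = (\<bar>ln (K * B)\<bar> + 3) / q"
  have C: "C > 0" using q by (simp add: C_def add_nonneg_pos)
  show ?thesis
  proof (rule that[OF C])
    fix T :: real assume T: "\<bar>T\<bar> \<ge> 5"
    define c where "c = Complex 2 T"
    define A where "A = {r. r \<in> nontrivial_zeros \<and> \<bar>Im r - T\<bar> \<le> 1 / 2}"
    have nb: "Re s \<ge> - 1 / 2" "\<bar>Im s\<bar> \<ge> 1" "norm s \<le> \<bar>T\<bar> + 5" if "dist c s \<le> 5 / 2" for s
    proof -
      have d: "norm (s - c) \<le> 5 / 2" using that by (simp add: dist_norm norm_minus_commute)
      show "Re s \<ge> - 1 / 2" using abs_Re_le_cmod[of "s - c"] d by (simp add: c_def)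
      show "\<bar>Im s\<bar> \<ge> 1" using abs_Im_le_cmod[of "s - c"] d T by (simp add: c_def)
      have "norm c \<le> 2 + \<bar>T\<bar>" using cmod_le[of c] by (simp add: c_def)
      thus "norm s \<le> \<bar>T\<bar> + 5" using norm_triangle_ineq[of "s - c" c] d by simp
    qed
    have "\<bar>Im r\<bar> \<le> \<bar>T\<bar> + 1" if "r \<in> A" for r
      using abs_triangle_ineq[of "Im r - T" T] that by (simp add: A_def)
    hence fin: "finite A"
      by (intro finite_subset[OF _ nontrivial_zeros_finite[of "\<bar>T\<bar> + 1"]]) (auto simp: A_def)
    have zc: "norm (zeta c) \<ge> 1 / B" "zeta c \<noteq> 0"
    proof -
      show nz: "zeta c \<noteq> 0" by (rule moebius_has_sum(1)) (simp add: c_def)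
      show "norm (zeta c) \<ge> 1 / B" using B(1) B(2)[of c] nz by (simp add: c_def norm_divide field_simps)
    qed
    have "(\<Sum>r\<in>A. real_of_int (zorder zeta r)) * ln ((12/5) / (21/10)) \<le> ln (K * (\<bar>T\<bar> + 6) ^ 3 / norm (zeta c))"
    proof (rule jensen_zero_count)
      show "zeta holomorphic_on ball c (5/2)"
        by (rule holomorphic_on_subset[OF zeta_holomorphic]) (use nb(2)[of 1] in auto)
      show "A \<subseteq> cball c (21 / 10)"
      proof
        fix a assume a: "a \<in> A"
        have "(norm (c - a))\<^sup>2 = (2 - Re a)\<^sup>2 + (T - Im a)\<^sup>2" by (simp add: cmod_power2 c_def)
        also have "\<dots> \<le> 2\<^sup>2 + (1/2)\<^sup>2"
          using a by (intro add_mono abs_le_square_iff[THEN iffD1]) (auto simp: A_def nontrivial_zeros_def abs_minus_commute[of T])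
        also have "\<dots> \<le> (21 / 10)\<^sup>2" by (simp add: power2_eq_square)
        finally have "norm (c - a) \<le> 21 / 10" by (rule power2_le_imp_le) simp
        thus "a \<in> cball c (21 / 10)" by (simp add: dist_norm)
      qed
      show "zeta a = 0" if "a \<in> A" for a using that by (simp add: A_def nontrivial_zeros_def)
      fix z assume z: "dist c z = 12 / 5"
      have z1: "z \<noteq> 1" using nb(2)[of z] z by auto
      have "norm (z - 1) \<ge> 1" using abs_Im_le_cmod[of "z - 1"] nb(2)[of z] z by simp
      hence "norm (zeta z) \<le> norm (zeta1 z) / 1"
        unfolding zeta_eq_zeta1[OF z1] norm_divide by (intro divide_left_mono) auto
      also have "\<dots> \<le> K * (1 + norm z) ^ 3" using K(2) nb(1)[of z] z by simp
      also have "\<dots> \<le> K * (\<bar>T\<bar> + 6) ^ 3" using K(1) nb(3)[of z] z by (intro mult_left_mono power_mono) auto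
      finally show "norm (zeta z) \<le> K * (\<bar>T\<bar> + 6) ^ 3" .
    qed (use fin zc in auto)
    also have "\<dots> \<le> ln (K * (\<bar>T\<bar> + 6) ^ 3 * B)"
    proof (rule ln_mono)
      have "1 / norm (zeta c) \<le> B" using B(2)[of c] by (simp add: c_def norm_divide)
      thus "K * (\<bar>T\<bar> + 6) ^ 3 / norm (zeta c) \<le> K * (\<bar>T\<bar> + 6) ^ 3 * B"
        using K(1) mult_left_mono[of "1 / norm (zeta c)" B "K * (\<bar>T\<bar> + 6) ^ 3"] by simp
    qed (use K zc in \<open>auto intro!: divide_pos_pos mult_pos_pos zero_less_power\<close>)
    also have "\<dots> = ln (K * B) + 3 * ln (\<bar>T\<bar> + 6)"
      using K(1) B(1) ln_mult[of "K * B" "(\<bar>T\<bar> + 6) ^ 3"] by (simp add: ln_realpow mult_ac)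
    also have "\<dots> \<le> (\<bar>ln (K * B)\<bar> + 3) * ln (\<bar>T\<bar> + 6)"
    proof -
      have "ln (exp 1) \<le> ln (\<bar>T\<bar> + 6)" using exp_le by (intro ln_mono) auto
      hence "\<bar>ln (K * B)\<bar> * 1 \<le> \<bar>ln (K * B)\<bar> * ln (\<bar>T\<bar> + 6)" by (intro mult_left_mono) auto
      thus ?thesis by (simp add: algebra_simps)
    qed
    finally have "(\<Sum>r\<in>A. real_of_int (zorder zeta r)) * q \<le> (\<bar>ln (K * B)\<bar> + 3) * ln (\<bar>T\<bar> + 6)"
      unfolding q_def .
    hence "(\<Sum>r\<in>A. real_of_int (zorder zeta r)) \<le> C * ln (\<bar>T\<bar> + 6)"
      using q by (simp add: C_def pos_le_divide_eq)
    thus "(\<Sum>r | r \<in> nontrivial_zeros \<and> \<bar>Im r - T\<bar> \<le> 1 / 2. real_of_int (zorder zeta r)) \<le> C * ln (\<bar>T\<bar> + 6)"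
      unfolding A_def .
  qed
qed

text \<open>Zeros are grouped by the absolute value \<open>k\<close> of the integer nearest to the
  ordinate. A group with \<open>k \<ge> 5\<close> lies in the two windows around \<open>k\<close>
  and \<open>- k\<close> and contributes \<open>O(ln k * k powr (-1 - \<epsilon>))\<close>; half of
  \<open>\<epsilon>\<close> absorbs the logarithm and the other half gives summability. The groups
  with \<open>k < 5\<close> are collected in the constant \<open>E\<close>.\<close>

lemma zeros_weighted_sum_bounded:
  assumes \<epsilon>: "\<epsilon> > 0"
  obtains C where "\<And>x. (\<Sum>r | r \<in> nontrivial_zeros \<and> \<bar>Im r\<bar> \<le> x. real_of_int (zorder zeta r) * \<bar>Im r\<bar> powr (-1 - \<epsilon>)) \<le> C"
proof -
  obtain C where C: "C > 0" "\<And>T. \<bar>T\<bar> \<ge> 5 \<Longrightarrow> 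
    (\<Sum>r | r \<in> nontrivial_zeros \<and> \<bar>Im r - T\<bar> \<le> 1 / 2. real_of_int (zorder zeta r)) \<le> C * ln (\<bar>T\<bar> + 6)"
    by (rule zero_window_count) blast
  define f where "f = (\<lambda>r. real_of_int (zorder zeta r) * \<bar>Im r\<bar> powr (-1 - \<epsilon>))"
  have f0: "f r \<ge> 0" if "r \<in> nontrivial_zeros" for r
    unfolding f_def using zorder_zeta_pos[OF that] by simp
  define E where "E = (\<Sum>r | r \<in> nontrivial_zeros \<and> \<bar>Im r\<bar> \<le> 6. f r)"
  define D where "D = 2 * C * 3 * (2 / \<epsilon>) * 2 powr (1 + \<epsilon>)"
  have win: "(\<Sum>r | r \<in> nontrivial_zeros \<and> \<bar>Im r\<bar> \<le> x \<and> nat \<bar>round (Im r)\<bar> = k. f r) \<le> D * real k powr (-1 - \<epsilon> / 2)"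
    if k: "k \<ge> 5" for k x
  proof -
    define S where "S = (\<lambda>T. {r \<in> nontrivial_zeros. \<bar>Im r - T\<bar> \<le> 1 / 2})"
    have fin: "finite (S T)" for T
    proof -
      have "\<bar>Im r\<bar> \<le> \<bar>T\<bar> + 1" if "r \<in> S T" for r
        using abs_triangle_ineq[of "Im r - T" T] that by (simp add: S_def)
      thus ?thesis by (intro finite_subset[OF _ nontrivial_zeros_finite[of "\<bar>T\<bar> + 1"]]) (auto simp: S_def)
    qed
    have sub: "{r. r \<in> nontrivial_zeros \<and> \<bar>Im r\<bar> \<le> x \<and> nat \<bar>round (Im r)\<bar> = k} \<subseteq> S (real k) \<union> S (- real k)"
    proof safe
      fix r assume r: "r \<in> nontrivial_zeros" "k = nat \<bar>round (Im r)\<bar>" "r \<notin> S (- real (nat \<bar>round (Im r)\<bar>))"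
      have "\<bar>Im r - of_int (round (Im r))\<bar> \<le> 1 / 2"
        using of_int_round_abs_le[of "Im r"] by (simp add: abs_minus_commute)
      thus "r \<in> S (real (nat \<bar>round (Im r)\<bar>))"
        using r by (cases "round (Im r) \<ge> 0") (auto simp: S_def)
    qed
    have each: "(\<Sum>r\<in>S T. f r) \<le> D / 2 * real k powr (-1 - \<epsilon> / 2)" if T: "\<bar>T\<bar> = real k" for T
    proof -
      have "(\<Sum>r\<in>S T. f r) \<le> (\<Sum>r\<in>S T. real_of_int (zorder zeta r) * (real k / 2) powr (-1 - \<epsilon>))"
        unfolding f_def
      proof (intro sum_mono mult_left_mono)
        fix r assume r: "r \<in> S T"
        have "real k / 2 \<le> \<bar>Im r\<bar>"
          using abs_triangle_ineq[of "T - Im r" "Im r"] r T k by (simp add: S_def abs_minus_commute)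
        thus "\<bar>Im r\<bar> powr (-1 - \<epsilon>) \<le> (real k / 2) powr (-1 - \<epsilon>)"
          using k \<epsilon> by (intro powr_mono2') auto
        show "real_of_int (zorder zeta r) \<ge> 0" using zorder_zeta_pos[of r] r by (simp add: S_def)
      qed
      also have "\<dots> = (\<Sum>r\<in>S T. real_of_int (zorder zeta r)) * (real k / 2) powr (-1 - \<epsilon>)"
        by (simp add: sum_distrib_right)
      also have "\<dots> \<le> (C * ln (real k + 6)) * (real k / 2) powr (-1 - \<epsilon>)"
        using C(2)[of T] T k by (intro mult_right_mono) (auto simp: S_def)
      also have "\<dots> \<le> (C * (3 * (2 / \<epsilon>) * real k powr (\<epsilon> / 2))) * (real k / 2) powr (-1 - \<epsilon>)"
      proof (intro mult_right_mono mult_left_mono)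
        have "ln (real k) \<ge> 1"
        proof -
          have "exp 1 \<le> real k" using exp_le k by linarith
          hence "ln (exp 1) \<le> ln (real k)" by (intro ln_mono) auto
          thus ?thesis by simp
        qed
        have "ln (real k + 6) \<le> ln (real k ^ 3)"
        proof (rule ln_mono)
          have "real k + 6 \<le> real k * 5" using k by simp
          also have "\<dots> \<le> real k * (real k)\<^sup>2"
            using k mult_mono[of 5 "real k" 1 "real k"] by (intro mult_left_mono) (auto simp: power2_eq_square)
          finally show "real k + 6 \<le> real k ^ 3" by (simp add: power3_eq_cube power2_eq_square)
        qed auto
        also have "\<dots> = 3 * ln (real k)" using k by (simp add: ln_realpow)
        also have "ln (real k) = (2 / \<epsilon>) * ln (real k powr (\<epsilon> / 2))" using k \<epsilon> by (simp add: ln_powr)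
        also have "3 * ((2 / \<epsilon>) * ln (real k powr (\<epsilon> / 2))) \<le> 3 * ((2 / \<epsilon>) * real k powr (\<epsilon> / 2))"
          using k \<epsilon> ln_bound[of "real k powr (\<epsilon> / 2)"] by (intro mult_left_mono) auto
        finally show "ln (real k + 6) \<le> 3 * (2 / \<epsilon>) * real k powr (\<epsilon> / 2)" by simp
      qed (use C in auto)
      also have "(real k / 2) powr (-1 - \<epsilon>) = real k powr (-1 - \<epsilon>) * 2 powr (1 + \<epsilon>)"
      proof -
        have "(real k / 2) powr (-1 - \<epsilon>) = real k powr (-1 - \<epsilon>) / 2 powr (-1 - \<epsilon>)" by (simp add: powr_divide)
        also have "2 powr (-1 - \<epsilon>) = 1 / (2::real) powr (1 + \<epsilon>)" using powr_minus_divide[of 2 "1 + \<epsilon>"] by simp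
        finally show ?thesis by simp
      qed
      also have "(C * (3 * (2 / \<epsilon>) * real k powr (\<epsilon> / 2))) * (real k powr (-1 - \<epsilon>) * 2 powr (1 + \<epsilon>)) = 
        D / 2 * (real k powr (\<epsilon> / 2) * real k powr (-1 - \<epsilon>))" by (simp add: D_def)
      also have "real k powr (\<epsilon> / 2) * real k powr (-1 - \<epsilon>) = real k powr (-1 - \<epsilon> / 2)"
      proof -
        have "\<epsilon> / 2 + (-1 - \<epsilon>) = -1 - \<epsilon> / 2" by simp
        thus ?thesis by (metis powr_add)
      qed
      finally show ?thesis .
    qed
    have "(\<Sum>r | r \<in> nontrivial_zeros \<and> \<bar>Im r\<bar> \<le> x \<and> nat \<bar>round (Im r)\<bar> = k. f r) \<le> (\<Sum>r\<in>S (real k) \<union> S (- real k). f r)"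
      by (rule sum_mono2[OF _ sub]) (use fin f0 in \<open>auto simp only: S_def finite_Un Un_iff mem_Collect_eq\<close>)
    also have "\<dots> \<le> (\<Sum>r\<in>S (real k). f r) + (\<Sum>r\<in>S (- real k). f r)"
      using sum.union_inter[OF fin[of "real k"] fin[of "- real k"], of f] sum_nonneg[of "S (real k) \<inter> S (- real k)" f] f0
      by (auto simp: S_def)
    also have "\<dots> \<le> D / 2 * real k powr (-1 - \<epsilon> / 2) + D / 2 * real k powr (-1 - \<epsilon> / 2)"
      by (intro add_mono each) auto
    finally show ?thesis by simp
  qed
  have D0: "D \<ge> 0" using C \<epsilon> by (simp add: D_def)
  define Z where "Z = (\<Sum>n. real (Suc n) powr (- (1 + \<epsilon> / 2)))"
  have Zs: "summable (\<lambda>n. real (Suc n) powr (- (1 + \<epsilon> / 2)))" using summable_Suc_powr[of "1 + \<epsilon> / 2" 1] \<epsilon> by simp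
  show ?thesis
  proof (rule that)
    fix x :: real
    define A where "A = {r. r \<in> nontrivial_zeros \<and> \<bar>Im r\<bar> \<le> x}"
    define w where "w = (\<lambda>r. nat \<bar>round (Im r)\<bar>)"
    have finA: "finite A" unfolding A_def using nontrivial_zeros_finite[of x] by simp
    define n where "n = Max (insert 0 (w ` A))"
    have wn: "w r \<le> n" if "r \<in> A" for r unfolding n_def using finA that by (intro Max_ge) auto
    have low: "(\<Sum>r\<in>{r \<in> A. w r < 5}. f r) \<le> E"
      unfolding E_def
    proof (rule sum_mono2)
      show "finite {r. r \<in> nontrivial_zeros \<and> \<bar>Im r\<bar> \<le> 6}" using nontrivial_zeros_finite[of 6] by simp
      show "{r \<in> A. w r < 5} \<subseteq> {r. r \<in> nontrivial_zeros \<and> \<bar>Im r\<bar> \<le> 6}"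
      proof safe
        fix r assume r: "r \<in> A" "w r < 5"
        have "\<bar>round (Im r)\<bar> < 5" using r(2) by (simp add: w_def)
        hence "\<bar>real_of_int (round (Im r))\<bar> < 5" by linarith
        thus "\<bar>Im r\<bar> \<le> 6" using of_int_round_abs_le[of "Im r"] by linarith
        show "r \<in> nontrivial_zeros" using r(1) by (simp add: A_def)
      qed
    qed (use f0 in auto)
    have high: "(\<Sum>r\<in>{r \<in> A. 5 \<le> w r}. f r) \<le> D * Z"
    proof -
      have "(\<Sum>r\<in>{r \<in> A. 5 \<le> w r}. f r) = (\<Sum>k=5..n. \<Sum>r\<in>{r \<in> {r \<in> A. 5 \<le> w r}. w r = k}. f r)"
        by (rule sum.group[symmetric]) (use finA wn in auto)
      also have "\<dots> \<le> (\<Sum>k=5..n. D * real k powr (-1 - \<epsilon> / 2))"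
      proof (rule sum_mono)
        fix k assume k: "k \<in> {5..n}"
        have "{r \<in> {r \<in> A. 5 \<le> w r}. w r = k} = {r. r \<in> nontrivial_zeros \<and> \<bar>Im r\<bar> \<le> x \<and> nat \<bar>round (Im r)\<bar> = k}"
          using k by (auto simp: A_def w_def)
        thus "(\<Sum>r\<in>{r \<in> {r \<in> A. 5 \<le> w r}. w r = k}. f r) \<le> D * real k powr (-1 - \<epsilon> / 2)"
          using win[of k x] k by simp
      qed
      also have "\<dots> = D * (\<Sum>k=5..n. real k powr (-1 - \<epsilon> / 2))" by (simp add: sum_distrib_left)
      also have "(\<Sum>k=5..n. real k powr (-1 - \<epsilon> / 2)) = (\<Sum>k\<in>{4..<n}. real (Suc k) powr (- (1 + \<epsilon> / 2)))"
        by (rule sum.reindex_bij_witness[of _ Suc "\<lambda>k. k - 1"]) (auto simp del: of_nat_Suc)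
      also have "D * (\<Sum>k\<in>{4..<n}. real (Suc k) powr (- (1 + \<epsilon> / 2))) \<le> D * Z"
        unfolding Z_def by (intro mult_left_mono sum_le_suminf Zs D0) auto
      finally show ?thesis .
    qed
    have "(\<Sum>r\<in>A. f r) = (\<Sum>r\<in>{r \<in> A. w r < 5} \<union> {r \<in> A. 5 \<le> w r}. f r)"
      by (rule sum.cong) auto
    also have "\<dots> = (\<Sum>r\<in>{r \<in> A. w r < 5}. f r) + (\<Sum>r\<in>{r \<in> A. 5 \<le> w r}. f r)"
      by (rule sum.union_disjoint) (use finA in auto)
    finally show "(\<Sum>r | r \<in> nontrivial_zeros \<and> \<bar>Im r\<bar> \<le> x. real_of_int (zorder zeta r) * \<bar>Im r\<bar> powr (-1 - \<epsilon>)) \<le> E + D * Z"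
      using low high by (simp add: A_def f_def)
  qed
qed

section \<open>The orders of magnitude\<close>

definition zero_sup :: real where
  "zero_sup = (SUP r \<in> nontrivial_zeros. Re r)"

lemma nontrivial_zeros_nonempty: "nontrivial_zeros \<noteq> {}"
proof -
  obtain s where s: "Re s > 1 / 8" "zeta1 s = 0" using zeta1_has_zero by blast
  have "s \<noteq> 1" using s by auto
  moreover have "Re s < 1" using zeta1_nonzero[of s] s by force
  ultimately have "s \<in> nontrivial_zeros" using s by (auto simp: nontrivial_zeros_def zeta1_def)
  thus ?thesis by blast
qed

lemma nontrivial_zero_Im: "r \<in> nontrivial_zeros \<Longrightarrow> Im r \<noteq> 0"
proof
  assume r: "r \<in> nontrivial_zeros" and "Im r = 0"
  hence "r = of_real (Re r)" by (simp add: complex_eq_iff)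
  thus False using zeta_real_nonzero[of "Re r"] r by (simp add: nontrivial_zeros_def)
qed

lemma nontrivial_zero_cnj: "r \<in> nontrivial_zeros \<Longrightarrow> cnj r \<in> nontrivial_zeros"
  using zeta_cnj[of r] by (cases "r = 1") (auto simp: nontrivial_zeros_def)

lemma Re_le_zero_sup: "r \<in> nontrivial_zeros \<Longrightarrow> Re r \<le> zero_sup"
  unfolding zero_sup_def by (rule cSUP_upper) (auto intro!: bdd_aboveI[of _ 1] simp: nontrivial_zeros_def)

lemma zero_sup_bounds: "0 < zero_sup" "zero_sup \<le> 1"
proof -
  obtain r where r: "r \<in> nontrivial_zeros" using nontrivial_zeros_nonempty by blast
  thus "0 < zero_sup" using Re_le_zero_sup[OF r] by (simp add: nontrivial_zeros_def)
  show "zero_sup \<le> 1" unfolding zero_sup_def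
    by (rule cSUP_least) (use nontrivial_zeros_nonempty in \<open>auto simp: nontrivial_zeros_def\<close>)
qed

text \<open>No nontrivial zero is real and conjugation preserves zeros, so a zero close to the
  supremum may be taken in the upper half-plane, over which \<open>Z_fun\<close> runs.\<close>

lemma zero_near_sup:
  assumes "\<tau> > 0" obtains r where "r \<in> nontrivial_zeros" "Im r > 0" "Re r > zero_sup - \<tau>"
proof -
  have "zero_sup - \<tau> < (SUP r \<in> nontrivial_zeros. Re r)" using assms by (simp add: zero_sup_def)
  moreover have bdd: "bdd_above (Re ` nontrivial_zeros)"
    by (auto intro!: bdd_aboveI[of _ 1] simp: nontrivial_zeros_def)
  ultimately obtain r where r: "r \<in> nontrivial_zeros" "Re r > zero_sup - \<tau>"
    using less_cSUP_iff[OF nontrivial_zeros_nonempty bdd] by blast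
  show ?thesis
  proof (cases "Im r > 0")
    case True
    thus ?thesis using r by (intro that[of r])
  next
    case False
    hence "Im (cnj r) > 0" using nontrivial_zero_Im[OF r(1)] by simp
    thus ?thesis using r nontrivial_zero_cnj by (intro that[of "cnj r"]) auto
  qed
qed

text \<open>Inside the strip this is the definition of the supremum; for \<open>Re s \<ge> 1\<close>
  it rests on the Euler product and the 3-4-1 inequality.\<close>

lemma zeta1_nonzero_right: "Re s > zero_sup \<Longrightarrow> zeta1 s \<noteq> 0"
  using zeta1_nonzero[of s] Re_le_zero_sup[of s] zero_sup_bounds(1)
  by (cases "s = 1"; cases "Re s \<ge> 1") (auto simp: zeta1_def nontrivial_zeros_def)

text \<open>The relation \<open>F x = x powr (\<theta> + o(1))\<close> as two one-sided bounds.
  Requiring \<open>c > 0\<close> makes \<open>F\<close> eventually positive, so that its logarithm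
  is meaningful.\<close>

definition has_order :: "(real \<Rightarrow> real) \<Rightarrow> real \<Rightarrow> bool" where
  "has_order F \<theta> \<longleftrightarrow> (\<forall>\<epsilon>>0. (\<exists>C. \<forall>\<^sub>F x in at_top. F x \<le> C * x powr (\<theta> + \<epsilon>)) \<and>
     (\<exists>c>0. \<forall>\<^sub>F x in at_top. F x \<ge> c * x powr (\<theta> - \<epsilon>)))"

lemma eventually_at_top_ge: "(\<And>x::real. a \<le> x \<Longrightarrow> P x) \<Longrightarrow> \<forall>\<^sub>F x in at_top. P x"
  by (rule eventually_mono[OF eventually_ge_at_top[of a]])

lemma eventually_le_powr:
  assumes "(\<epsilon>::real) > 0" shows "\<forall>\<^sub>F x in at_top. K \<le> x powr \<epsilon>"
  using eventually_ge_at_top[of "(\<bar>K\<bar> + 1) powr (1 / \<epsilon>)"]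
proof eventually_elim
  case (elim x)
  have "K \<le> ((\<bar>K\<bar> + 1) powr (1 / \<epsilon>)) powr \<epsilon>" using assms by (simp add: powr_powr)
  also have "\<dots> \<le> x powr \<epsilon>" using elim assms by (intro powr_mono2) auto
  finally show ?case .
qed

text \<open>For large \<open>x\<close> the constants are absorbed by another
  \<open>x powr \<epsilon>\<close>, so \<open>F x\<close> lies between the powers with exponents
  \<open>\<theta> - 2 * \<epsilon>\<close> and \<open>\<theta> + 2 * \<epsilon>\<close>.\<close>

lemma has_order_ln:
  assumes "has_order F \<theta>"
  shows "((\<lambda>x. ln (F x) / ln x) \<longlongrightarrow> \<theta>) at_top"
proof (rule tendstoI)
  fix e :: real assume e: "e > 0"
  define \<epsilon> where "\<epsilon> = e / 4"
  have \<epsilon>: "\<epsilon> > 0" using e by (simp add: \<epsilon>_def)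
  obtain C c where C: "\<forall>\<^sub>F x in at_top. F x \<le> C * x powr (\<theta> + \<epsilon>)" and c: "c > 0" "\<forall>\<^sub>F x in at_top. F x \<ge> c * x powr (\<theta> - \<epsilon>)"
    using assms \<epsilon> unfolding has_order_def by metis
  show "\<forall>\<^sub>F x in at_top. dist (ln (F x) / ln x) \<theta> < e"
    using C c(2) eventually_le_powr[OF \<epsilon>, of C] eventually_le_powr[OF \<epsilon>, of "1 / c"] eventually_gt_at_top[of 1]
  proof eventually_elim
    case (elim x)
    have lnx: "ln x > 0" using elim by simp
    have "F x \<le> x powr \<epsilon> * x powr (\<theta> + \<epsilon>)"
      by (rule order_trans[OF elim(1) mult_right_mono[OF elim(3)]]) simp
    also have "\<dots> = x powr (\<theta> + 2 * \<epsilon>)" by (simp add: algebra_simps flip: powr_add)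
    finally have up: "F x \<le> x powr (\<theta> + 2 * \<epsilon>)" .
    have "1 / x powr \<epsilon> \<le> c" using elim(4,5) c(1) by (simp add: field_simps)
    hence "1 / x powr \<epsilon> * x powr (\<theta> - \<epsilon>) \<le> c * x powr (\<theta> - \<epsilon>)" by (intro mult_right_mono) auto
    moreover have "x powr (\<theta> - 2 * \<epsilon>) = 1 / x powr \<epsilon> * x powr (\<theta> - \<epsilon>)"
      using powr_diff[of x "\<theta> - \<epsilon>" \<epsilon>] by simp
    ultimately have lo: "x powr (\<theta> - 2 * \<epsilon>) \<le> F x" using elim(2) by linarith
    have F0: "F x > 0" using lo elim(5) by (intro less_le_trans[OF _ lo]) simp
    have "ln (F x) \<le> ln (x powr (\<theta> + 2 * \<epsilon>))" using up F0 by (intro ln_mono) auto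
    moreover have "ln (x powr (\<theta> - 2 * \<epsilon>)) \<le> ln (F x)" using lo elim(5) by (intro ln_mono) auto
    ultimately have "ln (F x) / ln x \<le> \<theta> + 2 * \<epsilon>" "\<theta> - 2 * \<epsilon> \<le> ln (F x) / ln x"
      using lnx elim(5) by (auto simp: ln_powr field_simps)
    hence "\<bar>ln (F x) / ln x - \<theta>\<bar> \<le> 2 * \<epsilon>" by (simp add: abs_le_iff)
    thus ?case using e by (simp add: dist_real_def \<epsilon>_def)
  qed
qed

lemma has_order_asymp_eq:
  assumes "has_order F \<theta>" "has_order G \<theta>" "\<theta> > 0"
  shows "asymp_eq (\<lambda>x. ln (F x)) (\<lambda>x. ln (G x))"
proof -
  have "((\<lambda>x. (ln (F x) / ln x) / (ln (G x) / ln x)) \<longlongrightarrow> \<theta> / \<theta>) at_top"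
    by (intro tendsto_divide has_order_ln assms) (use assms in auto)
  moreover have "\<forall>\<^sub>F x in at_top. (ln (F x) / ln x) / (ln (G x) / ln x) = ln (F x) / ln (G x)"
    using eventually_gt_at_top[of "1::real"] by eventually_elim simp
  ultimately have "((\<lambda>x. ln (F x) / ln (G x)) \<longlongrightarrow> \<theta> / \<theta>) at_top"
    by (rule Lim_transform_eventually)
  thus ?thesis using assms(3) by (simp add: asymp_eq_def)
qed

text \<open>Upper bound: since \<open>\<bar>Im r\<bar> \<le> x\<close>, each
  \<open>1 / \<bar>Im r\<bar>\<close> is at most
  \<open>x powr \<epsilon> * \<bar>Im r\<bar> powr (-1 - \<epsilon>)\<close>, whose weighted sum is
  bounded. Lower bound: all terms are nonnegative, so one zero near the supremum suffices.\<close>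

lemma W_order: "has_order W_fun zero_sup"
  unfolding has_order_def
proof (intro allI impI conjI)
  fix \<epsilon> :: real assume \<epsilon>: "\<epsilon> > 0"
  obtain C where C: "\<And>x. (\<Sum>r | r \<in> nontrivial_zeros \<and> \<bar>Im r\<bar> \<le> x. real_of_int (zorder zeta r) * \<bar>Im r\<bar> powr (-1 - \<epsilon>)) \<le> C"
    using zeros_weighted_sum_bounded[OF \<epsilon>] by blast
  have "W_fun x \<le> C * x powr (zero_sup + \<epsilon>)" if x: "x \<ge> 1" for x
  proof -
    have "W_fun x \<le> (\<Sum>r | r \<in> nontrivial_zeros \<and> \<bar>Im r\<bar> \<le> x. x powr (zero_sup + \<epsilon>) * (real_of_int (zorder zeta r) * \<bar>Im r\<bar> powr (-1 - \<epsilon>)))"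
      unfolding W_fun_def
    proof (rule sum_mono)
      fix r assume r: "r \<in> {r. r \<in> nontrivial_zeros \<and> \<bar>Im r\<bar> \<le> x}"
      have g: "\<bar>Im r\<bar> > 0" using nontrivial_zero_Im r by auto
      have "x powr Re r \<le> x powr zero_sup" using r x Re_le_zero_sup[of r] by (intro powr_mono) auto
      moreover have "1 / \<bar>Im r\<bar> \<le> x powr \<epsilon> * \<bar>Im r\<bar> powr (-1 - \<epsilon>)"
      proof -
        have "1 / \<bar>Im r\<bar> = \<bar>Im r\<bar> powr \<epsilon> * \<bar>Im r\<bar> powr (-1 - \<epsilon>)"
          using g by (simp add: powr_minus_divide flip: powr_add)
        also have "\<dots> \<le> x powr \<epsilon> * \<bar>Im r\<bar> powr (-1 - \<epsilon>)"
          using r g \<epsilon> by (intro mult_right_mono powr_mono2) auto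
        finally show ?thesis .
      qed
      ultimately have "x powr Re r * (1 / \<bar>Im r\<bar>) \<le> x powr zero_sup * (x powr \<epsilon> * \<bar>Im r\<bar> powr (-1 - \<epsilon>))"
        by (intro mult_mono) auto
      hence "real_of_int (zorder zeta r) * (x powr Re r * (1 / \<bar>Im r\<bar>)) \<le> real_of_int (zorder zeta r) * (x powr zero_sup * (x powr \<epsilon> * \<bar>Im r\<bar> powr (-1 - \<epsilon>)))"
        using zorder_zeta_pos[of r] r by (intro mult_left_mono) auto
      thus "real_of_int (zorder zeta r) * (x powr Re r / \<bar>Im r\<bar>) \<le> x powr (zero_sup + \<epsilon>) * (real_of_int (zorder zeta r) * \<bar>Im r\<bar> powr (-1 - \<epsilon>))"
        by (simp add: powr_add mult_ac)
    qed
    also have "\<dots> = x powr (zero_sup + \<epsilon>) * (\<Sum>r | r \<in> nontrivial_zeros \<and> \<bar>Im r\<bar> \<le> x. real_of_int (zorder zeta r) * \<bar>Im r\<bar> powr (-1 - \<epsilon>))"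
      by (simp add: sum_distrib_left)
    also have "\<dots> \<le> x powr (zero_sup + \<epsilon>) * C" by (intro mult_left_mono C) auto
    finally show ?thesis by (simp add: mult.commute)
  qed
  thus "\<exists>C. \<forall>\<^sub>F x in at_top. W_fun x \<le> C * x powr (zero_sup + \<epsilon>)"
    by (intro exI[of _ C] eventually_at_top_ge[of 1])
  obtain r where r: "r \<in> nontrivial_zeros" "Im r > 0" "Re r > zero_sup - \<epsilon>" using zero_near_sup[OF \<epsilon>] by metis
  have "W_fun x \<ge> 1 / Im r * x powr (zero_sup - \<epsilon>)" if x: "x \<ge> max 1 (Im r)" for x
  proof -
    have "1 * (x powr (zero_sup - \<epsilon>) / Im r) \<le> real_of_int (zorder zeta r) * (x powr Re r / \<bar>Im r\<bar>)"
      using r x zorder_zeta_pos[OF r(1)] by (intro mult_mono divide_right_mono frac_le powr_mono) auto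
    also have "\<dots> \<le> W_fun x" unfolding W_fun_def
    proof (rule member_le_sum)
      fix s assume "s \<in> {r. r \<in> nontrivial_zeros \<and> \<bar>Im r\<bar> \<le> x} - {r}"
      thus "0 \<le> real_of_int (zorder zeta s) * (x powr Re s / \<bar>Im s\<bar>)" using zorder_zeta_pos[of s] by simp
    qed (use r x nontrivial_zeros_finite[of x] in auto)
    finally show ?thesis by simp
  qed
  thus "\<exists>c>0. \<forall>\<^sub>F x in at_top. W_fun x \<ge> c * x powr (zero_sup - \<epsilon>)"
    using r(2) by (intro exI[of _ "1 / Im r"] conjI eventually_at_top_ge[of "max 1 (Im r)"]) simp_all
qed

lemma Z_order: "has_order Z_fun zero_sup"
proof -
  define P where "P = {r \<in> nontrivial_zeros. Im r > 0}"
  \<comment> \<open>A positive lower bound for all positive ordinates: only finitely many are at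
    most 1, and the inserted 1 covers the rest. It makes the supremum in \<open>Z_fun\<close> one of
    a bounded set.\<close>
  define c where "c = Min (insert 1 (Im ` {r \<in> P. Im r \<le> 1}))"
  have fin: "finite {r \<in> P. Im r \<le> 1}"
    by (rule finite_subset[OF _ nontrivial_zeros_finite[of 1]]) (auto simp: P_def)
  have c: "c > 0" unfolding c_def using fin by (subst Min_gr_iff) (auto simp: P_def)
  have cle: "c \<le> Im r" if "r \<in> P" for r
  proof (cases "Im r \<le> 1")
    case True
    thus ?thesis unfolding c_def using fin that by (intro Min_le) auto
  next
    case False
    have "c \<le> 1" unfolding c_def using fin by (intro Min_le) auto
    thus ?thesis using False by simp
  qed
  have term_le: "x powr Re r / Im r \<le> x powr zero_sup / c" if "x \<ge> 1" "r \<in> P" for x r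
    using that c cle[OF that(2)] Re_le_zero_sup[of r] by (intro frac_le powr_mono) (auto simp: P_def)
  have bdd: "bdd_above ((\<lambda>r. x powr Re r / Im r) ` P)" if "x \<ge> 1" for x
    using term_le[OF that] by (intro bdd_aboveI[of _ "x powr zero_sup / c"]) auto
  have ne: "P \<noteq> {}" using zero_near_sup[of 1] by (auto simp: P_def)
  show ?thesis unfolding has_order_def
  proof (intro allI impI conjI)
    fix \<epsilon> :: real assume \<epsilon>: "\<epsilon> > 0"
    have "Z_fun x \<le> 1 / c * x powr (zero_sup + \<epsilon>)" if x: "x \<ge> 1" for x
    proof -
      have "Z_fun x \<le> x powr zero_sup / c"
        unfolding Z_fun_def P_def[symmetric] by (rule cSUP_least[OF ne]) (use term_le[OF x] in auto)
      also have "\<dots> \<le> x powr (zero_sup + \<epsilon>) / c" using x \<epsilon> c by (intro divide_right_mono powr_mono) auto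
      finally show ?thesis by simp
    qed
    thus "\<exists>C. \<forall>\<^sub>F x in at_top. Z_fun x \<le> C * x powr (zero_sup + \<epsilon>)"
      by (intro exI[of _ "1 / c"] eventually_at_top_ge[of 1])
    obtain r where r: "r \<in> nontrivial_zeros" "Im r > 0" "Re r > zero_sup - \<epsilon>" using zero_near_sup[OF \<epsilon>] by metis
    have "Z_fun x \<ge> 1 / Im r * x powr (zero_sup - \<epsilon>)" if x: "x \<ge> 1" for x
    proof -
      have "x powr (zero_sup - \<epsilon>) / Im r \<le> x powr Re r / Im r"
        using r x by (intro divide_right_mono powr_mono) auto
      also have "\<dots> \<le> Z_fun x"
        unfolding Z_fun_def P_def[symmetric] by (rule cSUP_upper[OF _ bdd[OF x]]) (use r in \<open>auto simp: P_def\<close>)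
      finally show ?thesis by simp
    qed
    thus "\<exists>c>0. \<forall>\<^sub>F x in at_top. Z_fun x \<ge> c * x powr (zero_sup - \<epsilon>)"
      using r(2) by (intro exI[of _ "1 / Im r"] conjI eventually_at_top_ge[of 1]) simp_all
  qed
qed

section \<open>The maxima and averages of \<open>M\<close>\<close>

lemma abs_mertens_bound:
  assumes "\<epsilon> > 0"
  obtains C where "C > 0" "\<And>u x. 0 \<le> u \<Longrightarrow> u \<le> x \<Longrightarrow> \<bar>mertens u\<bar> \<le> C * x powr (zero_sup + \<epsilon>)"
proof -
  obtain C where C: "C > 0" "\<And>n. n \<ge> 1 \<Longrightarrow> real_of_int \<bar>Mn n\<bar> \<le> C * real n powr (zero_sup + \<epsilon>)"
    using Mn_bound[of zero_sup \<epsilon>] zero_sup_bounds zeta1_nonzero_right assms by (metis less_imp_le)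
  show ?thesis
  proof (rule that[OF C(1)])
    fix u x :: real assume u: "0 \<le> u" "u \<le> x"
    define n where "n = nat \<lfloor>u\<rfloor>"
    have m: "\<bar>mertens u\<bar> = real_of_int \<bar>Mn n\<bar>" using u by (simp add: mertens_eq_Mn n_def)
    show "\<bar>mertens u\<bar> \<le> C * x powr (zero_sup + \<epsilon>)"
    proof (cases "n = 0")
      case True
      thus ?thesis using m C(1) by simp
    next
      case False
      have "real n \<le> x" using u by (simp add: n_def) linarith
      hence "C * real n powr (zero_sup + \<epsilon>) \<le> C * x powr (zero_sup + \<epsilon>)"
        using C(1) zero_sup_bounds assms by (intro mult_left_mono powr_mono2) auto
      thus ?thesis using m C(2)[of n] False by simp
    qed
  qed
qed

text \<open>The exponent \<open>a\<close> may be negative, as it can be for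
  \<open>zero_sup - \<epsilon>\<close>; the factor \<open>(1 / 2) powr \<bar>a\<bar>\<close> serves
  both signs.\<close>

lemma nat_floor_powr_ge:
  fixes x a :: real
  assumes "x \<ge> 1"
  shows "real (nat \<lfloor>x\<rfloor>) powr a \<ge> (1 / 2) powr \<bar>a\<bar> * x powr a" "x / 2 \<le> real (nat \<lfloor>x\<rfloor>)" "real (nat \<lfloor>x\<rfloor>) \<le> x" "nat \<lfloor>x\<rfloor> \<ge> 1"
proof -
  show N: "real (nat \<lfloor>x\<rfloor>) \<le> x" "nat \<lfloor>x\<rfloor> \<ge> 1" using assms by (auto simp: le_nat_iff le_floor_iff)
  have "x < real (nat \<lfloor>x\<rfloor>) + 1" using assms by linarith
  moreover have "real (nat \<lfloor>x\<rfloor>) \<ge> 1" using N(2) by linarith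
  ultimately show N2: "x / 2 \<le> real (nat \<lfloor>x\<rfloor>)" by linarith
  show "real (nat \<lfloor>x\<rfloor>) powr a \<ge> (1 / 2) powr \<bar>a\<bar> * x powr a"
  proof (cases "a \<ge> 0")
    case True
    have "(1 / 2) powr a * x powr a = (x / 2) powr a" using powr_mult[of "1/2" x a] by simp
    also have "\<dots> \<le> real (nat \<lfloor>x\<rfloor>) powr a" using N2 True assms by (intro powr_mono2) auto
    finally show ?thesis using True by simp
  next
    case False
    have "(1 / 2) powr \<bar>a\<bar> * x powr a \<le> 1 * x powr a" by (intro mult_right_mono) (auto intro: powr_le1)
    also have "\<dots> \<le> real (nat \<lfloor>x\<rfloor>) powr a" using N False assms by (simp, intro powr_mono2') auto
    finally show ?thesis .
  qed
qed

lemma sum_Mn_lower_real: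
  assumes "\<delta> > 0" "\<epsilon> > 0"
  shows "\<forall>\<^sub>F x::real in at_top. (\<Sum>n | 1 \<le> n \<and> n < nat \<lfloor>x\<rfloor> \<and> real (nat \<lfloor>x\<rfloor>) powr (1 - \<delta>) \<le> real n. real_of_int \<bar>Mn n\<bar>)
           \<ge> real (nat \<lfloor>x\<rfloor>) powr (1 + zero_sup - \<epsilon>)"
proof -
  have zeros: "\<exists>s. zeta1 s = 0 \<and> Re s > zero_sup - \<tau>" if pos: "\<tau> > 0" for \<tau>
  proof -
    obtain r where "r \<in> nontrivial_zeros" "Re r > zero_sup - \<tau>" using zero_near_sup[OF pos] by metis
    thus ?thesis by (intro exI[of _ r]) (auto simp: nontrivial_zeros_def zeta1_def)
  qed
  have "\<forall>\<^sub>F N in sequentially. (\<Sum>n | 1 \<le> n \<and> n < N \<and> real N powr (1 - \<delta>) \<le> real n. real_of_int \<bar>Mn n\<bar>) \<ge> real N powr (1 + zero_sup - \<epsilon>)"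
    by (rule sum_Mn_lower[OF zero_sup_bounds zeta1_nonzero_right zeros assms])
  then obtain N0 where N0: "\<And>N. N \<ge> N0 \<Longrightarrow> (\<Sum>n | 1 \<le> n \<and> n < N \<and> real N powr (1 - \<delta>) \<le> real n. real_of_int \<bar>Mn n\<bar>) \<ge> real N powr (1 + zero_sup - \<epsilon>)"
    by (auto simp: eventually_sequentially)
  show ?thesis by (rule eventually_at_top_ge[of "real N0"]) (intro N0 le_nat_floor)
qed

text \<open>A sum of fewer than \<open>N\<close> values that reaches
  \<open>N powr (1 + zero_sup - \<epsilon>)\<close> has a term of at least
  \<open>N powr (zero_sup - \<epsilon>)\<close>, provided all its indices lie in the window of the
  maximum.\<close>

lemma S_order:
  assumes \<delta>: "\<delta> > 0" shows "has_order (S_M \<delta>) zero_sup"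
  unfolding has_order_def
proof (intro allI impI conjI)
  fix \<epsilon> :: real assume \<epsilon>: "\<epsilon> > 0"
  have fin: "finite ((\<lambda>u. \<bar>mertens u\<bar>) ` {x powr (1 - \<delta>)..x})" for x
  proof (rule finite_subset)
    show "(\<lambda>u. \<bar>mertens u\<bar>) ` {x powr (1 - \<delta>)..x} \<subseteq> (\<lambda>n. real_of_int \<bar>Mn n\<bar>) ` {..nat \<lfloor>x\<rfloor>}"
    proof
      fix y assume "y \<in> (\<lambda>u. \<bar>mertens u\<bar>) ` {x powr (1 - \<delta>)..x}"
      then obtain u where u: "y = \<bar>mertens u\<bar>" "x powr (1 - \<delta>) \<le> u" "u \<le> x" by auto
      have "u \<ge> 0" using u(2) powr_ge_zero[of x "1 - \<delta>"] by linarith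
      thus "y \<in> (\<lambda>n. real_of_int \<bar>Mn n\<bar>) ` {..nat \<lfloor>x\<rfloor>}"
        using u by (intro image_eqI[of _ _ "nat \<lfloor>u\<rfloor>"]) (auto simp: mertens_eq_Mn intro!: nat_mono floor_mono)
    qed
  qed auto
  have ne: "{x powr (1 - \<delta>)..x} \<noteq> {}" if "x \<ge> 1" for x
  proof -
    have "x powr (1 - \<delta>) \<le> x powr 1" using that \<delta> by (intro powr_mono) auto
    thus ?thesis using that by simp
  qed
  obtain C where C: "C > 0" "\<And>u x. 0 \<le> u \<Longrightarrow> u \<le> x \<Longrightarrow> \<bar>mertens u\<bar> \<le> C * x powr (zero_sup + \<epsilon>)"
    using abs_mertens_bound[OF \<epsilon>] by metis
  have "S_M \<delta> x \<le> C * x powr (zero_sup + \<epsilon>)" if x: "x \<ge> 1" for x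
    unfolding S_M_def
  proof (rule Max.boundedI[OF fin])
    fix y assume "y \<in> (\<lambda>u. \<bar>mertens u\<bar>) ` {x powr (1 - \<delta>)..x}"
    then obtain u where u: "y = \<bar>mertens u\<bar>" "x powr (1 - \<delta>) \<le> u" "u \<le> x" by auto
    have "u \<ge> 0" using u(2) powr_ge_zero[of x "1 - \<delta>"] by linarith
    thus "y \<le> C * x powr (zero_sup + \<epsilon>)" using C(2)[of u x] u by simp
  qed (use ne[OF x] in simp)
  thus "\<exists>C. \<forall>\<^sub>F x in at_top. S_M \<delta> x \<le> C * x powr (zero_sup + \<epsilon>)"
    by (intro exI[of _ C] eventually_at_top_ge[of 1])
  \<comment> \<open>Halving leaves room for rounding \<open>x\<close> down to \<open>N\<close>: once
    \<open>x powr \<delta>' \<ge> 2\<close>, \<open>x powr (1 - \<delta>) \<le> (x / 2) powr (1 -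
    \<delta>') \<le> N powr (1 - \<delta>')\<close>. The minimum with 1 keeps the exponent
    \<open>1 - \<delta>'\<close> positive.\<close>
  define \<delta>' where "\<delta>' = min \<delta> 1 / 2"
  have \<delta>': "\<delta>' > 0" "2 * \<delta>' \<le> \<delta>" "\<delta>' \<le> 1 / 2" using \<delta> by (auto simp: \<delta>'_def)
  define c where "c = (1 / 2 :: real) powr \<bar>zero_sup - \<epsilon>\<bar>"
  have "\<forall>\<^sub>F x in at_top. S_M \<delta> x \<ge> c * x powr (zero_sup - \<epsilon>)"
    using sum_Mn_lower_real[OF \<delta>'(1) \<epsilon>] eventually_ge_at_top[of 1] eventually_le_powr[OF \<delta>'(1), of 2]
  proof eventually_elim
    case (elim x)
    define N where "N = nat \<lfloor>x\<rfloor>"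
    note N = nat_floor_powr_ge[OF elim(2), folded N_def]
    have ge: "\<bar>Mn n\<bar> \<le> S_M \<delta> x" if n: "n < N" "real N powr (1 - \<delta>') \<le> real n" for n
    proof -
      have "x powr (1 - \<delta>) \<le> x powr (1 - 2 * \<delta>')" using elim(2) \<delta>' by (intro powr_mono) auto
      also have "\<dots> = x powr (1 - \<delta>') / x powr \<delta>'" by (simp flip: powr_diff)
      also have "\<dots> \<le> x powr (1 - \<delta>') / 2" using elim(2,3) by (intro divide_left_mono) auto
      also have "\<dots> \<le> x powr (1 - \<delta>') / 2 powr (1 - \<delta>')"
        using \<delta>' powr_mono[of "1 - \<delta>'" 1 "2::real"] by (intro divide_left_mono) auto
      also have "\<dots> = (x / 2) powr (1 - \<delta>')" by (simp add: powr_divide)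
      also have "\<dots> \<le> real N powr (1 - \<delta>')" using N(2) elim(2) \<delta>' by (intro powr_mono2) auto
      finally have "x powr (1 - \<delta>) \<le> real n" using n by linarith
      moreover have "real n \<le> x" using n(1) N(3) by linarith
      ultimately have "\<bar>mertens (real n)\<bar> \<le> S_M \<delta> x"
        unfolding S_M_def by (intro Max_ge fin) auto
      thus ?thesis by (simp add: mertens_eq_Mn)
    qed
    have S0: "S_M \<delta> x \<ge> 0"
    proof -
      have "\<bar>mertens x\<bar> \<le> S_M \<delta> x" unfolding S_M_def using ne[OF elim(2)] by (intro Max_ge fin) auto
      thus ?thesis by linarith
    qed
    have "real N powr (1 + zero_sup - \<epsilon>) \<le> (\<Sum>n | 1 \<le> n \<and> n < N \<and> real N powr (1 - \<delta>') \<le> real n. real_of_int \<bar>Mn n\<bar>)"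
      using elim(1) by (simp add: N_def)
    also have "\<dots> \<le> (\<Sum>n | 1 \<le> n \<and> n < N \<and> real N powr (1 - \<delta>') \<le> real n. S_M \<delta> x)"
      by (rule sum_mono) (use ge in auto)
    also have "\<dots> \<le> (\<Sum>n<N. S_M \<delta> x)" by (rule sum_mono2) (use S0 in auto)
    also have "\<dots> = real N * S_M \<delta> x" by simp
    finally have "real N * real N powr (zero_sup - \<epsilon>) \<le> real N * S_M \<delta> x"
      using N(4) by (simp add: powr_diff powr_add)
    hence "real N powr (zero_sup - \<epsilon>) \<le> S_M \<delta> x" using N(4) by simp
    moreover have "c * x powr (zero_sup - \<epsilon>) \<le> real N powr (zero_sup - \<epsilon>)"
      using nat_floor_powr_ge(1)[OF elim(2), of "zero_sup - \<epsilon>"] by (simp add: c_def N_def)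
    ultimately show ?case by linarith
  qed
  thus "\<exists>c>0. \<forall>\<^sub>F x in at_top. S_M \<delta> x \<ge> c * x powr (zero_sup - \<epsilon>)"
    by (intro exI[of _ c]) (simp add: c_def)
qed

text \<open>On \<open>[n, n + 1)\<close> the function equals its value at \<open>n\<close>; the
  right endpoint, where it may jump, is a null set. Hence the sum stops before
  \<open>N\<close>.\<close>

lemma has_integral_abs_mertens:
  "((\<lambda>u. \<bar>mertens u\<bar>) has_integral (\<Sum>n<N. real_of_int \<bar>Mn n\<bar>)) {0..real N}"
proof (induction N)
  case 0
  show ?case by (simp add: has_integral_refl(2)[where a = "0::real", simplified])
next
  case (Suc N)
  have "((\<lambda>u. real_of_int \<bar>Mn N\<bar>) has_integral ((real (Suc N) - real N) *\<^sub>R real_of_int \<bar>Mn N\<bar>)) {real N..real (Suc N)}"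
    using has_integral_const_real[of "real_of_int \<bar>Mn N\<bar>" "real N" "real (Suc N)"] by simp
  hence "((\<lambda>u. real_of_int \<bar>Mn N\<bar>) has_integral real_of_int \<bar>Mn N\<bar>) {real N..real (Suc N)}" by simp
  hence "((\<lambda>u. \<bar>mertens u\<bar>) has_integral real_of_int \<bar>Mn N\<bar>) {real N..real (Suc N)}"
  proof (rule has_integral_spike_finite[rotated 2])
    fix u assume u: "u \<in> {real N..real (Suc N)} - {real (Suc N)}"
    hence "\<lfloor>u\<rfloor> = int N" by (auto simp: floor_eq_iff)
    thus "\<bar>mertens u\<bar> = real_of_int \<bar>Mn N\<bar>" using u by (simp add: mertens_eq_Mn)
  qed auto
  from has_integral_combine[OF _ _ Suc this] show ?case by simp
qed

lemma D_order: "has_order D_M zero_sup"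
  unfolding has_order_def
proof (intro allI impI conjI)
  fix \<epsilon> :: real assume \<epsilon>: "\<epsilon> > 0"
  let ?m = "\<lambda>u. \<bar>mertens u\<bar>"
  have int: "?m integrable_on {0..x}" if "x \<ge> 0" for x
  proof -
    have "?m integrable_on {0..real (nat \<lceil>x\<rceil>)}" using has_integral_abs_mertens has_integral_integrable by blast
    thus ?thesis by (rule integrable_on_subinterval) (use that in \<open>auto simp: real_nat_ceiling_ge intro: order_trans\<close>)
  qed
  obtain C where C: "C > 0" "\<And>u x. 0 \<le> u \<Longrightarrow> u \<le> x \<Longrightarrow> \<bar>mertens u\<bar> \<le> C * x powr (zero_sup + \<epsilon>)"
    using abs_mertens_bound[OF \<epsilon>] by metis
  have "D_M x \<le> C * x powr (zero_sup + \<epsilon>)" if x: "x \<ge> 1" for x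
  proof -
    have "integral {0..x} ?m \<le> integral {0..x} (\<lambda>u. C * x powr (zero_sup + \<epsilon>))"
      by (intro integral_le int) (use x C(2) in auto)
    also have "\<dots> = x * (C * x powr (zero_sup + \<epsilon>))" using x by simp
    finally show ?thesis using x by (simp add: D_M_def field_simps)
  qed
  thus "\<exists>C. \<forall>\<^sub>F x in at_top. D_M x \<le> C * x powr (zero_sup + \<epsilon>)"
    by (intro exI[of _ C] eventually_at_top_ge[of 1])
  define c where "c = (1 / 2 :: real) powr \<bar>1 + zero_sup - \<epsilon>\<bar>"
  have "\<forall>\<^sub>F x in at_top. D_M x \<ge> c * x powr (zero_sup - \<epsilon>)"
    using sum_Mn_lower_real[OF zero_less_one \<epsilon>] eventually_ge_at_top[of 1]
  proof eventually_elim
    case (elim x)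
    define N where "N = nat \<lfloor>x\<rfloor>"
    note N = nat_floor_powr_ge[OF elim(2), folded N_def]
    have "c * x powr (1 + zero_sup - \<epsilon>) \<le> real N powr (1 + zero_sup - \<epsilon>)"
      using nat_floor_powr_ge(1)[OF elim(2), of "1 + zero_sup - \<epsilon>"] by (simp add: c_def N_def)
    \<comment> \<open>The averaged bound is taken with \<open>\<delta> = 1\<close>, for which the
      lower end of the window is \<open>N powr 0 = 1\<close> and the whole range is covered.\<close>
    also have "\<dots> \<le> (\<Sum>n | 1 \<le> n \<and> n < N \<and> real N powr (1 - 1) \<le> real n. real_of_int \<bar>Mn n\<bar>)"
      using elim(1) by (simp add: N_def)
    also have "\<dots> \<le> (\<Sum>n<N. real_of_int \<bar>Mn n\<bar>)" by (rule sum_mono2) auto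
    also have "\<dots> = integral {0..real N} ?m" by (rule integral_unique[OF has_integral_abs_mertens, symmetric])
    also have "\<dots> \<le> integral {0..x} ?m" by (rule integral_subset_le) (use N elim(2) int in auto)
    finally have "c * (x * x powr (zero_sup - \<epsilon>)) \<le> integral {0..x} ?m"
      using elim(2) by (simp add: powr_diff powr_add)
    thus ?case using elim(2) by (simp add: D_M_def field_simps)
  qed
  thus "\<exists>c>0. \<forall>\<^sub>F x in at_top. D_M x \<ge> c * x powr (zero_sup - \<epsilon>)"
    by (intro exI[of _ c]) (simp add: c_def)
qed

theorem theorem2p2:
  fixes \<delta> :: real
  assumes "\<delta> > 0"
  shows "asymp_eq (\<lambda>x. ln (W_fun x)) (\<lambda>x. ln (D_M x)) \<and>
         asymp_eq (\<lambda>x. ln (D_M x)) (\<lambda>x. ln (S_M \<delta> x)) \<and>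
         asymp_eq (\<lambda>x. ln (S_M \<delta> x)) (\<lambda>x. ln (Z_fun x))"
  using has_order_asymp_eq[OF _ _ zero_sup_bounds(1)] W_order D_order S_order[OF assms] Z_order by blast

end
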